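(* Let $S$ be an inverse semigroup such that $E(S)$, the set of idempotents of $S$ with its natural partial order, is uniformly locally finite. Then the following are equivalent: (i) the semigroup algebra $\ell^{1}(S)$ is strong pseudo-amenable; (ii) each maximal subgroup $G_p$ ($p\in E(S)$) of $S$ is amenable and each $\mathfrak{D}$-class of $S$ contains only finitely many idempotent elements.
   Context: Strong pseudo-amenability: for a (complex) Banach algebra $A$, $A\otimes_p A$ is the projective tensor product, a Banach $A$-bimodule via $a\cdot(b\otimes c)=ab\otimes c$, $(b\otimes c)\cdot a=b\otimes ca$; $\pi_A:A\otimes_pA\to A$ is the bounded linear map with $\pi_A(a\otimes b)=ab$. For a Banach $A$-bimodule $X$, $X^*$ is a Banach $A$-bimodule via $(a\cdot f)(x)=f(x\cdot a)$, $(f\cdot a)(x)=f(a\cdot x)$; iterating, $(A\otimes_pA)^{**}$ and $A^{**}$ are Banach $A$-bimodules, and $A\subseteq A^{**}$ canonically. $A$ is strong pseudo-amenable if there is a (not necessarily bounded) net $(m_\alpha)$ in $(A\otimes_pA)^{**}$ such that for every $a\in A$: $a\cdot m_\alpha-m_\alpha\cdot a\to 0$ in norm, $a\,\pi_A^{**}(m_\alpha)=\pi_A^{**}(m_\alpha)\,a$ for all $\alpha$, and $\pi_A^{**}(m_\alpha)\,a\to a$ in norm. Semigroups: $S$ is an inverse semigroup if for each $s\in S$ there is a unique $s^*\in S$ with $ss^*s=s$ and $s^*ss^*=s^*$. $E(S)$ is the set of idempotents of $S$, partially ordered by $s\le t\iff s=st=ts$. A partially ordered set of this kind is uniformly locally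 finite if $\sup_x|(x]|<\infty$, where $(x]=\{y: y\le x\}$ (here $x,y$ range over $E(S)$). For $p\in E(S)$ the maximal subgroup at $p$ is $G_p=\{s\in S: ss^*=s^*s=p\}$, regarded as a discrete group. The equivalence relation $\mathfrak{D}$ on $S$ is given by $s\,\mathfrak{D}\,t$ iff there is $x\in S$ with $ss^*=xx^*$ and $t^*t=x^*x$. $\ell^1(S)$ is the Banach algebra with convolution product determined by $\delta_s\delta_t=\delta_{st}$. *)

theory Defs
  imports "HOL-Analysis.Analysis" "HOL-Algebra.Group"
begin

section \<open>Complex normed spaces and Banach algebras\<close>

class complex_normed_vector = real_normed_vector +
  fixes scaleC :: "complex \<Rightarrow> 'a \<Rightarrow> 'a" (infixr \<open>*\<^sub>C\<close> 75)
  assumes scaleC_add_right: "c *\<^sub>C (x + y) = c *\<^sub>C x + c *\<^sub>C y"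
    and scaleC_add_left: "(c + d) *\<^sub>C x = c *\<^sub>C x + d *\<^sub>C x"
    and scaleC_scaleC: "c *\<^sub>C d *\<^sub>C x = (c * d) *\<^sub>C x"
    and scaleC_of_real: "complex_of_real r *\<^sub>C x = r *\<^sub>R x"
    and norm_scaleC: "norm (c *\<^sub>C x) = cmod c * norm x"

class complex_banach_algebra = complex_normed_vector + real_normed_algebra + banach +
  assumes scaleC_mult_left: "(c *\<^sub>C x) * y = c *\<^sub>C (x * y)"
    and scaleC_mult_right: "x * (c *\<^sub>C y) = c *\<^sub>C (x * y)"

instantiation complex :: complex_normed_vector
begin
definition scaleC_complex :: "complex \<Rightarrow> complex \<Rightarrow> complex" where
  "scaleC_complex c x = c * x"
instance
  by standard (auto simp: scaleC_complex_def algebra_simps norm_mult scaleR_conv_of_real)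
end

lemma scaleC_one [simp]: "1 *\<^sub>C x = (x :: 'a::complex_normed_vector)"
  using scaleC_of_real[of 1 x] by simp

lemma scaleC_zero_right [simp]: "c *\<^sub>C 0 = (0 :: 'a::complex_normed_vector)"
  using norm_scaleC[of c "0 :: 'a"] by simp

lemma scaleC_minus_one: "(- 1) *\<^sub>C x = - (x :: 'a::complex_normed_vector)"
  using scaleC_of_real[of "-1" x] by simp

definition bounded_clinear :: "('a::complex_normed_vector \<Rightarrow> 'b::complex_normed_vector) \<Rightarrow> bool" where
  "bounded_clinear f \<longleftrightarrow> bounded_linear f \<and> (\<forall>c x. f (c *\<^sub>C x) = c *\<^sub>C f x)"

definition bounded_cbilinear ::
    "('a::complex_normed_vector \<Rightarrow> 'b::complex_normed_vector \<Rightarrow> 'c::complex_normed_vector) \<Rightarrow> bool" where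
  "bounded_cbilinear \<phi> \<longleftrightarrow> bounded_bilinear \<phi> \<and>
     (\<forall>c x y. \<phi> (c *\<^sub>C x) y = c *\<^sub>C \<phi> x y \<and> \<phi> x (c *\<^sub>C y) = c *\<^sub>C \<phi> x y)"

lemma bounded_cbilinear_times:
  "bounded_cbilinear ((*) :: 'a::complex_banach_algebra \<Rightarrow> 'a \<Rightarrow> 'a)"
  unfolding bounded_cbilinear_def
  by (simp add: bounded_bilinear_mult scaleC_mult_left scaleC_mult_right)

lemma bounded_clinear_compose:
  "bounded_clinear f \<Longrightarrow> bounded_clinear g \<Longrightarrow> bounded_clinear (\<lambda>x. f (g x))"
  unfolding bounded_clinear_def by (auto intro: bounded_linear_compose)

lemma bounded_bilinear_norm_le:
  assumes "bounded_bilinear \<phi>"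
  obtains K where "K \<ge> 0" "\<And>x y. norm (\<phi> x y) \<le> K * (norm x * norm y)"
  using bounded_bilinear.nonneg_bounded[OF assms] by (auto simp: mult.commute)

lemma bounded_cbilinear_compose:
  "bounded_clinear f \<Longrightarrow> bounded_cbilinear \<phi> \<Longrightarrow> bounded_cbilinear (\<lambda>x y. f (\<phi> x y))"
  unfolding bounded_clinear_def bounded_cbilinear_def
proof safe
  assume f: "bounded_linear f" and \<phi>: "bounded_bilinear \<phi>"
  interpret f: bounded_linear f by fact
  interpret b: bounded_bilinear \<phi> by fact
  obtain L where L: "L \<ge> 0" "\<And>z. norm (f z) \<le> norm z * L"
    using f.nonneg_bounded by blast
  obtain K where K: "K \<ge> 0" "\<And>x y. norm (\<phi> x y) \<le> K * (norm x * norm y)"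
    by (rule bounded_bilinear_norm_le[OF \<phi>]) blast
  have "norm (f (\<phi> x y)) \<le> norm x * norm y * (K * L)" for x y
    using order_trans[OF L(2) mult_right_mono[OF K(2) L(1)], of x y] by (simp add: ac_simps)
  then show "bounded_bilinear (\<lambda>x y. f (\<phi> x y))"
    by unfold_locales
       (auto simp: b.add_left b.add_right f.add b.scaleR_left b.scaleR_right f.scaleR)
qed auto

section \<open>Dual spaces\<close>

typedef (overloaded) 'a cdual = "{f :: 'a::complex_normed_vector \<Rightarrow> complex. bounded_clinear f}"
  morphisms dual_apply Abs_cdual
  by (rule exI[of _ "\<lambda>_. 0"]) (auto simp: bounded_clinear_def bounded_linear_zero)

setup_lifting type_definition_cdual

instantiation cdual :: (complex_normed_vector) complex_normed_vector
begin

lift_definition zero_cdual :: "'a cdual" is "\<lambda>_. 0"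
  by (simp add: bounded_clinear_def bounded_linear_zero)
lift_definition plus_cdual :: "'a cdual \<Rightarrow> 'a cdual \<Rightarrow> 'a cdual" is "\<lambda>f g x. f x + g x"
  by (auto simp: bounded_clinear_def bounded_linear_add scaleC_add_right)
lift_definition minus_cdual :: "'a cdual \<Rightarrow> 'a cdual \<Rightarrow> 'a cdual" is "\<lambda>f g x. f x - g x"
  by (auto simp: bounded_clinear_def bounded_linear_sub scaleC_complex_def algebra_simps)
lift_definition uminus_cdual :: "'a cdual \<Rightarrow> 'a cdual" is "\<lambda>f x. - f x"
  by (auto simp: bounded_clinear_def bounded_linear_minus scaleC_complex_def)
lift_definition scaleR_cdual :: "real \<Rightarrow> 'a cdual \<Rightarrow> 'a cdual" is "\<lambda>r f x. r *\<^sub>R f x"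
  by (auto simp: bounded_clinear_def bounded_linear_const_scaleR scaleC_complex_def)
lift_definition scaleC_cdual :: "complex \<Rightarrow> 'a cdual \<Rightarrow> 'a cdual" is "\<lambda>c f x. c * f x"
  by (auto simp: bounded_clinear_def bounded_linear_const_mult scaleC_complex_def)
lift_definition norm_cdual :: "'a cdual \<Rightarrow> real" is onorm .
definition dist_cdual :: "'a cdual \<Rightarrow> 'a cdual \<Rightarrow> real" where "dist_cdual f g = norm (f - g)"
definition sgn_cdual :: "'a cdual \<Rightarrow> 'a cdual" where "sgn_cdual f = inverse (norm f) *\<^sub>R f"
definition uniformity_cdual :: "('a cdual \<times> 'a cdual) filter" where
  "uniformity_cdual = (INF e\<in>{0 <..}. principal {(x, y). dist x y < e})"
definition open_cdual :: "'a cdual set \<Rightarrow> bool" where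
  "open_cdual U = (\<forall>x\<in>U. eventually (\<lambda>(x', y). x' = x \<longrightarrow> y \<in> U) uniformity)"

instance
proof
  fix f g :: "'a cdual" and a b :: complex and r s :: real
  show "norm (f + g) \<le> norm f + norm g"
    by transfer (simp add: bounded_clinear_def onorm_triangle)
  show "norm (r *\<^sub>R f) = \<bar>r\<bar> * norm f"
    by transfer (simp add: bounded_clinear_def onorm_scaleR)
  show "(norm f = 0) = (f = 0)"
    by transfer (auto simp: bounded_clinear_def onorm_eq_0 fun_eq_iff)
  show "norm (a *\<^sub>C f) = cmod a * norm f"
  proof transfer
    fix a and f :: "'a \<Rightarrow> complex"
    assume f: "bounded_clinear f"
    have "onorm (\<lambda>x. a * f x) = onorm (\<lambda>x. cmod a *\<^sub>R f x)"
      by (simp add: onorm_def norm_mult)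
    then show "onorm (\<lambda>x. a * f x) = cmod a * onorm f"
      using f by (simp add: bounded_clinear_def onorm_scaleR)
  qed
qed (unfold dist_cdual_def sgn_cdual_def uniformity_cdual_def open_cdual_def, 
     (transfer, auto simp: algebra_simps fun_eq_iff scaleR_conv_of_real)+)
end

lemma bounded_clinear_dual_apply: "bounded_clinear (dual_apply f)"
  using dual_apply by auto

text \<open>Hahn--Banach: bounded functionals separate points.  By Zorn's lemma there is a minimal
  sublinear functional below a given one, and minimal sublinear functionals are linear.\<close>

definition sublinear :: "('a::real_vector \<Rightarrow> real) \<Rightarrow> bool" where
  "sublinear q \<longleftrightarrow> (\<forall>x y. q (x + y) \<le> q x + q y) \<and> (\<forall>s>0. \<forall>x. q (s *\<^sub>R x) \<le> s * q x)"

lemma sublinear_0: assumes "sublinear q" shows "q 0 = 0"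
proof -
  have "q 0 \<le> (1/2) * q 0" "q 0 \<le> 2 * q 0"
    using assms[unfolded sublinear_def] by (metis half_gt_zero_iff scaleR_zero_right zero_less_one,
       metis scaleR_zero_right zero_less_numeral)
  then show ?thesis by simp
qed

lemma sublinear_scale: assumes "sublinear q" "s \<ge> 0" shows "q (s *\<^sub>R x) = s * q x"
proof (cases "s = 0")
  case False
  then have s: "s > 0" using assms by simp
  have "q (inverse s *\<^sub>R s *\<^sub>R x) \<le> inverse s * q (s *\<^sub>R x)"
    using assms s unfolding sublinear_def by (meson positive_imp_inverse_positive)
  then have "s * q x \<le> q (s *\<^sub>R x)" using s by (simp add: field_simps)
  moreover have "q (s *\<^sub>R x) \<le> s * q x" using assms s unfolding sublinear_def by blast
  ultimately show ?thesis by simp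
qed (use assms sublinear_0 in auto)

lemma sublinear_shrink:
  fixes q :: "'a::real_vector \<Rightarrow> real"
  assumes q: "sublinear q"
  obtains r where "sublinear r" "\<And>x. r x \<le> q x" "r (- y) \<le> - q y"
proof
  let ?S = "\<lambda>x. (\<lambda>t. q (x + t *\<^sub>R y) - t * q y) ` {0..}"
  let ?r = "\<lambda>x. Inf (?S x)"
  have add: "q (u + v) \<le> q u + q v" for u v using q unfolding sublinear_def by blast
  have bdd: "bdd_below (?S x)" for x
  proof (rule bdd_belowI2[of _ "- q (- x)"])
    fix t :: real assume "t \<in> {0..}"
    then have "t * q y = q ((x + t *\<^sub>R y) + - x)" using sublinear_scale[OF q] by simp
    also have "\<dots> \<le> q (x + t *\<^sub>R y) + q (- x)" by (rule add)
    finally show "- q (- x) \<le> q (x + t *\<^sub>R y) - t * q y" by simp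
  qed
  have le: "?r x \<le> q (x + t *\<^sub>R y) - t * q y" if "t \<ge> 0" for x t
    by (rule cInf_lower[OF _ bdd]) (use that in auto)
  have ex: "\<exists>t\<ge>0. q (x + t *\<^sub>R y) - t * q y < ?r x + e" if "e > 0" for x e
  proof -
    have "\<exists>z\<in>?S x. z < ?r x + e" by (rule cInf_lessD) (use that in auto)
    then show ?thesis by auto
  qed
  show "?r x \<le> q x" for x using le[of 0 x] by simp
  show "?r (- y) \<le> - q y" using le[of 1 "- y"] sublinear_0[OF q] by simp
  show "sublinear ?r" unfolding sublinear_def
  proof (intro conjI allI impI)
    fix x x' :: 'a
    show "?r (x + x') \<le> ?r x + ?r x'"
    proof (rule field_le_epsilon)
      fix e :: real assume "e > 0"
      then obtain t t' where t: "t \<ge> 0" "q (x + t *\<^sub>R y) - t * q y < ?r x + e/2"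
        "t' \<ge> 0" "q (x' + t' *\<^sub>R y) - t' * q y < ?r x' + e/2"
        using ex[of "e/2" x] ex[of "e/2" x'] by auto
      have "?r (x + x') \<le> q (x + x' + (t + t') *\<^sub>R y) - (t + t') * q y"
        using le t by simp
      also have "x + x' + (t + t') *\<^sub>R y = (x + t *\<^sub>R y) + (x' + t' *\<^sub>R y)"
        by (simp add: algebra_simps)
      also have "q \<dots> \<le> q (x + t *\<^sub>R y) + q (x' + t' *\<^sub>R y)" by (rule add)
      finally show "?r (x + x') \<le> ?r x + ?r x' + e" using t by (simp add: algebra_simps)
    qed
  next
    fix s :: real and x :: 'a assume s: "s > 0"
    show "?r (s *\<^sub>R x) \<le> s * ?r x"
    proof (rule field_le_epsilon)
      fix e :: real assume "e > 0"
      then obtain t where t: "t \<ge> 0" "q (x + t *\<^sub>R y) - t * q y < ?r x + e/s"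
        using ex[of "e/s" x] s by auto
      have "?r (s *\<^sub>R x) \<le> q (s *\<^sub>R x + (s * t) *\<^sub>R y) - (s * t) * q y"
        using le t s by simp
      also have "s *\<^sub>R x + (s * t) *\<^sub>R y = s *\<^sub>R (x + t *\<^sub>R y)" by (simp add: algebra_simps)
      also have "q \<dots> = s * q (x + t *\<^sub>R y)" using s sublinear_scale[OF q] by simp
      finally have "?r (s *\<^sub>R x) \<le> s * (q (x + t *\<^sub>R y) - t * q y)" by (simp add: algebra_simps)
      also have "\<dots> \<le> s * (?r x + e/s)" using t s by (intro mult_left_mono) auto
      finally show "?r (s *\<^sub>R x) \<le> s * ?r x + e" using s by (simp add: algebra_simps)
    qed
  qed
qed

lemma sublinear_minimal:
  fixes p :: "'a::real_vector \<Rightarrow> real"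
  assumes p: "sublinear p"
  obtains f where "linear f" "\<And>x. f x \<le> p x"
proof -
  let ?A = "{q. sublinear q \<and> (\<forall>x. q x \<le> p x)}"
  let ?P = "\<lambda>q r :: 'a \<Rightarrow> real. \<forall>x. r x \<le> q x"
  have "\<exists>m\<in>?A. \<forall>a\<in>?A. ?P m a \<longrightarrow> a = m"
  proof (rule predicate_Zorn)
    show "partial_order_on ?A (relation_of ?P ?A)"
      by (rule partial_order_on_relation_ofI) (auto intro!: ext intro: order_trans antisym)
  next
    fix C assume C: "C \<in> Chains (relation_of ?P ?A)"
    then have CA: "C \<subseteq> ?A" by (auto simp: Chains_def relation_of_def)
    have tot: "?P q r \<or> ?P r q" if "q \<in> C" "r \<in> C" for q r
      using C that by (auto simp: Chains_def relation_of_def)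
    show "\<exists>u\<in>?A. \<forall>a\<in>C. ?P a u"
    proof (cases "C = {}")
      case True then show ?thesis using p by blast
    next
      case False
      let ?u = "\<lambda>x. INF q\<in>C. q x"
      have bdd: "bdd_below ((\<lambda>q. q x) ` C)" for x
      proof (rule bdd_belowI2[of _ "- p (- x)"])
        fix q assume "q \<in> C"
        then have q: "sublinear q" "q (- x) \<le> p (- x)" using CA by auto
        have "q (x + - x) \<le> q x + q (- x)" using q unfolding sublinear_def by blast
        then show "- p (- x) \<le> q x" using q sublinear_0[OF q(1)] by simp
      qed
      have le: "?u x \<le> q x" if "q \<in> C" for q x
        by (rule cINF_lower[OF bdd that])
      have ex: "\<exists>q\<in>C. q x < ?u x + e" if "e > 0" for x e
      proof -
        have "\<exists>z\<in>(\<lambda>q. q x) ` C. z < ?u x + e" by (rule cInf_lessD) (use that False in auto)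
        then show ?thesis by auto
      qed
      have "sublinear ?u" unfolding sublinear_def
      proof (intro conjI allI impI)
        fix x y :: 'a
        show "?u (x + y) \<le> ?u x + ?u y"
        proof (rule field_le_epsilon)
          fix e :: real assume "e > 0"
          then obtain q r where qr: "q \<in> C" "r \<in> C" "q x < ?u x + e/2" "r y < ?u y + e/2"
            using ex[of "e/2" x] ex[of "e/2" y] by auto
          obtain k where k: "k \<in> C" "k x \<le> q x" "k y \<le> r y"
            using tot[OF qr(1,2)] qr(1,2) by (metis order_refl)
          have "?u (x + y) \<le> k (x + y)" by (rule le) fact
          also have "\<dots> \<le> k x + k y" using k CA unfolding sublinear_def by blast
          finally show "?u (x + y) \<le> ?u x + ?u y + e" using k qr by simp
        qed
      next
        fix s :: real and x :: 'a assume s: "s > 0"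
        show "?u (s *\<^sub>R x) \<le> s * ?u x"
        proof (rule field_le_epsilon)
          fix e :: real assume "e > 0"
          then obtain q where q: "q \<in> C" "q x < ?u x + e/s" using ex[of "e/s" x] s by auto
          have "?u (s *\<^sub>R x) \<le> q (s *\<^sub>R x)" by (rule le) fact
          also have "\<dots> \<le> s * q x" using q s CA unfolding sublinear_def by blast
          also have "\<dots> \<le> s * (?u x + e/s)" using q s by (intro mult_left_mono) auto
          finally show "?u (s *\<^sub>R x) \<le> s * ?u x + e" using s by (simp add: algebra_simps)
        qed
      qed
      moreover have "?u x \<le> p x" for x
        using False CA le by (metis (mono_tags, lifting) ex_in_conv mem_Collect_eq order_trans subsetD)
      ultimately have "?u \<in> ?A" by simp
      then show ?thesis using le by (intro bexI[of _ ?u]) auto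
    qed
  qed
  then obtain f where f: "sublinear f" "\<And>x. f x \<le> p x"
    and min: "\<And>a. sublinear a \<Longrightarrow> (\<And>x. a x \<le> p x) \<Longrightarrow> (\<And>x. a x \<le> f x) \<Longrightarrow> a = f" by blast
  have neg: "f (- y) = - f y" for y
  proof -
    obtain r where r: "sublinear r" "\<And>x. r x \<le> f x" "r (- y) \<le> - f y"
      by (rule sublinear_shrink[OF f(1)]) blast
    then have "r = f" using min f(2) order_trans by blast
    moreover have "f (y + - y) \<le> f y + f (- y)" using f(1) unfolding sublinear_def by blast
    ultimately show ?thesis using r(3) sublinear_0[OF f(1)] by simp
  qed
  have "linear f"
  proof (rule linearI)
    fix x y :: 'a and s :: real
    have sub: "f (u + v) \<le> f u + f v" for u v using f(1) unfolding sublinear_def by blast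
    have "f (- (x + y)) \<le> f (- x) + f (- y)" using sub[of "-x" "-y"] by simp
    then show "f (x + y) = f x + f y" using sub[of x y] by (simp only: neg)
    show "f (s *\<^sub>R x) = s *\<^sub>R f x"
    proof (cases "s \<ge> 0")
      case False
      have "f (s *\<^sub>R x) = - f ((- s) *\<^sub>R x)" using neg[of "s *\<^sub>R x"] by simp
      also have "\<dots> = s * f x" using sublinear_scale[OF f(1), of "- s" x] False by simp
      finally show ?thesis by simp
    qed (use sublinear_scale[OF f(1)] in simp)
  qed
  then show ?thesis using that f(2) by blast
qed

lemma cdual_separates:
  fixes x :: "'a::complex_normed_vector"
  assumes "\<And>f :: 'a \<Rightarrow> complex. bounded_clinear f \<Longrightarrow> f x = 0"
  shows "x = 0"
proof -
  have "sublinear (norm :: 'a \<Rightarrow> real)" by (auto simp: sublinear_def norm_triangle_ineq)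
  then obtain r where r: "sublinear r" "\<And>y. r y \<le> norm y" "r (- x) \<le> - norm x"
    by (rule sublinear_shrink) blast
  obtain f where f: "linear f" "\<And>y. f y \<le> r y" by (rule sublinear_minimal[OF r(1)]) blast
  have fb: "\<bar>f y\<bar> \<le> norm y" for y
  proof -
    have "f y \<le> norm y" "f (- y) \<le> norm (- y)" using f(2) r(2) order_trans by blast+
    then show ?thesis using linear_neg[OF f(1)] by (simp add: abs_le_iff)
  qed
  define F where "F y = Complex (f y) (- f (\<i> *\<^sub>C y))" for y
  have iadd: "\<i> *\<^sub>C (u + v) = \<i> *\<^sub>C u + \<i> *\<^sub>C v" for u v :: 'a by (rule scaleC_add_right)
  have iscale: "\<i> *\<^sub>C s *\<^sub>R u = s *\<^sub>R \<i> *\<^sub>C u" for s and u :: 'a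
    by (simp add: scaleC_scaleC mult.commute flip: scaleC_of_real)
  have lin: "linear F"
    by (rule linearI) (auto simp: F_def complex_eq_iff iadd iscale linear_add[OF f(1)] linear_scale[OF f(1)])
  have bl: "bounded_linear F"
  proof (rule linear_conv_bounded_linear[THEN iffD1] bounded_linear_intro)
    show "F (u + v) = F u + F v" "F (s *\<^sub>R u) = s *\<^sub>R F u" for u v s
      using linear_add[OF lin] linear_scale[OF lin] by auto
    show "norm (F u) \<le> norm u * 2" for u
    proof -
      have "norm (F u) \<le> \<bar>f u\<bar> + \<bar>f (\<i> *\<^sub>C u)\<bar>" using cmod_le[of "F u"] by (simp add: F_def)
      also have "\<dots> \<le> norm u + norm (\<i> *\<^sub>C u)" by (intro add_mono fb)
      finally show ?thesis by (simp add: norm_scaleC)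
    qed
  qed
  have "F (c *\<^sub>C u) = c * F u" for c u
  proof -
    have i: "F (\<i> *\<^sub>C u) = \<i> * F u" for u
      using linear_neg[OF f(1)] by (simp add: F_def scaleC_scaleC scaleC_minus_one complex_eq_iff)
    have "c *\<^sub>C u = Re c *\<^sub>R u + Im c *\<^sub>R \<i> *\<^sub>C u"
      by (simp add: scaleC_scaleC flip: scaleC_of_real scaleC_add_left)
         (metis complex_eq mult.commute)
    then have "F (c *\<^sub>C u) = Re c *\<^sub>R F u + Im c *\<^sub>R (\<i> * F u)"
      by (simp add: linear_add[OF lin] linear_scale[OF lin] i)
    also have "\<dots> = c * F u" by (simp add: complex_eq_iff)
    finally show ?thesis .
  qed
  then have "bounded_clinear F" using bl by (simp add: bounded_clinear_def scaleC_complex_def)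
  then have "F x = 0" by (rule assms)
  then have "f x = 0" by (simp add: F_def complex_eq_iff)
  then have "f (- x) = 0" using linear_neg[OF f(1)] by simp
  then show "x = 0" using f(2)[of "- x"] r(3) norm_ge_zero[of x]
    by (metis le_zero_eq neg_0_le_iff_le norm_eq_zero order_antisym order_trans)
qed

lemma convergent_of_abs_summable:
  fixes Y :: "nat \<Rightarrow> 'a::real_normed_vector"
  assumes sm: "\<And>X :: nat \<Rightarrow> 'a. summable (\<lambda>n. norm (X n)) \<Longrightarrow> summable X"
    and Y: "Cauchy Y"
  shows "convergent Y"
proof -
  have "\<exists>M. \<forall>m\<ge>M. \<forall>n\<ge>M. norm (Y m - Y n) < (1/2) ^ k" for k :: nat
    using Y by (auto simp: Cauchy_iff)
  then obtain M where M: "\<And>k m n. m \<ge> M k \<Longrightarrow> n \<ge> M k \<Longrightarrow> norm (Y m - Y n) < (1/2) ^ k"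
    by metis
  define r where "r = rec_nat (M 0) (\<lambda>k rk. max (Suc rk) (M (Suc k)))"
  have r_Suc: "r (Suc k) = max (Suc (r k)) (M (Suc k))" for k by (simp add: r_def)
  have mono: "strict_mono r" by (rule strict_monoI_Suc) (simp add: r_Suc)
  have rM: "r k \<ge> M k" for k by (cases k) (auto simp: r_def)
  define X where "X k = Y (r (Suc k)) - Y (r k)" for k
  have "norm (X k) \<le> (1/2) ^ k" for k
  proof -
    have "r (Suc k) \<ge> M k" using rM[of k] r_Suc[of k] by linarith
    then show ?thesis unfolding X_def using M rM less_imp_le by blast
  qed
  then have "summable (\<lambda>k. norm (X k))"
    by (intro summable_comparison_test'[OF summable_geometric, of "1/2 :: real" 0]) auto
  then have "X sums suminf X" using sm by blast
  then have "(\<lambda>n. Y (r n) - Y (r 0)) \<longlonglongrightarrow> suminf X"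
    by (simp add: sums_def X_def sum_lessThan_telescope[of "\<lambda>i. Y (r i)"])
  then have "(\<lambda>n. Y (r n) - Y (r 0) + Y (r 0)) \<longlonglongrightarrow> suminf X + Y (r 0)"
    by (intro tendsto_add tendsto_const)
  then have "(Y \<circ> r) \<longlonglongrightarrow> suminf X + Y (r 0)" by (simp add: o_def)
  then have "Y \<longlonglongrightarrow> suminf X + Y (r 0)"
    using Cauchy_converges_subseq[OF Y mono] by blast
  then show ?thesis by (auto simp: convergent_def)
qed

section \<open>The projective tensor product\<close>

text \<open>Every element of the projective tensor product \<open>X \<otimes>\<^sub>p Y\<close> is a series
  \<open>\<Sum>n. a n \<otimes> b n\<close> with \<open>\<Sum>n. \<parallel>a n\<parallel> \<parallel>b n\<parallel> < \<infinity>\<close>, its norm is the infimum of \<open>\<Sum>n. \<parallel>a n\<parallel> \<parallel>b n\<parallel>\<close>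
  over all such representations, and two series are equal iff all bounded bilinear forms agree
  on them.  The type is built from this description: an element is
  identified with the induced functional on bounded bilinear forms.  That this is the completion
  of the algebraic tensor product for the projective norm is confirmed below: the type is complete
  and has the universal property \<open>ptensor_universal\<close>, with control of the norm.\<close>

definition tensor_rep :: "(nat \<Rightarrow> 'a::real_normed_vector) \<Rightarrow> (nat \<Rightarrow> 'b::real_normed_vector) \<Rightarrow> bool" where
  "tensor_rep a b \<longleftrightarrow> summable (\<lambda>n. norm (a n) * norm (b n))"

definition tensor_series ::
    "(nat \<Rightarrow> 'a::complex_normed_vector) \<Rightarrow> (nat \<Rightarrow> 'b::complex_normed_vector) \<Rightarrow>
     ('a \<Rightarrow> 'b \<Rightarrow> complex) \<Rightarrow> complex" where
  "tensor_series a b = (\<lambda>\<phi>. if bounded_cbilinear \<phi> then \<Sum>n. \<phi> (a n) (b n) else 0)"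

typedef (overloaded) ('a, 'b) ptensor =
    "{tensor_series a b | (a :: nat \<Rightarrow> 'a::complex_normed_vector) (b :: nat \<Rightarrow> 'b::complex_normed_vector).
        tensor_rep a b}"
  morphisms eval_form Abs_ptensor
  by (auto simp: tensor_rep_def intro!: exI[of _ "\<lambda>_. 0"])

setup_lifting type_definition_ptensor

lemma tensor_rep_summable:
  fixes \<phi> :: "'a::complex_normed_vector \<Rightarrow> 'b::complex_normed_vector \<Rightarrow> 'c::{complex_normed_vector,banach}"
  assumes "tensor_rep a b" "bounded_cbilinear \<phi>"
  shows "summable (\<lambda>n. norm (\<phi> (a n) (b n)))" "summable (\<lambda>n. \<phi> (a n) (b n))"
proof -
  obtain K where K: "K \<ge> 0" "\<And>x y. norm (\<phi> x y) \<le> K * (norm x * norm y)"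
    using assms(2) bounded_bilinear_norm_le unfolding bounded_cbilinear_def by metis
  show "summable (\<lambda>n. norm (\<phi> (a n) (b n)))"
    by (rule summable_comparison_test'[of "\<lambda>n. K * (norm (a n) * norm (b n))" 0])
       (use assms(1) K in \<open>auto simp: tensor_rep_def intro!: summable_mult\<close>)
  then show "summable (\<lambda>n. \<phi> (a n) (b n))" by (rule summable_norm_cancel)
qed

lemma tensor_rep_norm_le:
  fixes \<phi> :: "'a::complex_normed_vector \<Rightarrow> 'b::complex_normed_vector \<Rightarrow> 'c::{complex_normed_vector,banach}"
  assumes "tensor_rep a b" "bounded_cbilinear \<phi>" "\<And>x y. norm (\<phi> x y) \<le> K * (norm x * norm y)"
  shows "norm (\<Sum>n. \<phi> (a n) (b n)) \<le> K * (\<Sum>n. norm (a n) * norm (b n))"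
proof -
  have "norm (\<Sum>n. \<phi> (a n) (b n)) \<le> (\<Sum>n. norm (\<phi> (a n) (b n)))"
    by (rule summable_norm) (rule tensor_rep_summable[OF assms(1,2)])
  also have "\<dots> \<le> (\<Sum>n. K * (norm (a n) * norm (b n)))"
    using assms tensor_rep_summable[OF assms(1,2)]
    by (intro suminf_le) (auto simp: tensor_rep_def intro!: summable_mult)
  also have "\<dots> = K * (\<Sum>n. norm (a n) * norm (b n))"
    using assms(1) by (intro suminf_mult) (simp add: tensor_rep_def)
  finally show ?thesis .
qed

lemma interleave_sums:
  assumes "f sums (x :: 'a::real_normed_vector)" "g sums y"
  shows "(\<lambda>n. if even n then f (n div 2) else g (n div 2)) sums (x + y)"
proof -
  have "(\<lambda>n. if even n then f (n div 2) else 0) sums x"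
    by (subst sums_mono_reindex[of "\<lambda>n. 2 * n", symmetric])
       (use assms in \<open>auto simp: strict_mono_def elim!: evenE\<close>)
  moreover have "(\<lambda>n. if even n then 0 else g (n div 2)) sums y"
    by (subst sums_mono_reindex[of "\<lambda>n. Suc (2 * n)", symmetric])
       (use assms in \<open>auto simp: strict_mono_def elim!: oddE\<close>)
  ultimately have "(\<lambda>n. (if even n then f (n div 2) else 0) + (if even n then 0 else g (n div 2))) sums (x + y)"
    by (rule sums_add)
  then show ?thesis by (rule sums_cong[THEN iffD1, rotated]) auto
qed

lemma tensor_series_add:
  fixes a a' :: "nat \<Rightarrow> 'a::complex_normed_vector" and b b' :: "nat \<Rightarrow> 'b::complex_normed_vector"
  assumes "tensor_rep a b" "tensor_rep a' b'"
  defines "c \<equiv> \<lambda>n. if even n then a (n div 2) else a' (n div 2)"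
    and "d \<equiv> \<lambda>n. if even n then b (n div 2) else b' (n div 2)"
  shows "tensor_rep c d"
    and "(\<Sum>n. norm (c n) * norm (d n)) =
           (\<Sum>n. norm (a n) * norm (b n)) + (\<Sum>n. norm (a' n) * norm (b' n))"
    and "tensor_series c d \<phi> = tensor_series a b \<phi> + tensor_series a' b' \<phi>"
proof -
  have *: "(\<lambda>n. norm (c n) * norm (d n)) =
      (\<lambda>n. if even n then norm (a (n div 2)) * norm (b (n div 2)) else norm (a' (n div 2)) * norm (b' (n div 2)))"
    by (auto simp: c_def d_def)
  have s: "(\<lambda>n. norm (c n) * norm (d n)) sums
      ((\<Sum>n. norm (a n) * norm (b n)) + (\<Sum>n. norm (a' n) * norm (b' n)))"
    unfolding * using assms(1,2) 
    by (intro interleave_sums[of "\<lambda>n. norm (a n) * norm (b n)" _ "\<lambda>n. norm (a' n) * norm (b' n)"] summable_sums) (simp_all add: tensor_rep_def)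
  show "tensor_rep c d" using s by (auto simp: tensor_rep_def sums_iff)
  show "(\<Sum>n. norm (c n) * norm (d n)) =
           (\<Sum>n. norm (a n) * norm (b n)) + (\<Sum>n. norm (a' n) * norm (b' n))"
    using s by (simp add: sums_iff)
  show "tensor_series c d \<phi> = tensor_series a b \<phi> + tensor_series a' b' \<phi>"
  proof (cases "bounded_cbilinear \<phi>")
    case True
    have "(\<lambda>n. \<phi> (c n) (d n)) =
        (\<lambda>n. if even n then \<phi> (a (n div 2)) (b (n div 2)) else \<phi> (a' (n div 2)) (b' (n div 2)))"
      by (auto simp: c_def d_def)
    then have "(\<lambda>n. \<phi> (c n) (d n)) sums ((\<Sum>n. \<phi> (a n) (b n)) + (\<Sum>n. \<phi> (a' n) (b' n)))"
      using interleave_sums[OF summable_sums summable_sums,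
          OF tensor_rep_summable(2)[OF assms(1) True] tensor_rep_summable(2)[OF assms(2) True]]
      by simp
    then show ?thesis using True by (simp add: tensor_series_def sums_iff)
  qed (simp add: tensor_series_def)
qed

lemma tensor_series_scale:
  fixes a :: "nat \<Rightarrow> 'a::complex_normed_vector" and b :: "nat \<Rightarrow> 'b::complex_normed_vector"
  assumes "tensor_rep a b"
  shows "tensor_rep (\<lambda>n. z *\<^sub>C a n) b"
    and "(\<Sum>n. norm (z *\<^sub>C a n) * norm (b n)) = cmod z * (\<Sum>n. norm (a n) * norm (b n))"
    and "tensor_series (\<lambda>n. z *\<^sub>C a n) b \<phi> = z * tensor_series a b \<phi>"
proof -
  have s: "summable (\<lambda>n. norm (a n) * norm (b n))" using assms by (simp add: tensor_rep_def)
  show "tensor_rep (\<lambda>n. z *\<^sub>C a n) b"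
    using summable_mult[OF s, of "cmod z"] by (simp add: tensor_rep_def norm_scaleC mult.assoc)
  show "(\<Sum>n. norm (z *\<^sub>C a n) * norm (b n)) = cmod z * (\<Sum>n. norm (a n) * norm (b n))"
    using suminf_mult[OF s, of "cmod z"] by (simp add: norm_scaleC mult.assoc)
  show "tensor_series (\<lambda>n. z *\<^sub>C a n) b \<phi> = z * tensor_series a b \<phi>"
  proof (cases "bounded_cbilinear \<phi>")
    case True
    then have "\<phi> (z *\<^sub>C x) y = z * \<phi> x y" for x y
      by (auto simp: bounded_cbilinear_def scaleC_complex_def)
    then show ?thesis
      using suminf_mult[OF tensor_rep_summable(2)[OF assms True], of z] True
      by (simp add: tensor_series_def)
  qed (simp add: tensor_series_def)
qed

instantiation ptensor :: (complex_normed_vector, complex_normed_vector) complex_normed_vector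
begin

lift_definition zero_ptensor :: "('a, 'b) ptensor" is "\<lambda>_. 0"
  by (auto intro!: exI[of _ "\<lambda>_. 0"] simp: tensor_rep_def tensor_series_def fun_eq_iff
      bounded_cbilinear_def bounded_bilinear.zero_left)
lift_definition plus_ptensor :: "('a, 'b) ptensor \<Rightarrow> ('a, 'b) ptensor \<Rightarrow> ('a, 'b) ptensor"
  is "\<lambda>S T \<phi>. S \<phi> + T \<phi>"
proof clarify
  fix a a' :: "nat \<Rightarrow> 'a" and b b' :: "nat \<Rightarrow> 'b"
  assume "tensor_rep a b" "tensor_rep a' b'"
  note add = tensor_series_add[OF this]
  show "\<exists>c d. (\<lambda>\<phi>. tensor_series a b \<phi> + tensor_series a' b' \<phi>) = tensor_series c d \<and> tensor_rep c d"
  proof (intro exI conjI)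
    show "(\<lambda>\<phi>. tensor_series a b \<phi> + tensor_series a' b' \<phi>) = tensor_series
        (\<lambda>n. if even n then a (n div 2) else a' (n div 2)) (\<lambda>n. if even n then b (n div 2) else b' (n div 2))"
      by (rule ext) (simp only: add(3))
  qed (rule add(1))
qed
lift_definition scaleC_ptensor :: "complex \<Rightarrow> ('a, 'b) ptensor \<Rightarrow> ('a, 'b) ptensor"
  is "\<lambda>z T \<phi>. z * T \<phi>"
proof clarify
  fix z and a :: "nat \<Rightarrow> 'a" and b :: "nat \<Rightarrow> 'b"
  assume "tensor_rep a b"
  note scale = tensor_series_scale[OF this]
  show "\<exists>c d. (\<lambda>\<phi>. z * tensor_series a b \<phi>) = tensor_series c d \<and> tensor_rep c d"
    using scale(1)[of z] by (auto simp: fun_eq_iff scale(3) intro!: exI[of _ "\<lambda>n. z *\<^sub>C a n"] exI[of _ b])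
qed
definition scaleR_ptensor :: "real \<Rightarrow> ('a, 'b) ptensor \<Rightarrow> ('a, 'b) ptensor" where
  "scaleR_ptensor r T = complex_of_real r *\<^sub>C T"
definition uminus_ptensor :: "('a, 'b) ptensor \<Rightarrow> ('a, 'b) ptensor" where
  "uminus_ptensor T = (- 1) *\<^sub>C T"
definition minus_ptensor :: "('a, 'b) ptensor \<Rightarrow> ('a, 'b) ptensor \<Rightarrow> ('a, 'b) ptensor" where
  "minus_ptensor S T = S + - T"
definition norm_ptensor :: "('a, 'b) ptensor \<Rightarrow> real" where
  "norm_ptensor T = Inf {\<Sum>n. norm (a n) * norm (b n) | a b.
     tensor_rep a b \<and> eval_form T = tensor_series a b}"
definition dist_ptensor :: "('a, 'b) ptensor \<Rightarrow> ('a, 'b) ptensor \<Rightarrow> real" where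
  "dist_ptensor S T = norm (S - T)"
definition sgn_ptensor :: "('a, 'b) ptensor \<Rightarrow> ('a, 'b) ptensor" where
  "sgn_ptensor T = inverse (norm T) *\<^sub>R T"
definition uniformity_ptensor :: "(('a, 'b) ptensor \<times> ('a, 'b) ptensor) filter" where
  "uniformity_ptensor = (INF e\<in>{0 <..}. principal {(x, y). dist x y < e})"
definition open_ptensor :: "('a, 'b) ptensor set \<Rightarrow> bool" where
  "open_ptensor U = (\<forall>x\<in>U. eventually (\<lambda>(x', y). x' = x \<longrightarrow> y \<in> U) uniformity)"

lemma norm_ptensor_le:
  assumes "tensor_rep a b" "eval_form T = tensor_series a b"
  shows "norm T \<le> (\<Sum>n. norm (a n) * norm (b n))"
  unfolding norm_ptensor_def
  by (rule cInf_lower)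
     (use assms in \<open>auto intro!: bdd_belowI[of _ 0] suminf_nonneg simp: tensor_rep_def\<close>)

lemma norm_ptensor_less:
  fixes T :: "('a, 'b) ptensor"
  assumes "norm T < e"
  obtains a b where "tensor_rep a b" "eval_form T = tensor_series a b"
    "(\<Sum>n. norm (a n) * norm (b n)) < e"
proof -
  have "\<exists>z\<in>{\<Sum>n. norm (a n) * norm (b n) | a b. tensor_rep a b \<and> eval_form T = tensor_series a b}. z < e"
    by (rule cInf_lessD) (use assms eval_form[of T] in \<open>auto simp: norm_ptensor_def\<close>)
  then show ?thesis using that by auto
qed

lemma norm_ptensor_ge_0: "norm (T :: ('a, 'b) ptensor) \<ge> 0"
  unfolding norm_ptensor_def
  by (rule cInf_greatest) (use eval_form[of T] in \<open>auto simp: tensor_rep_def intro!: suminf_nonneg\<close>)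

lemma eval_form_norm_le:
  fixes T :: "('a, 'b) ptensor"
  assumes "bounded_cbilinear \<phi>" "K \<ge> 0" "\<And>x y. norm (\<phi> x y) \<le> K * (norm x * norm y)"
  shows "norm (eval_form T \<phi>) \<le> K * norm T"
proof (rule field_le_epsilon)
  fix e :: real assume e: "e > 0"
  obtain a b where ab: "tensor_rep a b" "eval_form T = tensor_series a b"
    "(\<Sum>n. norm (a n) * norm (b n)) < norm T + e / (K + 1)"
    by (rule norm_ptensor_less[of T "norm T + e / (K + 1)"]) (use e assms(2) in auto)
  have "norm (eval_form T \<phi>) \<le> K * (\<Sum>n. norm (a n) * norm (b n))"
    using tensor_rep_norm_le[OF ab(1) assms(1,3)] assms(1) by (simp add: ab(2) tensor_series_def)
  also have "\<dots> \<le> K * (norm T + e / (K + 1))" using ab(3) assms(2) by (intro mult_left_mono) auto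
  also have "\<dots> \<le> K * norm T + e" using assms(2) e by (simp add: field_simps)
  finally show "norm (eval_form T \<phi>) \<le> K * norm T + e" .
qed

lemma eval_form_unbounded: "\<not> bounded_cbilinear \<phi> \<Longrightarrow> eval_form T \<phi> = 0"
  using eval_form[of T] by (auto simp: tensor_series_def)

lemma ptensor_eqI:
  "(\<And>\<phi>. bounded_cbilinear \<phi> \<Longrightarrow> eval_form S \<phi> = eval_form T \<phi>) \<Longrightarrow> S = T"
  by (metis eval_form_inject eval_form_unbounded ext)

lemma norm_ptensor_scaleC_le: "norm (z *\<^sub>C T) \<le> cmod z * norm (T :: ('a, 'b) ptensor)"
proof (rule field_le_epsilon)
  fix e :: real assume e: "e > 0"
  obtain a b where ab: "tensor_rep a b" "eval_form T = tensor_series a b"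
    "(\<Sum>n. norm (a n) * norm (b n)) < norm T + e / (cmod z + 1)"
    by (rule norm_ptensor_less[of T "norm T + e / (cmod z + 1)"]) (use e in \<open>auto simp: add_nonneg_pos\<close>)
  have "norm (z *\<^sub>C T) \<le> cmod z * (\<Sum>n. norm (a n) * norm (b n))"
    using norm_ptensor_le[OF tensor_series_scale(1)[OF ab(1)], of "z *\<^sub>C T" z]
    by (simp add: tensor_series_scale[OF ab(1)] ab(2) scaleC_ptensor.rep_eq fun_eq_iff)
  also have "\<dots> \<le> cmod z * (norm T + e / (cmod z + 1))" using ab(3) by (intro mult_left_mono) auto
  also have "\<dots> \<le> cmod z * norm T + e"
    using e norm_ge_zero[of z] by (simp add: field_simps add_nonneg_pos del: norm_ge_zero)
  finally show "norm (z *\<^sub>C T) \<le> cmod z * norm T + e" .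
qed

instance
proof
  fix S T U :: "('a, 'b) ptensor" and z w :: complex and r s :: real
  note [simp] = scaleR_ptensor_def uminus_ptensor_def minus_ptensor_def
  show "S + T + U = S + (T + U)" "S + T = T + S" "0 + S = S"
    and C: "z *\<^sub>C (S + T) = z *\<^sub>C S + z *\<^sub>C T" "(z + w) *\<^sub>C S = z *\<^sub>C S + w *\<^sub>C S"
    "z *\<^sub>C w *\<^sub>C S = (z * w) *\<^sub>C S" for z w
    by (transfer, auto simp: algebra_simps fun_eq_iff)+
  show "- S + S = 0" "1 *\<^sub>R S = S" unfolding uminus_ptensor_def scaleR_ptensor_def
    by (transfer, auto)+
  show "r *\<^sub>R (S + T) = r *\<^sub>R S + r *\<^sub>R T" "(r + s) *\<^sub>R S = r *\<^sub>R S + s *\<^sub>R S"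
    "r *\<^sub>R s *\<^sub>R S = (r * s) *\<^sub>R S"
    by (simp_all add: C)
  show "S - T = S + - T" "complex_of_real r *\<^sub>C S = r *\<^sub>R S" by simp_all
  show nC: "norm (z *\<^sub>C S) = cmod z * norm S" for z
  proof (cases "z = 0")
    case True
    then show ?thesis using norm_ptensor_scaleC_le[of 0 S] norm_ptensor_ge_0[of "0 *\<^sub>C S"] by simp
  next
    case False
    have "inverse z *\<^sub>C z *\<^sub>C S = S" using False by transfer (simp add: fun_eq_iff)
    then have "norm S \<le> inverse (cmod z) * norm (z *\<^sub>C S)"
      using norm_ptensor_scaleC_le[of "inverse z" "z *\<^sub>C S"] by (simp add: norm_inverse)
    then show ?thesis using norm_ptensor_scaleC_le[of z S] False by (simp add: field_simps)
  qed
  show "norm (r *\<^sub>R S) = \<bar>r\<bar> * norm S" by (simp add: nC)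
  show "norm (S + T) \<le> norm S + norm T"
  proof (rule field_le_epsilon)
    fix e :: real assume e: "e > 0"
    obtain a b where ab: "tensor_rep a b" "eval_form S = tensor_series a b"
      "(\<Sum>n. norm (a n) * norm (b n)) < norm S + e / 2"
      by (rule norm_ptensor_less[of S "norm S + e / 2"]) (use e in auto)
    obtain c d where cd: "tensor_rep c d" "eval_form T = tensor_series c d"
      "(\<Sum>n. norm (c n) * norm (d n)) < norm T + e / 2"
      by (rule norm_ptensor_less[of T "norm T + e / 2"]) (use e in auto)
    note add = tensor_series_add[OF ab(1) cd(1)]
    have "norm (S + T) \<le> (\<Sum>n. norm (a n) * norm (b n)) + (\<Sum>n. norm (c n) * norm (d n))"
      unfolding add(2)[symmetric]
      by (rule norm_ptensor_le[OF add(1)]) (simp add: fun_eq_iff add(3) plus_ptensor.rep_eq ab(2) cd(2))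
    then show "norm (S + T) \<le> norm S + norm T + e" using ab cd by simp
  qed
  show "(norm S = 0) = (S = 0)"
  proof
    assume S: "norm S = 0"
    show "S = 0"
    proof (rule ptensor_eqI)
      fix \<phi> :: "'a \<Rightarrow> 'b \<Rightarrow> complex" assume \<phi>: "bounded_cbilinear \<phi>"
      obtain K where "K \<ge> 0" "\<And>x y. norm (\<phi> x y) \<le> K * (norm x * norm y)"
        using \<phi> bounded_bilinear_norm_le unfolding bounded_cbilinear_def by metis
      then have "norm (eval_form S \<phi>) \<le> 0" using eval_form_norm_le[OF \<phi>, of K S] S by simp
      then show "eval_form S \<phi> = eval_form 0 \<phi>" by (simp add: zero_ptensor.rep_eq)
    qed
  next
    assume S: "S = 0"
    have "0 *\<^sub>C S = S" using S by transfer simp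
    then show "norm S = 0" using nC[of 0] by simp
  qed
qed (auto simp: dist_ptensor_def sgn_ptensor_def uniformity_ptensor_def open_ptensor_def)

end

lemma eval_form_simps [simp]:
  "eval_form 0 \<phi> = 0" "eval_form (S + T) \<phi> = eval_form S \<phi> + eval_form T \<phi>"
  "eval_form (S - T) \<phi> = eval_form S \<phi> - eval_form T \<phi>"
  "eval_form (z *\<^sub>C T) \<phi> = z * eval_form T \<phi>"
  "eval_form (r *\<^sub>R T) \<phi> = r *\<^sub>R eval_form T \<phi>"
  by (simp_all add: zero_ptensor.rep_eq plus_ptensor.rep_eq minus_ptensor_def uminus_ptensor_def
      scaleC_ptensor.rep_eq scaleR_ptensor_def scaleR_conv_of_real)

lemma eval_form_sum [simp]: "eval_form (sum X A) \<phi> = (\<Sum>i\<in>A. eval_form (X i) \<phi>)"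
  by (induction A rule: infinite_finite_induct) auto

lift_definition tensor :: "'a::complex_normed_vector \<Rightarrow> 'b::complex_normed_vector \<Rightarrow> ('a, 'b) ptensor"
  is "\<lambda>x y \<phi>. if bounded_cbilinear \<phi> then \<phi> x y else 0"
proof -
  fix x :: 'a and y :: 'b
  let ?a = "\<lambda>n::nat. if n = 0 then x else 0"
  have 1: "tensor_rep ?a (\<lambda>_. y)"
    unfolding tensor_rep_def by (rule summable_finite[of "{0}"]) auto
  have "(\<Sum>n. \<phi> (?a n) y) = \<phi> x y" if "bounded_cbilinear \<phi>" for \<phi> :: "'a \<Rightarrow> 'b \<Rightarrow> complex"
  proof -
    have "\<phi> 0 y = 0"
      using that bounded_bilinear.zero_left unfolding bounded_cbilinear_def by blast
    then have "(\<Sum>n. \<phi> (?a n) y) = (\<Sum>n\<in>{0}. \<phi> (?a n) y)" by (intro suminf_finite) auto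
    then show ?thesis by simp
  qed
  then have "(\<lambda>\<phi>. if bounded_cbilinear \<phi> then \<phi> x y else 0) = tensor_series ?a (\<lambda>_. y)"
    by (auto simp: tensor_series_def fun_eq_iff)
  then show "\<exists>a b. (\<lambda>\<phi>. if bounded_cbilinear \<phi> then \<phi> x y else 0) = tensor_series a b \<and> tensor_rep a b"
    using 1 by blast
qed

lemma eval_form_tensor [simp]: "bounded_cbilinear \<phi> \<Longrightarrow> eval_form (tensor x y) \<phi> = \<phi> x y"
  by transfer simp

lemma norm_tensor_le: "norm (tensor x y) \<le> norm x * norm y"
proof -
  let ?a = "\<lambda>n::nat. if n = 0 then x else 0"
  have 1: "tensor_rep ?a (\<lambda>_. y)"
    unfolding tensor_rep_def by (rule summable_finite[of "{0}"]) auto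
  have "(\<Sum>n. \<phi> (?a n) y) = \<phi> x y" if "bounded_cbilinear \<phi>" for \<phi> :: "'a \<Rightarrow> 'b \<Rightarrow> complex"
  proof -
    have "\<phi> 0 y = 0"
      using that bounded_bilinear.zero_left unfolding bounded_cbilinear_def by blast
    then have "(\<Sum>n. \<phi> (?a n) y) = (\<Sum>n\<in>{0}. \<phi> (?a n) y)" by (intro suminf_finite) auto
    then show ?thesis by simp
  qed
  then have "norm (tensor x y) \<le> (\<Sum>n. norm (?a n) * norm y)"
    by (intro norm_ptensor_le 1) (auto simp: tensor.rep_eq tensor_series_def fun_eq_iff)
  also have "\<dots> = (\<Sum>n\<in>{0}. norm (?a n) * norm y)" by (intro suminf_finite) auto
  finally show ?thesis by simp
qed

lemma bounded_cbilinear_tensor: "bounded_cbilinear tensor"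
  unfolding bounded_cbilinear_def
proof (intro conjI allI)
  have E: "bounded_bilinear \<phi> \<and> (\<forall>c x y. \<phi> (c *\<^sub>C x) y = c * \<phi> x y \<and> \<phi> x (c *\<^sub>C y) = c * \<phi> x y)"
    if "bounded_cbilinear \<phi>" for \<phi> :: "'a \<Rightarrow> 'b \<Rightarrow> complex"
    using that by (auto simp: bounded_cbilinear_def scaleC_complex_def)
  show "bounded_bilinear (tensor :: 'a \<Rightarrow> 'b \<Rightarrow> _)"
  proof
    fix x x' :: 'a and y y' :: 'b and r :: real
    show "tensor (x + x') y = tensor x y + tensor x' y"
      by (rule ptensor_eqI) (use E in \<open>auto simp: bounded_bilinear.add_left\<close>)
    show "tensor x (y + y') = tensor x y + tensor x y'"
      by (rule ptensor_eqI) (use E in \<open>auto simp: bounded_bilinear.add_right\<close>)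
    show "tensor (r *\<^sub>R x) y = r *\<^sub>R tensor x y"
      by (rule ptensor_eqI) (use E in \<open>auto simp: bounded_bilinear.scaleR_left\<close>)
    show "tensor x (r *\<^sub>R y) = r *\<^sub>R tensor x y"
      by (rule ptensor_eqI) (use E in \<open>auto simp: bounded_bilinear.scaleR_right\<close>)
    show "\<exists>K. \<forall>(x::'a) (y::'b). norm (tensor x y) \<le> norm x * norm y * K"
      by (rule exI[of _ 1]) (simp add: norm_tensor_le)
  qed
  fix c and x :: 'a and y :: 'b
  show "tensor (c *\<^sub>C x) y = c *\<^sub>C tensor x y"
    by (rule ptensor_eqI) (use E in auto)
  show "tensor x (c *\<^sub>C y) = c *\<^sub>C tensor x y"
    by (rule ptensor_eqI) (simp, use E in blast)
qed

lemma ptensor_series_exists: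
  fixes X :: "nat \<Rightarrow> ('a::complex_normed_vector, 'b::complex_normed_vector) ptensor"
  assumes X: "summable (\<lambda>k. norm (X k))" and e: "e > 0"
  obtains T where "norm T \<le> (\<Sum>k. norm (X k)) + e"
    "\<And>\<phi>. bounded_cbilinear \<phi> \<Longrightarrow> eval_form T \<phi> = (\<Sum>k. eval_form (X k) \<phi>)"
proof -
  have "\<exists>a b. tensor_rep a b \<and> eval_form (X k) = tensor_series a b \<and>
      (\<Sum>n. norm (a n) * norm (b n)) < norm (X k) + e * (1/2) ^ Suc k" for k
  proof -
    have "norm (X k) < norm (X k) + e * (1/2) ^ Suc k" using e by simp
    then show ?thesis by (rule norm_ptensor_less) blast
  qed
  then obtain a b where ab: "\<And>k. tensor_rep (a k) (b k)" "\<And>k. eval_form (X k) = tensor_series (a k) (b k)"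
    "\<And>k. (\<Sum>n. norm (a k n) * norm (b k n)) < norm (X k) + e * (1/2) ^ Suc k" by metis
  define w where "w = (\<lambda>(k, n). norm (a k n) * norm (b k n))"
  have w0: "w p \<ge> 0" for p by (auto simp: w_def split: prod.splits)
  have wk: "((\<lambda>n. w (k, n)) has_sum (\<Sum>n. w (k, n))) UNIV" for k
    using ab(1)[of k] by (intro norm_summable_imp_has_sum) (auto simp: w_def tensor_rep_def intro!: summable_sums)
  define W where "W k = (\<Sum>n. w (k, n))" for k
  have geo: "(\<lambda>k. e * (1/2) ^ Suc k) sums e" using sums_mult[OF power_half_series, of e] by simp
  have W0: "W k \<ge> 0" for k unfolding W_def by (rule has_sum_nonneg[OF wk]) (rule w0)
  have Wle: "W k \<le> norm (X k) + e * (1/2) ^ Suc k" for k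
    using ab(3)[of k] by (simp add: W_def w_def)
  have Wb: "summable (\<lambda>k. norm (X k) + e * (1/2) ^ Suc k)"
    by (intro summable_add X sums_summable[OF geo])
  have Ws: "summable W"
    by (rule summable_comparison_test'[OF Wb, of 0]) (use W0 Wle in auto)
  have "suminf W \<le> (\<Sum>k. norm (X k) + e * (1/2) ^ Suc k)" by (intro suminf_le Wle Ws Wb)
  also have "\<dots> = (\<Sum>k. norm (X k)) + e"
    using suminf_add[OF X, of "\<lambda>k. e * (1/2) ^ Suc k"] geo by (simp add: sums_iff)
  finally have Wsum: "suminf W \<le> (\<Sum>k. norm (X k)) + e" .
  have Whs: "(W has_sum suminf W) UNIV"
    using Ws W0 by (intro norm_summable_imp_has_sum) (auto intro: summable_sums)
  have wW: "((\<lambda>n. w (k, n)) has_sum W k) UNIV" for k using wk by (simp add: W_def)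
  have "w summable_on (UNIV \<times> UNIV)"
    by (rule summable_on_SigmaI[where g = W]) (use wW w0 has_sum_imp_summable[OF Whs] in auto)
  then have "(w has_sum suminf W) (UNIV \<times> UNIV)"
    by (rule has_sum_SigmaI[where g = W, rotated 2]) (use wW Whs in auto)
  then have whs: "(w has_sum suminf W) UNIV" by simp
  define A where "A m = a (fst (prod_decode m)) (snd (prod_decode m))" for m
  define B where "B m = b (fst (prod_decode m)) (snd (prod_decode m))" for m
  have "((\<lambda>m. w (prod_decode m)) has_sum suminf W) UNIV"
    using has_sum_reindex_bij_betw[OF bij_prod_decode, of w "suminf W"] whs by simp
  then have AB: "(\<lambda>m. norm (A m) * norm (B m)) sums suminf W"
    by (intro has_sum_imp_sums) (auto simp: A_def B_def w_def case_prod_unfold)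
  then have rep: "tensor_rep A B" by (auto simp: tensor_rep_def sums_iff)
  define T where "T = Abs_ptensor (tensor_series A B)"
  have T: "eval_form T = tensor_series A B"
    unfolding T_def by (rule Abs_ptensor_inverse) (use rep in blast)
  show ?thesis
  proof
    show "norm T \<le> (\<Sum>k. norm (X k)) + e"
      using norm_ptensor_le[OF rep T] AB Wsum by (simp add: sums_iff)
    fix \<phi> :: "'a \<Rightarrow> 'b \<Rightarrow> complex" assume \<phi>: "bounded_cbilinear \<phi>"
    obtain K where K: "K \<ge> 0" "\<And>x y. norm (\<phi> x y) \<le> K * (norm x * norm y)"
      using \<phi> bounded_bilinear_norm_le unfolding bounded_cbilinear_def by metis
    define f where "f = (\<lambda>(k, n). \<phi> (a k n) (b k n))"
    have "(\<lambda>p. K * w p) summable_on UNIV" using whs by (intro summable_on_cmult_right) (auto simp: summable_on_def)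
    then have fs: "(\<lambda>p. norm (f p)) summable_on UNIV"
      by (rule summable_on_comparison_test) (use K in \<open>auto simp: f_def w_def\<close>)
    then have fs': "f summable_on (UNIV \<times> UNIV)" by (simp add: abs_summable_summable)
    have inner: "((\<lambda>n. f (k, n)) has_sum eval_form (X k) \<phi>) UNIV" for k
    proof (rule norm_summable_imp_has_sum)
      show "summable (\<lambda>n. norm (f (k, n)))" using tensor_rep_summable(1)[OF ab(1) \<phi>] by (simp add: f_def)
      show "(\<lambda>n. f (k, n)) sums eval_form (X k) \<phi>"
        using summable_sums[OF tensor_rep_summable(2)[OF ab(1) \<phi>]] \<phi>
        by (simp add: f_def ab(2) tensor_series_def)
    qed
    have "((\<lambda>k. eval_form (X k) \<phi>) has_sum infsum f (UNIV \<times> UNIV)) UNIV"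
      by (rule has_sum_SigmaD[where f = f and B = "\<lambda>_. UNIV"]) (use fs' inner in auto)
    then have 1: "(\<lambda>k. eval_form (X k) \<phi>) sums infsum f UNIV" by (intro has_sum_imp_sums) simp
    have "(f has_sum infsum f UNIV) UNIV" using fs' by simp
    then have "((\<lambda>m. f (prod_decode m)) has_sum infsum f UNIV) UNIV"
      using has_sum_reindex_bij_betw[OF bij_prod_decode, of f] by simp
    then have "(\<lambda>m. \<phi> (A m) (B m)) sums infsum f UNIV"
      by (intro has_sum_imp_sums) (simp add: A_def B_def f_def case_prod_unfold)
    then show "eval_form T \<phi> = (\<Sum>k. eval_form (X k) \<phi>)"
      using 1 \<phi> by (simp add: T tensor_series_def sums_iff)
  qed
qed

lemma ptensor_abs_summable_sums:
  fixes X :: "nat \<Rightarrow> ('a::complex_normed_vector, 'b::complex_normed_vector) ptensor"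
  assumes X: "summable (\<lambda>k. norm (X k))"
    and T: "\<And>\<phi>. bounded_cbilinear \<phi> \<Longrightarrow> eval_form T \<phi> = (\<Sum>k. eval_form (X k) \<phi>)"
  shows "X sums T"
proof -
  have ev: "summable (\<lambda>k. eval_form (X k) \<phi>)" if \<phi>: "bounded_cbilinear \<phi>" for \<phi>
  proof -
    obtain K where K: "K \<ge> 0" "\<And>x y. norm (\<phi> x y) \<le> K * (norm x * norm y)"
      using \<phi> bounded_bilinear_norm_le unfolding bounded_cbilinear_def by metis
    show ?thesis
      by (rule summable_comparison_test'[OF summable_mult[OF X, of K], of 0])
         (use eval_form_norm_le[OF \<phi> K] in auto)
  qed
  have le: "norm (T - (\<Sum>k<N. X k)) \<le> (\<Sum>k. norm (X (k + N)))" for N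
  proof (rule field_le_epsilon)
    fix e :: real assume "e > 0"
    then obtain R where R: "norm R \<le> (\<Sum>k. norm (X (k + N))) + e"
      "\<And>\<phi>. bounded_cbilinear \<phi> \<Longrightarrow> eval_form R \<phi> = (\<Sum>k. eval_form (X (k + N)) \<phi>)"
      using ptensor_series_exists[of "\<lambda>k. X (k + N)" e] summable_ignore_initial_segment[OF X, of N]
      by auto
    have "T - (\<Sum>k<N. X k) = R"
      by (rule ptensor_eqI) (simp add: T R(2) suminf_split_initial_segment[OF ev, of _ N])
    then show "norm (T - (\<Sum>k<N. X k)) \<le> (\<Sum>k. norm (X (k + N))) + e" using R(1) by simp
  qed
  have "(\<lambda>N. \<Sum>k. norm (X (k + N))) \<longlonglongrightarrow> 0" by (rule suminf_exist_split2[OF X])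
  then have "(\<lambda>N. T - (\<Sum>k<N. X k)) \<longlonglongrightarrow> 0"
    by (rule Lim_null_comparison[rotated]) (simp add: le)
  then have "(\<lambda>N. T - (T - (\<Sum>k<N. X k))) \<longlonglongrightarrow> T - 0" by (intro tendsto_diff tendsto_const)
  then show ?thesis by (simp add: sums_def)
qed

instance ptensor :: (complex_normed_vector, complex_normed_vector) banach
proof
  fix Y :: "nat \<Rightarrow> ('a, 'b) ptensor"
  assume "Cauchy Y"
  then show "convergent Y"
  proof (rule convergent_of_abs_summable[rotated])
    fix X :: "nat \<Rightarrow> ('a, 'b) ptensor"
    assume X: "summable (\<lambda>n. norm (X n))"
    show "summable X"
      using ptensor_series_exists[OF X zero_less_one] ptensor_abs_summable_sums[OF X]
      by (metis sums_summable)
  qed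
qed

lemma tensor_series_sums:
  assumes rep: "tensor_rep a b" and T: "eval_form T = tensor_series a b"
  shows "(\<lambda>n. tensor (a n) (b n)) sums T"
proof (rule ptensor_abs_summable_sums)
  show "summable (\<lambda>k. norm (tensor (a k) (b k)))"
    by (rule summable_comparison_test'[of "\<lambda>n. norm (a n) * norm (b n)" 0])
       (use rep norm_tensor_le in \<open>auto simp: tensor_rep_def\<close>)
  show "eval_form T \<phi> = (\<Sum>k. eval_form (tensor (a k) (b k)) \<phi>)" if "bounded_cbilinear \<phi>" for \<phi>
    using that by (simp add: T tensor_series_def)
qed

theorem ptensor_universal:
  fixes \<phi> :: "'a::complex_normed_vector \<Rightarrow> 'b::complex_normed_vector \<Rightarrow> 'c::{complex_normed_vector,banach}"
  assumes \<phi>: "bounded_cbilinear \<phi>"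
  shows "\<exists>!f. bounded_clinear f \<and> (\<forall>x y. f (tensor x y) = \<phi> x y)"
    and "\<lbrakk>bounded_clinear f; \<And>x y. f (tensor x y) = \<phi> x y;
          \<And>x y. norm (\<phi> x y) \<le> K * (norm x * norm y); K \<ge> 0\<rbrakk> \<Longrightarrow> norm (f T) \<le> K * norm T"
proof -
  have series: "f T = (\<Sum>n. \<phi> (a n) (b n))"
    if "bounded_clinear f" "\<And>x y. f (tensor x y) = \<phi> x y" "tensor_rep a b" "eval_form T = tensor_series a b"
    for f :: "('a, 'b) ptensor \<Rightarrow> 'c" and T a b
    using bounded_linear.sums[of f, OF _ tensor_series_sums[OF that(3,4)]] that(1,2)
    by (simp add: sums_iff bounded_clinear_def)
  show bnd: "norm (f T) \<le> K * norm T"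
    if f: "bounded_clinear f" "\<And>x y. f (tensor x y) = \<phi> x y"
      and K: "\<And>x y. norm (\<phi> x y) \<le> K * (norm x * norm y)" "K \<ge> 0" for f K T
  proof (rule field_le_epsilon)
    fix e :: real assume e: "e > 0"
    obtain a b where ab: "tensor_rep a b" "eval_form T = tensor_series a b"
      "(\<Sum>n. norm (a n) * norm (b n)) < norm T + e / (K + 1)"
      by (rule norm_ptensor_less[of T "norm T + e / (K + 1)"]) (use e K(2) in auto)
    have "norm (f T) \<le> K * (\<Sum>n. norm (a n) * norm (b n))"
      using tensor_rep_norm_le[OF ab(1) \<phi> K(1)] series[OF f ab(1,2)] by simp
    also have "\<dots> \<le> K * (norm T + e / (K + 1))" using ab(3) K(2) by (intro mult_left_mono) auto
    also have "\<dots> \<le> K * norm T + e" using K(2) e by (simp add: field_simps)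
    finally show "norm (f T) \<le> K * norm T + e" .
  qed
  have pair: "g (\<Sum>n. \<phi> (a n) (b n)) = eval_form T (\<lambda>x y. g (\<phi> x y))"
    if g: "bounded_clinear g" and ab: "tensor_rep a b" "eval_form T = tensor_series a b"
    for g :: "'c \<Rightarrow> complex" and a b T
  proof -
    have "bounded_linear g" using g by (simp add: bounded_clinear_def)
    then have "g (\<Sum>n. \<phi> (a n) (b n)) = (\<Sum>n. g (\<phi> (a n) (b n)))"
      using bounded_linear.suminf[OF _ tensor_rep_summable(2)[OF ab(1) \<phi>]] by metis
    then show ?thesis
      using bounded_cbilinear_compose[OF g \<phi>] by (simp add: ab(2) tensor_series_def)
  qed
  have "\<forall>T. \<exists>a b. tensor_rep a b \<and> eval_form T = tensor_series a b"
    using eval_form by fast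
  then obtain a :: "('a,'b) ptensor \<Rightarrow> nat \<Rightarrow> 'a" and b :: "('a,'b) ptensor \<Rightarrow> nat \<Rightarrow> 'b"
    where ab: "\<And>T. tensor_rep (a T) (b T)" "\<And>T. eval_form T = tensor_series (a T) (b T)" by metis
  define f where "f T = (\<Sum>n. \<phi> (a T n) (b T n))" for T
  have gf: "g (f T) = eval_form T (\<lambda>x y. g (\<phi> x y))" if "bounded_clinear g" for g :: "'c \<Rightarrow> complex" and T
    unfolding f_def by (rule pair[OF that ab])
  have eqI: "y = z" if "\<And>g :: 'c \<Rightarrow> complex. bounded_clinear g \<Longrightarrow> g y = g z" for y z
  proof -
    have "y - z = 0"
    proof (rule cdual_separates)
      fix g :: "'c \<Rightarrow> complex" assume g: "bounded_clinear g"
      then have "g (y - z) = g y - g z" by (simp add: bounded_clinear_def bounded_linear.linear linear_diff)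
      then show "g (y - z) = 0" using that[OF g] by simp
    qed
    then show ?thesis by simp
  qed
  have fser: "f T = (\<Sum>n. \<phi> (c n) (d n))" if "tensor_rep c d" "eval_form T = tensor_series c d" for T c d
    by (rule eqI) (simp add: gf pair[OF _ that])
  obtain K where K: "K \<ge> 0" "\<And>x y. norm (\<phi> x y) \<le> K * (norm x * norm y)"
    using \<phi> bounded_bilinear_norm_le unfolding bounded_cbilinear_def by metis
  have lin: "f (S + T) = f S + f T" "f (z *\<^sub>C T) = z *\<^sub>C f T" for S T z
  proof -
    show "f (S + T) = f S + f T"
      by (rule eqI) (auto simp: gf bounded_clinear_def linear_add[OF bounded_linear.linear])
    show "f (z *\<^sub>C T) = z *\<^sub>C f T"
      by (rule eqI) (auto simp: gf bounded_clinear_def scaleC_complex_def)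
  qed
  have "bounded_linear f"
  proof (rule bounded_linear_intro)
    show "f (S + T) = f S + f T" for S T by (rule lin)
    show "f (r *\<^sub>R T) = r *\<^sub>R f T" for r T using lin(2)[of "complex_of_real r" T] by (simp add: scaleC_of_real)
    show "norm (f T) \<le> norm T * K" for T
    proof (rule field_le_epsilon)
      fix e :: real assume e: "e > 0"
      obtain c d where cd: "tensor_rep c d" "eval_form T = tensor_series c d"
        "(\<Sum>n. norm (c n) * norm (d n)) < norm T + e / (K + 1)"
        by (rule norm_ptensor_less[of T "norm T + e / (K + 1)"]) (use e K(1) in auto)
      have "norm (f T) \<le> K * (\<Sum>n. norm (c n) * norm (d n))"
        using tensor_rep_norm_le[OF cd(1) \<phi> K(2)] fser[OF cd(1,2)] by simp
      also have "\<dots> \<le> K * (norm T + e / (K + 1))" using cd(3) K(1) by (intro mult_left_mono) auto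
      also have "\<dots> \<le> norm T * K + e" using K(1) e by (simp add: field_simps)
      finally show "norm (f T) \<le> norm T * K + e" .
    qed
  qed
  then have f: "bounded_clinear f" by (simp add: bounded_clinear_def lin)
  moreover have "f (tensor x y) = \<phi> x y" for x y
    by (rule eqI) (simp add: gf bounded_cbilinear_compose[OF _ \<phi>])
  moreover have "h = f" if "bounded_clinear h" "\<forall>x y. h (tensor x y) = \<phi> x y" for h
  proof
    fix T show "h T = f T" using series[OF that(1) _ ab, of T] that(2) by (simp add: f_def)
  qed
  ultimately show "\<exists>!f. bounded_clinear f \<and> (\<forall>x y. f (tensor x y) = \<phi> x y)" by blast
qed

section \<open>Modules and strong pseudo-amenability\<close>

text \<open>Only meaningful for bounded linear \<open>T\<close>, see \<open>adjoint_apply\<close>.\<close>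

definition adjoint ::
    "('a::complex_normed_vector \<Rightarrow> 'b::complex_normed_vector) \<Rightarrow> 'b cdual \<Rightarrow> 'a cdual" where
  "adjoint T f = Abs_cdual (\<lambda>x. dual_apply f (T x))"

lemma adjoint_apply [simp]:
  assumes "bounded_clinear T"
  shows "dual_apply (adjoint T f) x = dual_apply f (T x)"
  unfolding adjoint_def
  by (subst Abs_cdual_inverse)
     (simp_all add: bounded_clinear_compose[OF bounded_clinear_dual_apply assms])

lemma norm_dual_apply_le: "norm (dual_apply f x) \<le> norm f * norm x"
  unfolding norm_cdual.rep_eq
  using bounded_clinear_dual_apply[of f] by (intro onorm) (simp add: bounded_clinear_def)

lemma norm_cdual_le:
  assumes "K \<ge> 0" "\<And>x. norm (dual_apply f x) \<le> K * norm x"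
  shows "norm f \<le> K"
  unfolding norm_cdual.rep_eq by (rule onorm_bound[OF assms])

lemma bounded_clinear_adjoint:
  assumes T: "bounded_clinear T"
  shows "bounded_clinear (adjoint T)"
proof -
  have bT: "bounded_linear T" using T by (simp add: bounded_clinear_def)
  have eqI: "f = g" if "\<And>x. dual_apply f x = dual_apply g x" for f g :: "'a cdual"
    using that by (metis dual_apply_inject ext)
  have "bounded_linear (adjoint T)"
  proof (rule bounded_linear_intro)
    fix f g r
    show "adjoint T (f + g) = adjoint T f + adjoint T g"
      by (rule eqI) (simp add: T plus_cdual.rep_eq)
    show "adjoint T (r *\<^sub>R f) = r *\<^sub>R adjoint T f"
      by (rule eqI) (simp add: T scaleR_cdual.rep_eq)
    show "norm (adjoint T f) \<le> norm f * onorm T"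
    proof (rule norm_cdual_le)
      show "0 \<le> norm f * onorm T" by (simp add: onorm_pos_le[OF bT])
      fix x
      have "norm (dual_apply f (T x)) \<le> norm f * (onorm T * norm x)"
        by (intro order_trans[OF norm_dual_apply_le] mult_left_mono onorm bT norm_ge_zero)
      then show "norm (dual_apply (adjoint T f) x) \<le> norm f * onorm T * norm x"
        by (simp add: T mult.assoc)
    qed
  qed
  moreover have "adjoint T (c *\<^sub>C f) = c *\<^sub>C adjoint T f" for c f
    by (rule eqI) (simp add: T scaleC_cdual.rep_eq)
  ultimately show ?thesis by (simp add: bounded_clinear_def)
qed

definition bidual_embed :: "'a::complex_normed_vector \<Rightarrow> 'a cdual cdual" where
  "bidual_embed x = Abs_cdual (\<lambda>f. dual_apply f x)"

lemma bidual_embed_apply [simp]: "dual_apply (bidual_embed x) f = dual_apply f x"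
proof -
  have "bounded_linear (\<lambda>f. dual_apply f x)"
    by (rule bounded_linear_intro[where K = "norm x"])
       (simp_all add: plus_cdual.rep_eq scaleR_cdual.rep_eq norm_dual_apply_le)
  then have "bounded_clinear (\<lambda>f. dual_apply f x)"
    by (simp add: bounded_clinear_def scaleC_cdual.rep_eq scaleC_complex_def)
  then show ?thesis by (simp add: bidual_embed_def Abs_cdual_inverse)
qed

text \<open>\<open>(a \<cdot> f)(x) = f (x \<cdot> a)\<close> and \<open>(f \<cdot> a)(x) = f (a \<cdot> x)\<close>: the left action on the dual comes from the
  right action on the module, and conversely.\<close>

definition dual_lact :: "('x::complex_normed_vector \<Rightarrow> 'a \<Rightarrow> 'x) \<Rightarrow> 'a \<Rightarrow> 'x cdual \<Rightarrow> 'x cdual" where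
  "dual_lact ract a f = adjoint (\<lambda>x. ract x a) f"

definition dual_ract :: "('a \<Rightarrow> 'x::complex_normed_vector \<Rightarrow> 'x) \<Rightarrow> 'x cdual \<Rightarrow> 'a \<Rightarrow> 'x cdual" where
  "dual_ract lact f a = adjoint (\<lambda>x. lact a x) f"

definition bidual_lact ::
    "('a \<Rightarrow> 'x::complex_normed_vector \<Rightarrow> 'x) \<Rightarrow> 'a \<Rightarrow> 'x cdual cdual \<Rightarrow> 'x cdual cdual" where
  "bidual_lact lact = dual_lact (dual_ract lact)"

definition bidual_ract ::
    "('x::complex_normed_vector \<Rightarrow> 'a \<Rightarrow> 'x) \<Rightarrow> 'x cdual cdual \<Rightarrow> 'a \<Rightarrow> 'x cdual cdual" where
  "bidual_ract ract = dual_ract (dual_lact ract)"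

definition ptensor_lift ::
    "('a::complex_normed_vector \<Rightarrow> 'b::complex_normed_vector \<Rightarrow> 'c::{complex_normed_vector,banach}) \<Rightarrow>
     ('a, 'b) ptensor \<Rightarrow> 'c" where
  "ptensor_lift \<phi> = (THE f. bounded_clinear f \<and> (\<forall>x y. f (tensor x y) = \<phi> x y))"

lemma ptensor_lift:
  assumes "bounded_cbilinear \<phi>"
  shows "bounded_clinear (ptensor_lift \<phi>)" "ptensor_lift \<phi> (tensor x y) = \<phi> x y"
  using theI'[OF ptensor_universal(1)[OF assms]] by (simp_all add: ptensor_lift_def)

definition ptensor_lact :: "'a::complex_banach_algebra \<Rightarrow> ('a, 'a) ptensor \<Rightarrow> ('a, 'a) ptensor" where
  "ptensor_lact a = ptensor_lift (\<lambda>b c. tensor (a * b) c)"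

definition ptensor_ract :: "('a::complex_banach_algebra, 'a) ptensor \<Rightarrow> 'a \<Rightarrow> ('a, 'a) ptensor" where
  "ptensor_ract u a = ptensor_lift (\<lambda>b c. tensor b (c * a)) u"

definition ptensor_prod :: "('a::complex_banach_algebra, 'a) ptensor \<Rightarrow> 'a" where
  "ptensor_prod = ptensor_lift (*)"

lemma
  fixes a b c :: "'a::complex_banach_algebra"
  shows ptensor_lact: "bounded_clinear (ptensor_lact a)" "ptensor_lact a (tensor b c) = tensor (a * b) c"
  and ptensor_ract: "bounded_clinear (\<lambda>u. ptensor_ract u a)" "ptensor_ract (tensor b c) a = tensor b (c * a)"
  and ptensor_prod: "bounded_clinear (ptensor_prod :: ('a, 'a) ptensor \<Rightarrow> 'a)" "ptensor_prod (tensor b c) = b * c"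
proof -
  have t: "bounded_bilinear (tensor :: 'a \<Rightarrow> 'a \<Rightarrow> _)" "tensor (z *\<^sub>C x) y = z *\<^sub>C tensor x y"
    "tensor x (z *\<^sub>C y) = z *\<^sub>C tensor x y" for z and x y :: 'a
    using bounded_cbilinear_tensor unfolding bounded_cbilinear_def by blast+
  have "bounded_cbilinear (\<lambda>b c::'a. tensor (a * b) c)"
    unfolding bounded_cbilinear_def
    using bounded_bilinear.comp[OF t(1) bounded_linear_mult_right[of a] bounded_linear_ident]
    by (auto simp: t scaleC_mult_right)
  then show "bounded_clinear (ptensor_lact a)" "ptensor_lact a (tensor b c) = tensor (a * b) c"
    by (simp_all add: ptensor_lact_def ptensor_lift)
  have "bounded_cbilinear (\<lambda>(b::'a) c. tensor b (c * a))"
    unfolding bounded_cbilinear_def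
    using bounded_bilinear.comp[OF t(1) bounded_linear_ident bounded_linear_mult_left[of a]]
    by (auto simp: t scaleC_mult_left)
  then show "bounded_clinear (\<lambda>u. ptensor_ract u a)" "ptensor_ract (tensor b c) a = tensor b (c * a)"
    by (simp_all add: ptensor_ract_def ptensor_lift)
  show "bounded_clinear (ptensor_prod :: ('a, 'a) ptensor \<Rightarrow> 'a)" "ptensor_prod (tensor b c) = b * c"
    by (simp_all add: ptensor_prod_def ptensor_lift bounded_cbilinear_times)
qed

text \<open>A net is a family \<open>m\<close> with a proper filter \<open>F\<close> on its index type (the filter of tails of a
  directed index set).  Below, \<open>adjoint (adjoint ptensor_prod)\<close> is \<open>\<pi>\<^sub>A\<^sup>*\<^sup>*\<close>, and \<open>(*)\<close> serves both as the left
  and as the right action of \<open>A\<close> on itself.  All limits are norm limits.\<close>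

definition strong_pseudo_net ::
    "('i \<Rightarrow> ('a::complex_banach_algebra, 'a) ptensor cdual cdual) \<Rightarrow> 'i filter \<Rightarrow> bool" where
  "strong_pseudo_net m F \<longleftrightarrow> F \<noteq> bot \<and> (\<forall>a.
     ((\<lambda>i. bidual_lact ptensor_lact a (m i) - bidual_ract ptensor_ract (m i) a) \<longlongrightarrow> 0) F \<and>
     (\<forall>i. bidual_lact (*) a (adjoint (adjoint ptensor_prod) (m i)) =
          bidual_ract (*) (adjoint (adjoint ptensor_prod) (m i)) a) \<and>
     ((\<lambda>i. bidual_ract (*) (adjoint (adjoint ptensor_prod) (m i)) a) \<longlongrightarrow> bidual_embed a) F)"

text \<open>A definition cannot quantify over index types.  Indexing by \<open>(A \<otimes>\<^sub>p A)\<^sup>*\<^sup>*\<close> itself loses nothing,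
  see \<open>strong_pseudo_amenableI\<close>.\<close>

definition strong_pseudo_amenable :: "'a::complex_banach_algebra itself \<Rightarrow> bool" where
  "strong_pseudo_amenable _ \<longleftrightarrow>
     (\<exists>(m :: ('a, 'a) ptensor cdual cdual \<Rightarrow> ('a, 'a) ptensor cdual cdual) F. strong_pseudo_net m F)"

lemma strong_pseudo_amenableI:
  fixes m :: "'i \<Rightarrow> ('a::complex_banach_algebra, 'a) ptensor cdual cdual"
  assumes "strong_pseudo_net m F"
  shows "strong_pseudo_amenable TYPE('a)"
proof -
  define m' where "m' x = (if x \<in> range m then x else m undefined)" for x
  have m': "m' (m i) = m i" "\<exists>i. m' x = m i" for i x by (auto simp: m'_def)
  have "strong_pseudo_net m' (filtermap m F)"
    using assms unfolding strong_pseudo_net_def filtermap_bot_iff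
    by (auto simp: filterlim_filtermap m'(1)) (metis m'(2))+
  then show ?thesis unfolding strong_pseudo_amenable_def by blast
qed

section \<open>The semigroup algebra\<close>

typedef 's ell1 = "{f :: 's \<Rightarrow> complex. (\<lambda>s. norm (f s)) summable_on UNIV}"
  morphisms ell1_apply Abs_ell1
  by (rule exI[of _ "\<lambda>_. 0"]) simp

setup_lifting type_definition_ell1

lemma ell1_eqI: "(\<And>s. ell1_apply f s = ell1_apply g s) \<Longrightarrow> f = g"
  by (metis ell1_apply_inject ext)

lemma ell1_norm_add:
  fixes f g :: "'s \<Rightarrow> complex"
  assumes "(\<lambda>s. norm (f s)) summable_on UNIV" "(\<lambda>s. norm (g s)) summable_on UNIV"
  shows "(\<lambda>s. norm (f s + g s)) summable_on UNIV"
    "infsum (\<lambda>s. norm (f s + g s)) UNIV \<le> infsum (\<lambda>s. norm (f s)) UNIV + infsum (\<lambda>s. norm (g s)) UNIV"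
proof -
  note s = summable_on_add[OF assms]
  show *: "(\<lambda>s. norm (f s + g s)) summable_on UNIV"
    by (rule summable_on_comparison_test[OF s]) (auto intro: norm_triangle_ineq)
  show "infsum (\<lambda>s. norm (f s + g s)) UNIV \<le> infsum (\<lambda>s. norm (f s)) UNIV + infsum (\<lambda>s. norm (g s)) UNIV"
    unfolding infsum_add[OF assms, symmetric]
    by (rule infsum_mono[OF * s]) (rule norm_triangle_ineq)
qed

instantiation ell1 :: (type) complex_normed_vector
begin

lift_definition zero_ell1 :: "'a ell1" is "\<lambda>_. 0" by simp
lift_definition plus_ell1 :: "'a ell1 \<Rightarrow> 'a ell1 \<Rightarrow> 'a ell1" is "\<lambda>f g s. f s + g s"
  by (rule ell1_norm_add(1))
lift_definition uminus_ell1 :: "'a ell1 \<Rightarrow> 'a ell1" is "\<lambda>f s. - f s" by simp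
lift_definition scaleC_ell1 :: "complex \<Rightarrow> 'a ell1 \<Rightarrow> 'a ell1" is "\<lambda>c f s. c * f s"
  by (simp add: norm_mult summable_on_cmult_right)
lift_definition scaleR_ell1 :: "real \<Rightarrow> 'a ell1 \<Rightarrow> 'a ell1" is "\<lambda>r f s. complex_of_real r * f s"
  by (simp add: norm_mult summable_on_cmult_right)
lift_definition norm_ell1 :: "'a ell1 \<Rightarrow> real" is "\<lambda>f. infsum (\<lambda>s. norm (f s)) UNIV" .
definition minus_ell1 :: "'a ell1 \<Rightarrow> 'a ell1 \<Rightarrow> 'a ell1" where "minus_ell1 f g = f + - g"
definition dist_ell1 :: "'a ell1 \<Rightarrow> 'a ell1 \<Rightarrow> real" where "dist_ell1 f g = norm (f - g)"
definition sgn_ell1 :: "'a ell1 \<Rightarrow> 'a ell1" where "sgn_ell1 f = inverse (norm f) *\<^sub>R f"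
definition uniformity_ell1 :: "('a ell1 \<times> 'a ell1) filter" where
  "uniformity_ell1 = (INF e\<in>{0 <..}. principal {(x, y). dist x y < e})"
definition open_ell1 :: "'a ell1 set \<Rightarrow> bool" where
  "open_ell1 U = (\<forall>x\<in>U. eventually (\<lambda>(x', y). x' = x \<longrightarrow> y \<in> U) uniformity)"

instance
proof
  fix f g h :: "'a ell1" and c d :: complex and r s :: real
  show "f + g + h = f + (g + h)" "f + g = g + f" "0 + f = f" "- f + f = 0"
    "r *\<^sub>R (f + g) = r *\<^sub>R f + r *\<^sub>R g" "(r + s) *\<^sub>R f = r *\<^sub>R f + s *\<^sub>R f"
    "r *\<^sub>R s *\<^sub>R f = (r * s) *\<^sub>R f" "1 *\<^sub>R f = f"
    "c *\<^sub>C (f + g) = c *\<^sub>C f + c *\<^sub>C g" "(c + d) *\<^sub>C f = c *\<^sub>C f + d *\<^sub>C f"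
    "c *\<^sub>C d *\<^sub>C f = (c * d) *\<^sub>C f" "complex_of_real r *\<^sub>C f = r *\<^sub>R f"
    by (transfer, auto simp: algebra_simps fun_eq_iff)+
  show "norm (f + g) \<le> norm f + norm g" by transfer (rule ell1_norm_add(2))
  show "norm (c *\<^sub>C f) = cmod c * norm f" "norm (r *\<^sub>R f) = \<bar>r\<bar> * norm f"
    by (transfer, simp add: norm_mult infsum_cmult_right')+
  show "(norm f = 0) = (f = 0)"
  proof (transfer, safe)
    fix f :: "'a \<Rightarrow> complex"
    assume *: "(\<lambda>s. norm (f s)) summable_on UNIV" "infsum (\<lambda>s. norm (f s)) UNIV = 0"
    show "f = (\<lambda>_. 0)"
    proof
      fix x show "f x = 0" using nonneg_infsum_le_0D[of "\<lambda>s. norm (f s)" UNIV x] * by simp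
    qed
  qed simp
qed (rule dist_ell1_def, rule minus_ell1_def, auto simp: dist_ell1_def sgn_ell1_def uniformity_ell1_def open_ell1_def)

end

lemma ell1_apply_simps [simp]:
  "ell1_apply 0 s = 0" "ell1_apply (f + g) s = ell1_apply f s + ell1_apply g s"
  "ell1_apply (f - g) s = ell1_apply f s - ell1_apply g s"
  unfolding minus_ell1_def by (simp_all only: zero_ell1.rep_eq plus_ell1.rep_eq uminus_ell1.rep_eq) simp

lemma ell1_apply_sum [simp]: "ell1_apply (sum X A) s = (\<Sum>i\<in>A. ell1_apply (X i) s)"
  by (induction A rule: infinite_finite_induct) auto

lemma ell1_has_sum_norm: "((\<lambda>s. norm (ell1_apply f s)) has_sum norm f) UNIV"
  using ell1_apply[of f] by (simp add: norm_ell1.rep_eq)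

lemma norm_ell1_apply_le: "norm (ell1_apply f s) \<le> norm f"
  using finite_sum_le_has_sum[OF ell1_has_sum_norm[of f], of "{s}"] by simp

lemma ell1_series_exists:
  fixes X :: "nat \<Rightarrow> 's ell1"
  assumes X: "summable (\<lambda>k. norm (X k))"
  obtains f where "norm f \<le> (\<Sum>k. norm (X k))" "\<And>s. (\<lambda>k. ell1_apply (X k) s) sums ell1_apply f s"
proof -
  define x where "x = (\<lambda>(k, s). norm (ell1_apply (X k) s))"
  have inner: "((\<lambda>s. x (k, s)) has_sum norm (X k)) UNIV" for k
    using ell1_has_sum_norm[of "X k"] by (simp add: x_def)
  have outer: "((\<lambda>k. norm (X k)) has_sum (\<Sum>k. norm (X k))) UNIV"
    using X by (intro norm_summable_imp_has_sum) (auto intro: summable_sums)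
  have "x summable_on UNIV \<times> UNIV"
    by (rule summable_on_SigmaI[OF inner]) (use outer has_sum_imp_summable in \<open>auto simp: x_def\<close>)
  then have "(x has_sum (\<Sum>k. norm (X k))) (UNIV \<times> UNIV)"
    by (rule has_sum_SigmaI[rotated 2]) (use inner outer in auto)
  then have sw: "((\<lambda>(s, k). x (k, s)) has_sum (\<Sum>k. norm (X k))) (UNIV \<times> UNIV)"
    by (subst has_sum_swap[symmetric]) simp
  have sk: "summable (\<lambda>k. norm (ell1_apply (X k) s))" for s
    by (rule summable_comparison_test'[OF X, of 0]) (simp add: norm_ell1_apply_le)
  have R: "((\<lambda>s. \<Sum>k. norm (ell1_apply (X k) s)) has_sum (\<Sum>k. norm (X k))) UNIV"
  proof (rule has_sum_SigmaD[OF sw])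
    show "((\<lambda>k. case (s, k) of (s, k) \<Rightarrow> x (k, s)) has_sum (\<Sum>k. norm (ell1_apply (X k) s))) UNIV" for s
      using sk[of s] by (intro norm_summable_imp_has_sum) (auto simp: x_def intro!: summable_sums)
  qed
  define L where "L s = (\<Sum>k. ell1_apply (X k) s)" for s
  have le: "norm (L s) \<le> (\<Sum>k. norm (ell1_apply (X k) s))" for s
    unfolding L_def by (rule summable_norm[OF sk])
  have Ls: "(\<lambda>s. norm (L s)) summable_on UNIV"
    by (rule summable_on_comparison_test[OF has_sum_imp_summable[OF R]]) (use le in auto)
  have L: "ell1_apply (Abs_ell1 L) = L" by (rule Abs_ell1_inverse) (use Ls in simp)
  show ?thesis
  proof
    show "norm (Abs_ell1 L) \<le> (\<Sum>k. norm (X k))"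
      by (rule has_sum_mono[OF ell1_has_sum_norm R]) (simp add: L le)
    show "(\<lambda>k. ell1_apply (X k) s) sums ell1_apply (Abs_ell1 L) s" for s
      unfolding L L_def by (rule summable_sums[OF summable_norm_cancel[OF sk]])
  qed
qed

instance ell1 :: (type) banach
proof
  fix Y :: "nat \<Rightarrow> 'a ell1"
  assume "Cauchy Y"
  then show "convergent Y"
  proof (rule convergent_of_abs_summable[rotated])
    fix X :: "nat \<Rightarrow> 'a ell1"
    assume X: "summable (\<lambda>n. norm (X n))"
    obtain f where f: "\<And>s. (\<lambda>k. ell1_apply (X k) s) sums ell1_apply f s"
      by (rule ell1_series_exists[OF X]) blast
    have le: "norm (f - (\<Sum>k<N. X k)) \<le> (\<Sum>k. norm (X (k + N)))" for N
    proof -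
      obtain R where R: "norm R \<le> (\<Sum>k. norm (X (k + N)))"
        "\<And>s. (\<lambda>k. ell1_apply (X (k + N)) s) sums ell1_apply R s"
        by (rule ell1_series_exists[of "\<lambda>k. X (k + N)"])
           (use summable_ignore_initial_segment[OF X, of N] in auto)
      have "f - (\<Sum>k<N. X k) = R"
      proof (rule ell1_eqI)
        fix s
        have "(\<lambda>k. ell1_apply (X (k + N)) s) sums (ell1_apply f s - (\<Sum>k<N. ell1_apply (X k) s))"
          by (rule sums_split_initial_segment[OF f])
        then show "ell1_apply (f - (\<Sum>k<N. X k)) s = ell1_apply R s"
          using sums_unique2[OF R(2)] by simp
      qed
      then show ?thesis using R(1) by simp
    qed
    have "(\<lambda>N. \<Sum>k. norm (X (k + N))) \<longlonglongrightarrow> 0" by (rule suminf_exist_split2[OF X])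
    then have "(\<lambda>N. f - (\<Sum>k<N. X k)) \<longlonglongrightarrow> 0"
      by (rule Lim_null_comparison[rotated]) (simp add: le)
    then have "(\<lambda>N. f - (f - (\<Sum>k<N. X k))) \<longlonglongrightarrow> f - 0" by (intro tendsto_diff tendsto_const)
    then show "summable X" by (auto simp: sums_def summable_def)
  qed
qed

lemma abs_summable_times:
  fixes f :: "'x \<Rightarrow> complex" and g :: "'y \<Rightarrow> complex"
  assumes "((\<lambda>x. norm (f x)) has_sum M) UNIV" "((\<lambda>y. norm (g y)) has_sum N) UNIV"
  shows "((\<lambda>p. norm (f (fst p) * g (snd p))) has_sum (M * N)) UNIV"
proof -
  let ?p = "\<lambda>p. norm (f (fst p) * g (snd p))"
  have inner: "((\<lambda>y. ?p (x, y)) has_sum (norm (f x) * N)) UNIV" for x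
    using has_sum_cmult_right[OF assms(2), of "norm (f x)"] by (simp add: norm_mult)
  have outer: "((\<lambda>x. norm (f x) * N) has_sum (M * N)) UNIV"
    by (rule has_sum_cmult_left[OF assms(1)])
  have "?p summable_on UNIV \<times> UNIV"
    by (rule summable_on_SigmaI[OF inner]) (use outer has_sum_imp_summable in auto)
  then have "(?p has_sum (M * N)) (UNIV \<times> UNIV)"
    by (rule has_sum_SigmaI[rotated 2]) (use inner outer in auto)
  then show ?thesis by simp
qed

lemma fibre_has_sum:
  fixes F :: "'x \<Rightarrow> real" and h :: "'x \<Rightarrow> 'u"
  assumes "(F has_sum M) UNIV"
  shows "((\<lambda>u. infsum F {x. h x = u}) has_sum M) UNIV"
proof -
  have "bij_betw (\<lambda>x. (h x, x)) UNIV (Sigma UNIV (\<lambda>u. {x. h x = u}))"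
    by (rule bij_betwI[where g = snd]) auto
  then have *: "((\<lambda>p. F (snd p)) has_sum M) (Sigma UNIV (\<lambda>u. {x. h x = u}))"
    using has_sum_reindex_bij_betw[of "\<lambda>x. (h x, x)" UNIV _ "\<lambda>p. F (snd p)" M] assms by simp
  show ?thesis
  proof (rule has_sum_SigmaD[OF *])
    show "((\<lambda>x. F (snd (u, x))) has_sum infsum F {x. h x = u}) {x. h x = u}" for u
      using summable_on_subset_banach[OF has_sum_imp_summable[OF assms], of "{x. h x = u}"] by simp
  qed
qed

instantiation ell1 :: (semigroup_mult) complex_banach_algebra
begin

lemma convolution_bound:
  fixes f g :: "'a \<Rightarrow> complex"
  assumes fM: "((\<lambda>s. norm (f s)) has_sum M) UNIV" and gN: "((\<lambda>s. norm (g s)) has_sum N) UNIV"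
  shows "(\<lambda>u. norm (infsum (\<lambda>(s, t). f s * g t) {(s, t). s * t = u})) summable_on UNIV"
    and "infsum (\<lambda>u. norm (infsum (\<lambda>(s, t). f s * g t) {(s, t). s * t = u})) UNIV \<le> M * N"
proof -
  have eq: "{(s, t). s * t = u} = {p. fst p * snd p = u}" for u :: 'a by auto
  note P = abs_summable_times[OF assms]
  have S: "((\<lambda>u. infsum (\<lambda>p. norm (f (fst p) * g (snd p))) {(s, t). s * t = u}) has_sum (M * N)) UNIV"
    unfolding eq by (rule fibre_has_sum[OF P])
  have le: "norm (infsum (\<lambda>(s, t). f s * g t) {(s, t). s * t = u})
      \<le> infsum (\<lambda>p. norm (f (fst p) * g (snd p))) {(s, t). s * t = u}" for u
    unfolding case_prod_unfold
    by (rule norm_infsum_bound) (rule summable_on_subset_banach[OF has_sum_imp_summable[OF P]], simp)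
  show *: "(\<lambda>u. norm (infsum (\<lambda>(s, t). f s * g t) {(s, t). s * t = u})) summable_on UNIV"
    by (rule summable_on_comparison_test[OF has_sum_imp_summable[OF S]]) (use le in auto)
  show "infsum (\<lambda>u. norm (infsum (\<lambda>(s, t). f s * g t) {(s, t). s * t = u})) UNIV \<le> M * N"
    by (rule has_sum_mono[OF has_sum_infsum[OF *] S]) (use le in auto)
qed

lift_definition times_ell1 :: "'a ell1 \<Rightarrow> 'a ell1 \<Rightarrow> 'a ell1"
  is "\<lambda>f g u. infsum (\<lambda>(s, t). f s * g t) {(s, t). s * t = u}"
  by (rule convolution_bound(1)[OF has_sum_infsum has_sum_infsum])

lemma convolution_summable:
  "(\<lambda>(s, t). ell1_apply f s * ell1_apply g t) summable_on A"
proof -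
  have "(\<lambda>p. norm (ell1_apply f (fst p) * ell1_apply g (snd p))) summable_on UNIV"
    using abs_summable_times[OF ell1_has_sum_norm ell1_has_sum_norm] has_sum_imp_summable by blast
  then have "(\<lambda>p. ell1_apply f (fst p) * ell1_apply g (snd p)) summable_on UNIV"
    by (rule abs_summable_summable)
  then show ?thesis
    unfolding case_prod_unfold by (rule summable_on_subset_banach) simp
qed

lemma ell1_mult_assoc: "(f * g) * h = f * (g * (h :: 'a ell1))"
proof (rule ell1_eqI)
  fix w :: 'a
  let ?f = "ell1_apply f" and ?g = "ell1_apply g" and ?h = "ell1_apply h"
  let ?T = "{(s, t, v). s * t * v = w}"
  let ?F = "\<lambda>(s, t, v). ?f s * (?g t * ?h v)"
  have "(\<lambda>p. norm (?f (fst p) * (?g (fst (snd p)) * ?h (snd (snd p))))) summable_on UNIV"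
    using abs_summable_times[OF ell1_has_sum_norm[of f] abs_summable_times[OF ell1_has_sum_norm[of g] ell1_has_sum_norm[of h]]]
      has_sum_imp_summable by blast
  then have "(\<lambda>p. ?f (fst p) * (?g (fst (snd p)) * ?h (snd (snd p)))) summable_on UNIV"
    by (rule abs_summable_summable)
  then have sF: "?F summable_on ?T"
    unfolding case_prod_unfold by (rule summable_on_subset_banach) simp
  let ?L = "Sigma {(u, v). u * v = w} (\<lambda>(u, v). {(s, t). s * t = u})"
  let ?R = "Sigma {(s, u). s * u = w} (\<lambda>(s, u). {(t, v). t * v = u})"
  have bL: "bij_betw (\<lambda>(s, t, v). ((s * t, v), (s, t))) ?T ?L"
    by (rule bij_betwI[where g = "\<lambda>((u, v), (s, t)). (s, t, v)"]) auto
  have bR: "bij_betw (\<lambda>(s, t, v). ((s, t * v), (t, v))) ?T ?R"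
    by (rule bij_betwI[where g = "\<lambda>((s, u), (t, v)). (s, t, v)"]) (auto simp: mult.assoc)
  let ?FL = "\<lambda>p q. ?f (fst q) * ?g (snd q) * ?h (snd p)"
  let ?FR = "\<lambda>p q. ?f (fst p) * (?g (fst q) * ?h (snd q))"
  have sL: "(\<lambda>(p, q). ?FL p q) summable_on ?L"
    using summable_on_reindex_bij_betw[OF bL, of "\<lambda>(p, q). ?FL p q"] sF
    by (simp add: case_prod_unfold mult.assoc)
  have sR: "(\<lambda>(p, q). ?FR p q) summable_on ?R"
    using summable_on_reindex_bij_betw[OF bR, of "\<lambda>(p, q). ?FR p q"] sF
    by (simp add: case_prod_unfold mult.assoc)
  have "ell1_apply (f * g * h) w =
      infsum (\<lambda>p. infsum (?FL p) (case p of (u, v) \<Rightarrow> {(s, t). s * t = u})) {(u, v). u * v = w}"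
    unfolding times_ell1.rep_eq by (simp add: case_prod_unfold infsum_cmult_left')
  also have "\<dots> = infsum (\<lambda>(p, q). ?FL p q) ?L" by (rule infsum_Sigma'_banach[OF sL])
  also have "\<dots> = infsum ?F ?T"
    using infsum_reindex_bij_betw[OF bL, of "\<lambda>(p, q). ?FL p q"] by (simp add: case_prod_unfold mult.assoc)
  also have "\<dots> = infsum (\<lambda>(p, q). ?FR p q) ?R"
    using infsum_reindex_bij_betw[OF bR, of "\<lambda>(p, q). ?FR p q"] by (simp add: case_prod_unfold mult.assoc)
  also have "\<dots> = infsum (\<lambda>p. infsum (?FR p) (case p of (s, u) \<Rightarrow> {(t, v). t * v = u})) {(s, u). s * u = w}"
    by (rule infsum_Sigma'_banach[OF sR, symmetric])
  also have "\<dots> = ell1_apply (f * (g * h)) w"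
    unfolding times_ell1.rep_eq by (simp add: case_prod_unfold infsum_cmult_right')
  finally show "ell1_apply (f * g * h) w = ell1_apply (f * (g * h)) w" .
qed

instance
proof
  fix f g h :: "'a ell1" and c :: complex and r :: real
  note sm = convolution_summable[unfolded case_prod_unfold]
  show "f * g * h = f * (g * h)" by (rule ell1_mult_assoc)
  show "(f + g) * h = f * h + g * h"
    by (rule ell1_eqI) (simp add: times_ell1.rep_eq case_prod_unfold algebra_simps infsum_add sm)
  show "f * (g + h) = f * g + f * h"
    by (rule ell1_eqI) (simp add: times_ell1.rep_eq case_prod_unfold algebra_simps infsum_add sm)
  show C: "(c *\<^sub>C f) * g = c *\<^sub>C (f * g)" "f * (c *\<^sub>C g) = c *\<^sub>C (f * g)" for c
    by (rule ell1_eqI, simp add: times_ell1.rep_eq scaleC_ell1.rep_eq case_prod_unfold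
        mult.assoc mult.left_commute infsum_cmult_right')+
  show "(r *\<^sub>R f) * g = r *\<^sub>R (f * g)" "f * (r *\<^sub>R g) = r *\<^sub>R (f * g)"
    using C[of "complex_of_real r"] by (simp_all add: scaleC_of_real)
  show "norm (f * g) \<le> norm f * norm g"
    unfolding norm_ell1.rep_eq[of "f * g"] times_ell1.rep_eq
    by (rule convolution_bound(2)[OF ell1_has_sum_norm ell1_has_sum_norm])
qed

end

lift_definition ell1_delta :: "'s \<Rightarrow> 's ell1" is "\<lambda>s t. if t = s then 1 else 0"
  by (rule finite_nonzero_values_imp_summable_on) auto

lemma ell1_delta_mult: "ell1_delta s * ell1_delta t = ell1_delta (s * t)"
proof (rule ell1_eqI)
  fix u
  have "infsum (\<lambda>(s', t'). (if s' = s then 1 else 0) * (if t' = t then 1 else 0)) {(s', t'). s' * t' = u}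
      = infsum (\<lambda>_. 1 :: complex) (if s * t = u then {(s, t)} else {})"
    by (rule infsum_cong_neutral) (auto split: if_splits)
  then show "ell1_apply (ell1_delta s * ell1_delta t) u = ell1_apply (ell1_delta (s * t)) u"
    by (simp add: times_ell1.rep_eq ell1_delta.rep_eq)
qed

section \<open>Inverse semigroups and amenable groups\<close>

class inverse_semigroup = semigroup_mult +
  assumes inverse_ex1: "\<exists>!t. s * t * s = s \<and> t * s * t = t"

definition star :: "'s::inverse_semigroup \<Rightarrow> 's" where
  "star s = (THE t. s * t * s = s \<and> t * s * t = t)"

definition idempotents :: "'s::semigroup_mult set" where
  "idempotents = {e. e * e = e}"

definition natural_le :: "'s::semigroup_mult \<Rightarrow> 's \<Rightarrow> bool" where
  "natural_le s t \<longleftrightarrow> s = s * t \<and> s = t * s"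

definition uniformly_locally_finite :: "'x set \<Rightarrow> ('x \<Rightarrow> 'x \<Rightarrow> bool) \<Rightarrow> bool" where
  "uniformly_locally_finite P R \<longleftrightarrow>
     (\<exists>N::nat. \<forall>x\<in>P. finite {y \<in> P. R y x} \<and> card {y \<in> P. R y x} \<le> N)"

definition maximal_subgroup :: "'s::inverse_semigroup \<Rightarrow> 's monoid" where
  "maximal_subgroup p =
     \<lparr>carrier = {s. s * star s = p \<and> star s * s = p}, mult = (*), one = p\<rparr>"

definition D_relation :: "('s::inverse_semigroup \<times> 's) set" where
  "D_relation = {(s, t). \<exists>x. s * star s = x * star x \<and> star t * t = star x * x}"

text \<open>A left-invariant mean on the real space \<open>\<ell>\<^sup>\<infinity>(G)\<close>.  Functions are defined on the whole type;
  additivity and positivity force \<open>M f\<close> to depend only on the restriction of \<open>f\<close> to \<open>carrier G\<close>.\<close>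

definition invariant_mean :: "('g, 'b) monoid_scheme \<Rightarrow> (('g \<Rightarrow> real) \<Rightarrow> real) \<Rightarrow> bool" where
  "invariant_mean G M \<longleftrightarrow>
     (let L = {f. bounded (f ` carrier G)} in
       (\<forall>f\<in>L. \<forall>g\<in>L. M (\<lambda>x. f x + g x) = M f + M g) \<and>
       (\<forall>c. \<forall>f\<in>L. M (\<lambda>x. c * f x) = c * M f) \<and>
       (\<forall>f\<in>L. (\<forall>x\<in>carrier G. 0 \<le> f x) \<longrightarrow> 0 \<le> M f) \<and>
       M (\<lambda>_. 1) = 1 \<and>
       (\<forall>f\<in>L. \<forall>g\<in>carrier G. M (\<lambda>x. f (g \<otimes>\<^bsub>G\<^esub> x)) = M f))"

definition amenable_group :: "('g, 'b) monoid_scheme \<Rightarrow> bool" where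
  "amenable_group G \<longleftrightarrow> group G \<and> (\<exists>M. invariant_mean G M)"

end

theory Submission
  imports Defs
begin

text \<open>
  Necessity. Let \<open>m\<close> be far out in a strong pseudo-amenability net and \<open>z = \<pi>\<^sup>*\<^sup>*(m)\<close>. Conjugating by \<open>\<delta>\<^sub>x\<close> shows
  that \<open>z\<close>, being central, takes one and the same value, close to \<open>1\<close>, on the coefficient functionals of all
  idempotents in a \<open>\<D>\<close>-class. Sums of such functionals are bounded uniformly by local finiteness of the
  idempotents, so the class has at most a multiple of \<open>\<parallel>z\<parallel>\<close> of them. For amenability, every bounded function \<open>f\<close> on
  \<open>G\<^sub>p\<close> is turned into a bounded bilinear form on \<open>\<ell>\<^sup>1(S)\<close>, in such a way that left translation of \<open>f\<close> becomes the left
  action on the tensor square while the right action does nothing. The net thereby yields asymptotically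
  invariant functionals on \<open>\<ell>\<^sup>\<infinity>(G\<^sub>p)\<close>; the net is unbounded and not positive, so one passes to normalised total
  variations before taking a cluster point.

  Sufficiency. Moebius inversion over the natural partial order gives a bounded family \<open>\<epsilon>\<^sub>s\<close> that multiplies like a
  groupoid. A \<open>\<D>\<close>-class with finitely many idempotents then spans a full matrix algebra over \<open>\<ell>\<^sup>1(G\<^sub>p)\<close>, which has a
  virtual diagonal if \<open>G\<^sub>p\<close> is amenable. The sums of these diagonals over finitely many classes
  commute exactly with \<open>\<ell>\<^sup>1(S)\<close>, so only the convergence of their images under \<open>\<pi>\<^sup>*\<^sup>*\<close> needs an estimate.
\<close>

section \<open>Inverse semigroups\<close>

lemma star_inverse:
  fixes s :: "'s::inverse_semigroup"
  shows "s * star s * s = s" "star s * s * star s = star s"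
  using theI'[OF inverse_ex1[of s]] by (auto simp: star_def)

lemma star_unique:
  fixes s t :: "'s::inverse_semigroup"
  assumes "s * t * s = s" "t * s * t = t"
  shows "star s = t"
  using inverse_ex1[of s] star_inverse[of s] assms by blast

lemma star_simps [simp]:
  fixes s t :: "'s::inverse_semigroup"
  shows "s * (star s * s) = s" "star s * (s * star s) = star s"
    "s * (star s * (s * t)) = s * t" "star s * (s * (star s * t)) = star s * t"
    "star (star s) = s"
proof -
  show 1: "s * (star s * s) = s" and 2: "star s * (s * star s) = star s"
    using star_inverse[of s] by (simp_all add: mult.assoc)
  show "s * (star s * (s * t)) = s * t"
    using arg_cong[OF 1, of "\<lambda>x. x * t"] by (simp only: mult.assoc)
  show "star s * (s * (star s * t)) = star s * t"
    using arg_cong[OF 2, of "\<lambda>x. x * t"] by (simp only: mult.assoc)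
  show "star (star s) = s"
    by (rule star_unique) (rule star_inverse)+
qed

lemma idempotentsD: "e \<in> idempotents \<Longrightarrow> e * e = e"
  by (simp add: idempotents_def)

lemma idempotent_absorb:
  fixes e x :: "'s::semigroup_mult"
  assumes "e \<in> idempotents"
  shows "e * (e * x) = e * x"
  using idempotentsD[OF assms] by (metis mult.assoc)

lemma star_idempotent:
  fixes e :: "'s::inverse_semigroup"
  assumes "e \<in> idempotents"
  shows "star e = e"
  by (rule star_unique) (use assms in \<open>simp_all add: idempotents_def\<close>)

lemma idempotents_star:
  fixes s :: "'s::inverse_semigroup"
  shows "s * star s \<in> idempotents" "star s * s \<in> idempotents"
  by (simp_all add: idempotents_def mult.assoc)

text \<open>The element \<open>f * star (e * f) * e\<close> is again an inverse of
  \<open>e * f\<close>, so it equals \<open>star (e * f)\<close>. This makes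
  \<open>star (e * f)\<close> idempotent, hence its own inverse, and therefore equal to
  \<open>e * f\<close>.\<close>

lemma idempotents_mult:
  fixes e f :: "'s::inverse_semigroup"
  assumes e: "e \<in> idempotents" and f: "f \<in> idempotents"
  shows "e * f \<in> idempotents"
proof -
  let ?x = "star (e * f)"
  note ee = idempotentsD[OF e] idempotent_absorb[OF e] idempotentsD[OF f] idempotent_absorb[OF f]
  have x: "e * (f * (?x * (e * f))) = e * f" "?x * (e * (f * ?x)) = ?x"
    using star_inverse[of "e * f"] by (simp_all add: mult.assoc)
  have x': "?x * (e * (f * (?x * y))) = ?x * y" for y
    using arg_cong[OF x(2), of "\<lambda>z. z * y"] by (simp only: mult.assoc)
  have "star (e * f) = f * ?x * e"
    by (rule star_unique) (simp_all add: mult.assoc ee x x')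
  then have y: "?x * ?x = ?x" using x' by (metis mult.assoc)
  then have "?x \<in> idempotents" by (simp add: idempotents_def)
  then have "star ?x = ?x" by (rule star_idempotent)
  then show ?thesis using \<open>?x \<in> idempotents\<close> by simp
qed

text \<open>Since \<open>e * f\<close> is idempotent, it is its own inverse; \<open>f * e\<close> is
  an inverse of it too, and inverses are unique.\<close>

lemma idempotents_commute:
  fixes e f :: "'s::inverse_semigroup"
  assumes e: "e \<in> idempotents" and f: "f \<in> idempotents"
  shows "e * f = f * e"
proof -
  have i: "e * f * (e * f) = e * f" "f * e * (f * e) = f * e"
    using idempotents_mult[OF e f] idempotents_mult[OF f e] by (simp_all add: idempotents_def)
  note ee = idempotentsD[OF e] idempotent_absorb[OF e] idempotentsD[OF f] idempotent_absorb[OF f]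
  have "star (e * f) = f * e"
    by (rule star_unique) (use i in \<open>simp_all add: mult.assoc ee\<close>)
  then show ?thesis using star_idempotent[OF idempotents_mult[OF e f]] by simp
qed

text \<open>Commutation of idempotents, bracketed to the right to match terms normalised by
  \<open>mult.assoc\<close>; the second form allows a further factor on the right.\<close>

lemma star_commute:
  fixes s t :: "'s::inverse_semigroup"
  shows "s * (star s * (t * star t)) = t * (star t * (s * star s))"
    "s * (star s * (t * (star t * u))) = t * (star t * (s * (star s * u)))"
proof -
  show 1: "s * (star s * (t * star t)) = t * (star t * (s * star s))" for s t :: 's
    using idempotents_commute[OF idempotents_star(1)[of s] idempotents_star(1)[of t]]
    by (simp add: mult.assoc)
  show "s * (star s * (t * (star t * u))) = t * (star t * (s * (star s * u)))"
    using arg_cong[OF 1[of s t], of "\<lambda>x. x * u"] by (simp only: mult.assoc)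
qed

lemma star_mult [simp]:
  fixes s t :: "'s::inverse_semigroup"
  shows "star (s * t) = star t * star s"
proof (rule star_unique)
  show "s * t * (star t * star s) * (s * t) = s * t"
    using star_commute(2)[of t "star s" t] by (simp add: mult.assoc)
  show "star t * star s * (s * t) * (star t * star s) = star t * star s"
    using star_commute(2)[of "star s" t "star s"] by (simp add: mult.assoc)
qed

lemma idempotents_conj:
  fixes e s :: "'s::inverse_semigroup"
  assumes "e \<in> idempotents"
  shows "s * e * star s \<in> idempotents" "star s * e * s \<in> idempotents"
proof -
  show *: "s * e * star s \<in> idempotents" for s
  proof -
    have "s * e * star s = (s * e) * star (s * e)"
      using assms by (simp add: mult.assoc star_idempotent idempotent_absorb)
    then show ?thesis using idempotents_star by metis
  qed
  show "star s * e * s \<in> idempotents" using *[of "star s"] by simp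
qed

section \<open>The natural partial order and its order ideals\<close>

text \<open>The natural partial order of an inverse semigroup; on idempotents it is \<^const>\<open>natural_le\<close>.\<close>

definition below :: "'s::inverse_semigroup \<Rightarrow> 's set" where
  "below t = {u. \<exists>e\<in>idempotents. u = t * e}"

lemma below_idempotents_le: "e \<in> idempotents \<Longrightarrow> t * e \<in> below t"
  by (auto simp: below_def)

text \<open>If \<open>u = t * e\<close>, then \<open>star u * u\<close> is \<open>e\<close> cut down
  to \<open>star t * t\<close>, and multiplying \<open>t\<close> by it gives \<open>u\<close> again.
  So \<open>star u * u\<close> is a canonical witness.\<close>

lemma below_iff_right:
  fixes t u :: "'s::inverse_semigroup"
  shows "u \<in> below t \<longleftrightarrow> u = t * (star u * u)"
proof
  assume "u \<in> below t"
  then obtain e where e: "e \<in> idempotents" "u = t * e" by (auto simp: below_def)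
  have "t * (e * (star t * (t * e))) = t * (star t * (t * (e * e)))"
    using idempotents_commute[OF e(1) idempotents_star(2)[of t]] by (metis mult.assoc)
  then show "u = t * (star u * u)" using e
    by (simp add: star_idempotent mult.assoc idempotentsD)
qed (use idempotents_star below_def in blast)

text \<open>An idempotent passes to the other side of \<open>t\<close> by conjugation:
  \<open>t * e = (t * e * star t) * t\<close>.\<close>

lemma below_iff_left:
  fixes t u :: "'s::inverse_semigroup"
  shows "u \<in> below t \<longleftrightarrow> (\<exists>e\<in>idempotents. u = e * t)"
proof
  assume "u \<in> below t"
  then obtain e where e: "e \<in> idempotents" "u = t * e" by (auto simp: below_def)
  have "t * e = t * (star t * t * e)" by (simp add: mult.assoc)
  also have "\<dots> = t * (e * (star t * t))"
    using idempotents_commute[OF e(1) idempotents_star(2)[of t]] by simp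
  finally have "u = (t * e * star t) * t" using e by (simp add: mult.assoc)
  then show "\<exists>e\<in>idempotents. u = e * t" using idempotents_conj(1)[OF e(1)] by blast
next
  assume "\<exists>e\<in>idempotents. u = e * t"
  then obtain e where e: "e \<in> idempotents" "u = e * t" by blast
  have "e * t = (e * (t * star t)) * t" by (simp add: mult.assoc)
  also have "\<dots> = (t * star t * e) * t"
    using idempotents_commute[OF e(1) idempotents_star(1)[of t]] by simp
  finally have "u = t * (star t * e * t)" using e by (simp add: mult.assoc)
  then show "u \<in> below t" using idempotents_conj(2)[OF e(1)] by (auto simp: below_def)
qed

lemma below_refl: "t \<in> below t"
  by (simp add: below_iff_right)

lemma below_trans: "u \<in> below t \<Longrightarrow> t \<in> below s \<Longrightarrow> u \<in> below s"
  unfolding below_def using idempotents_mult by (fastforce simp: mult.assoc)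

lemma below_antisym:
  assumes "u \<in> below t" "t \<in> below u"
  shows "u = t"
proof -
  obtain e f where e: "e \<in> idempotents" "u = t * e" "f \<in> idempotents" "t = u * f"
    using assms by (auto simp: below_def)
  have "u * e = u" using e idempotentsD by (metis mult.assoc)
  then have "t = u * (e * f)" using e by (metis mult.assoc)
  also have "\<dots> = u * (f * e)" using e idempotents_commute by metis
  also have "\<dots> = u" using e by (metis mult.assoc)
  finally show ?thesis by simp
qed

lemma below_eqI:
  assumes "u \<in> below t" "star u * u = star t * t"
  shows "u = t"
  using assms by (simp add: below_iff_right)

lemma idempotents_below:
  fixes e :: "'s::inverse_semigroup"
  assumes "e \<in> idempotents"
  shows "f \<in> below e \<longleftrightarrow> f \<in> idempotents \<and> natural_le f e"
proof
  assume "f \<in> below e"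
  then obtain g where g: "g \<in> idempotents" "f = e * g" by (auto simp: below_def)
  then show "f \<in> idempotents \<and> natural_le f e"
    unfolding natural_le_def using assms idempotents_mult idempotents_commute[OF g(1) assms]
    by (simp add: mult.assoc idempotentsD[OF assms] idempotent_absorb[OF assms])
qed (auto simp: below_def natural_le_def)

lemma idempotents_below_iff:
  fixes e f :: "'s::inverse_semigroup"
  assumes "e \<in> idempotents" "f \<in> idempotents"
  shows "f \<in> below e \<longleftrightarrow> f * e = f"
  using assms idempotents_below[OF assms(1), of f] idempotents_commute[OF assms]
  by (auto simp: natural_le_def)

text \<open>Every order ideal is a copy of the order ideal of an idempotent; this carries uniform
  local finiteness from the idempotents to the whole semigroup.\<close>

lemma bij_betw_below:
  "bij_betw (\<lambda>u. star u * u) (below t) (below (star t * (t::'s::inverse_semigroup)))"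
proof (rule bij_betwI[where g = "\<lambda>e. t * e"])
  show "(\<lambda>u. star u * u) \<in> below t \<rightarrow> below (star t * t)"
  proof
    fix u assume "u \<in> below t"
    then obtain e where e: "e \<in> idempotents" "u = t * e" by (auto simp: below_def)
    then have "star u * u = e * (star t * t * e)" by (simp add: star_idempotent mult.assoc)
    also have "\<dots> = e * (e * (star t * t))"
      using idempotents_commute[OF e(1) idempotents_star(2)[of t]] by simp
    also have "\<dots> = star t * t * e"
      using idempotents_commute[OF e(1) idempotents_star(2)[of t]] idempotent_absorb[OF e(1)] by metis
    finally show "star u * u \<in> below (star t * t)" using e by (auto simp: below_def)
  qed
  show "(\<lambda>e. t * e) \<in> below (star t * t) \<rightarrow> below t"
    by (auto simp: below_def mult.assoc)
  show "t * (star u * u) = u" if "u \<in> below t" for u using that below_iff_right by metis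
  fix e assume e: "e \<in> below (star t * t)"
  then have ei: "e \<in> idempotents" "star t * t * e = e"
    using idempotents_below[OF idempotents_star(2)] unfolding natural_le_def by metis+
  have "star (t * e) * (t * e) = e * (star t * t * e)" using ei by (simp add: star_idempotent mult.assoc)
  then show "star (t * e) * (t * e) = e" using ei by (simp add: idempotentsD)
qed

lemma below_finite_card:
  fixes t :: "'s::inverse_semigroup"
  assumes "\<forall>x\<in>(idempotents::'s set). finite {y \<in> idempotents. natural_le y x} \<and>
    card {y \<in> idempotents. natural_le y x} \<le> N"
  shows "finite (below t)" "card (below t) \<le> N"
proof -
  have "below (star t * t) = {y \<in> idempotents. natural_le y (star t * t)}"
    using idempotents_below[OF idempotents_star(2)] by auto
  then have "finite (below (star t * t)) \<and> card (below (star t * t)) \<le> N"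
    using assms idempotents_star(2) by metis
  then show "finite (below t)" "card (below t) \<le> N"
    using bij_betw_below[of t] bij_betw_finite bij_betw_same_card by metis+
qed

section \<open>Idempotents of a D-class and maximal subgroups\<close>

definition D_idempotents :: "'s::inverse_semigroup \<Rightarrow> 's set" where
  "D_idempotents i = {j. \<exists>x. x * star x = i \<and> star x * x = j}"

lemma D_relation_idempotents:
  fixes s :: "'s::inverse_semigroup"
  shows "D_relation `` {s} \<inter> idempotents = D_idempotents (s * star s)"
proof -
  have tt: "star t * t = t" if "t \<in> idempotents" for t :: 's
    using that by (simp add: star_idempotent idempotentsD)
  show ?thesis
  proof (rule equalityI; rule subsetI)
    fix t assume "t \<in> D_relation `` {s} \<inter> idempotents"
    then obtain x where "t \<in> idempotents" "s * star s = x * star x" "star t * t = star x * x"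
      by (auto simp: D_relation_def)
    then show "t \<in> D_idempotents (s * star s)" using tt[of t] by (auto simp: D_idempotents_def)
  next
    fix t assume "t \<in> D_idempotents (s * star s)"
    then obtain x where x: "x * star x = s * star s" "star x * x = t" by (auto simp: D_idempotents_def)
    then have t: "t \<in> idempotents" using idempotents_star(2) by blast
    then have "(s, t) \<in> D_relation"
      unfolding D_relation_def using x tt[OF t] by (intro CollectI case_prodI exI[of _ x]) simp
    then show "t \<in> D_relation `` {s} \<inter> idempotents" using t by blast
  qed
qed

lemma D_idempotents_subset: "D_idempotents i \<subseteq> (idempotents :: 's::inverse_semigroup set)"
  using idempotents_star(2) by (auto simp: D_idempotents_def)

lemma D_idempotents_refl: "i \<in> idempotents \<Longrightarrow> i \<in> D_idempotents i"
  by (auto simp: D_idempotents_def star_idempotent idempotentsD intro!: exI[of _ i])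

lemma D_idempotents_sym:
  assumes "j \<in> D_idempotents i"
  shows "i \<in> D_idempotents j"
proof -
  obtain x where "x * star x = i" "star x * x = j" using assms by (auto simp: D_idempotents_def)
  then show ?thesis by (auto simp: D_idempotents_def intro!: exI[of _ "star x"])
qed

lemma D_idempotents_trans:
  assumes "j \<in> D_idempotents i" "k \<in> D_idempotents j"
  shows "k \<in> D_idempotents i"
proof -
  obtain x y where x: "x * star x = i" "star x * x = j" and y: "y * star y = j" "star y * y = k"
    using assms by (auto simp: D_idempotents_def)
  have "(x * y) * star (x * y) = x * (y * star y) * star x" by (simp add: mult.assoc)
  also have "\<dots> = x * (star x * x) * star x" by (simp only: x y)
  also have "\<dots> = i" by (simp add: mult.assoc flip: x(1))
  finally have 1: "(x * y) * star (x * y) = i" .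
  have "star (x * y) * (x * y) = star y * (star x * x) * y" by (simp add: mult.assoc)
  also have "\<dots> = star y * (y * star y) * y" by (simp only: x y)
  also have "\<dots> = k" by (simp add: mult.assoc flip: y(2))
  finally show ?thesis using 1 unfolding D_idempotents_def by blast
qed

lemma D_idempotents_eq: "j \<in> D_idempotents i \<Longrightarrow> D_idempotents j = D_idempotents i"
  using D_idempotents_trans D_idempotents_sym by blast

lemma group_maximal_subgroup:
  fixes p :: "'s::inverse_semigroup"
  assumes p: "p \<in> idempotents"
  shows "group (maximal_subgroup p)"
proof (rule groupI)
  have pp: "p * p = p" "star p = p" using p by (simp_all add: idempotentsD star_idempotent)
  have id: "p * s = s" "s * p = s" if "s * star s = p" "star s * s = p" for s
    using that star_simps(1)[of s] by (metis mult.assoc)+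
  show "\<one>\<^bsub>maximal_subgroup p\<^esub> \<in> carrier (maximal_subgroup p)" by (simp add: maximal_subgroup_def pp)
  fix x y assume xy: "x \<in> carrier (maximal_subgroup p)" "y \<in> carrier (maximal_subgroup p)"
  have "x * (y * star y) * star x = p" "star y * (star x * x) * y = p"
    using xy id[of x] id[of y] by (auto simp: maximal_subgroup_def mult.assoc)
  then show "x \<otimes>\<^bsub>maximal_subgroup p\<^esub> y \<in> carrier (maximal_subgroup p)"
    by (simp add: maximal_subgroup_def mult.assoc)
  show "\<one>\<^bsub>maximal_subgroup p\<^esub> \<otimes>\<^bsub>maximal_subgroup p\<^esub> x = x"
    using xy id by (auto simp: maximal_subgroup_def)
  show "\<exists>y\<in>carrier (maximal_subgroup p). y \<otimes>\<^bsub>maximal_subgroup p\<^esub> x = \<one>\<^bsub>maximal_subgroup p\<^esub>"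
    using xy by (intro bexI[of _ "star x"]) (auto simp: maximal_subgroup_def)
qed (auto simp: maximal_subgroup_def mult.assoc)

section \<open>Bounded complex-linear maps\<close>

lemma bounded_clinearI:
  fixes T :: "'a::complex_normed_vector \<Rightarrow> 'b::complex_normed_vector"
  assumes "\<And>x y. T (x + y) = T x + T y" "\<And>c x. T (c *\<^sub>C x) = c *\<^sub>C T x"
    "\<And>x. norm (T x) \<le> K * norm x"
  shows "bounded_clinear T"
  unfolding bounded_clinear_def
proof
  show "bounded_linear T"
  proof (rule bounded_linear_intro[where K = K])
    show "T (r *\<^sub>R x) = r *\<^sub>R T x" for r x
      using assms(2)[of "complex_of_real r" x] by (simp add: scaleC_of_real)
  qed (use assms in \<open>auto simp: mult.commute\<close>)
qed (use assms in simp)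

lemma bounded_clinearD:
  assumes "bounded_clinear T"
  shows "T (x + y) = T x + T y" "T (c *\<^sub>C x) = c *\<^sub>C T x" "T 0 = 0" "T (x - y) = T x - T y"
    "T (sum f A) = (\<Sum>i\<in>A. T (f i))" "bounded_linear T"
  using assms unfolding bounded_clinear_def
  by (auto simp: linear_simps linear_sum bounded_linear.linear)

lemma bounded_clinear_diff:
  assumes "bounded_clinear T" "bounded_clinear U"
  shows "bounded_clinear (\<lambda>x. T x - U x)"
  unfolding bounded_clinear_def
proof
  show "bounded_linear (\<lambda>x. T x - U x)"
    using assms by (intro bounded_linear_sub bounded_clinearD)
  show "\<forall>c x. T (c *\<^sub>C x) - U (c *\<^sub>C x) = c *\<^sub>C (T x - U x)"
    using assms by (simp add: bounded_clinearD scaleC_add_right flip: scaleC_minus_one)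
      (metis add_diff_cancel diff_add_cancel scaleC_add_right scaleC_minus_one)
qed

lemma cdual_eqI: "(\<And>x. dual_apply f x = dual_apply g x) \<Longrightarrow> f = g"
  by (metis dual_apply_inject ext)

lemma dual_apply_simps [simp]:
  "dual_apply 0 x = 0" "dual_apply (f + g) x = dual_apply f x + dual_apply g x"
  "dual_apply (f - g) x = dual_apply f x - dual_apply g x"
  "dual_apply (c *\<^sub>C f) x = c * dual_apply f x"
  by (simp_all add: zero_cdual.rep_eq plus_cdual.rep_eq minus_cdual.rep_eq scaleC_cdual.rep_eq)

lemma dual_apply_sum [simp]: "dual_apply (sum f A) x = (\<Sum>i\<in>A. dual_apply (f i) x)"
  by (induction A rule: infinite_finite_induct) auto

lemma dual_apply_linear:
  "dual_apply f 0 = 0" "dual_apply f (x + y) = dual_apply f x + dual_apply f y"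
  "dual_apply f (x - y) = dual_apply f x - dual_apply f y"
  "dual_apply f (c *\<^sub>C x) = c * dual_apply f x"
  "dual_apply f (sum g A) = (\<Sum>i\<in>A. dual_apply f (g i))"
  using bounded_clinearD[OF bounded_clinear_dual_apply[of f]] by (simp_all add: scaleC_complex_def)

lemma dual_apply_Abs_cdual: "bounded_clinear f \<Longrightarrow> dual_apply (Abs_cdual f) x = f x"
  by (simp add: Abs_cdual_inverse)

section \<open>Functionals on \<open>\<ell>\<^sup>1\<close> and its projective tensor square\<close>

lemma ell1_apply_scaleC [simp]: "ell1_apply (c *\<^sub>C f) s = c * ell1_apply f s"
  by (simp add: scaleC_ell1.rep_eq)

lemma norm_ell1_delta [simp]: "norm (ell1_delta s) = 1"
proof -
  have "infsum (\<lambda>t. norm (if t = s then 1 else 0 :: complex)) UNIV = infsum (\<lambda>_. 1 :: real) {s}"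
    by (rule infsum_cong_neutral) auto
  then show ?thesis by (simp add: norm_ell1.rep_eq ell1_delta.rep_eq)
qed

text \<open>The partial sum over \<open>F\<close> agrees with \<open>f\<close> on \<open>F\<close>
  and vanishes elsewhere, so the norm of the error is exactly \<open>norm f\<close> minus the
  partial sum of the absolute values.\<close>

lemma ell1_has_sum_delta:
  "((\<lambda>s. ell1_apply f s *\<^sub>C ell1_delta s) has_sum f) UNIV"
  unfolding has_sum_def
proof (rule Lim_null[THEN iffD2], rule tendsto_norm_zero_cancel)
  have N: "norm ((\<Sum>s\<in>F. ell1_apply f s *\<^sub>C ell1_delta s) - f) = norm f - (\<Sum>s\<in>F. norm (ell1_apply f s))"
    if F: "finite F" for F
  proof -
    let ?g = "(\<Sum>s\<in>F. ell1_apply f s *\<^sub>C ell1_delta s) - f"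
    have g: "ell1_apply ?g t = (if t \<in> F then 0 else - ell1_apply f t)" for t
      using F by (simp add: ell1_delta.rep_eq if_distrib[of "(*) _"] sum.delta cong: if_cong)
    have "((\<lambda>s. norm (ell1_apply f s)) has_sum norm ?g) (- F)"
      using ell1_has_sum_norm[of ?g] unfolding g
      by (rule has_sum_cong_neutral[THEN iffD1, rotated -1]) auto
    from has_sum_Un_disjoint[OF has_sum_finite[OF F] this]
    have "((\<lambda>s. norm (ell1_apply f s)) has_sum ((\<Sum>s\<in>F. norm (ell1_apply f s)) + norm ?g)) UNIV"
      by simp
    from has_sum_unique[OF this ell1_has_sum_norm] show ?thesis by simp
  qed
  have "((\<lambda>F. norm f - (\<Sum>s\<in>F. norm (ell1_apply f s))) \<longlongrightarrow> norm f - norm f) (finite_subsets_at_top UNIV)"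
    using ell1_has_sum_norm[of f] unfolding has_sum_def by (intro tendsto_diff tendsto_const)
  then show "((\<lambda>F. norm ((\<Sum>s\<in>F. ell1_apply f s *\<^sub>C ell1_delta s) - f)) \<longlongrightarrow> 0) (finite_subsets_at_top UNIV)"
    by (subst tendsto_cong[OF eventually_finite_subsets_at_top_weakI]) (auto intro: N)
qed

text \<open>Partial sums of the point-mass expansion obey the bound by the triangle inequality, and
  continuity of \<open>T\<close> carries it to \<open>f\<close>. The case \<open>K = 0\<close> shows
  that point masses determine a bounded operator.\<close>

lemma ell1_bounded_clinear_norm_le:
  fixes T :: "'s ell1 \<Rightarrow> 'b::complex_normed_vector"
  assumes T: "bounded_clinear T" and K: "\<And>s. norm (T (ell1_delta s)) \<le> K"
  shows "norm (T f) \<le> K * norm f"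
proof -
  have K0: "K \<ge> 0" using K norm_ge_zero order_trans by blast
  have "((\<lambda>F. T (\<Sum>s\<in>F. ell1_apply f s *\<^sub>C ell1_delta s)) \<longlongrightarrow> T f) (finite_subsets_at_top UNIV)"
    using ell1_has_sum_delta[of f] unfolding has_sum_def
    by (rule bounded_linear.tendsto[OF bounded_clinearD(6)[OF T]])
  then have "((\<lambda>F. norm (T (\<Sum>s\<in>F. ell1_apply f s *\<^sub>C ell1_delta s))) \<longlongrightarrow> norm (T f)) (finite_subsets_at_top UNIV)"
    by (rule tendsto_norm)
  then show ?thesis
  proof (rule tendsto_upperbound)
    show "\<forall>\<^sub>F F in finite_subsets_at_top UNIV. norm (T (\<Sum>s\<in>F. ell1_apply f s *\<^sub>C ell1_delta s)) \<le> K * norm f"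
    proof (rule eventually_finite_subsets_at_top_weakI)
      fix F :: "'s set" assume F: "finite F"
      have "norm (T (\<Sum>s\<in>F. ell1_apply f s *\<^sub>C ell1_delta s)) \<le> (\<Sum>s\<in>F. norm (ell1_apply f s) * norm (T (ell1_delta s)))"
        using T by (auto simp: bounded_clinearD norm_scaleC intro: sum_norm_le)
      also have "\<dots> \<le> (\<Sum>s\<in>F. norm (ell1_apply f s) * K)"
        by (intro sum_mono mult_left_mono K) auto
      also have "\<dots> \<le> norm f * K"
        using finite_sum_le_has_sum[OF ell1_has_sum_norm[of f] F] K0
        by (auto simp flip: sum_distrib_right intro!: mult_right_mono)
      finally show "norm (T (\<Sum>s\<in>F. ell1_apply f s *\<^sub>C ell1_delta s)) \<le> K * norm f" by (simp add: mult.commute)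
    qed
  qed simp
qed

lemma ell1_bounded_clinear_eqI:
  fixes T U :: "'s ell1 \<Rightarrow> 'b::complex_normed_vector"
  assumes "bounded_clinear T" "bounded_clinear U" "\<And>s. T (ell1_delta s) = U (ell1_delta s)"
  shows "T f = U f"
  using ell1_bounded_clinear_norm_le[OF bounded_clinear_diff[OF assms(1,2)], of 0 f] assms(3) by simp

text \<open>The duality pairing between l-infinity and l1, meaningful for bounded
  \<open>k\<close>.\<close>

definition ell1_pair :: "('s \<Rightarrow> complex) \<Rightarrow> 's ell1 \<Rightarrow> complex" where
  "ell1_pair k f = infsum (\<lambda>s. k s * ell1_apply f s) UNIV"

lemma ell1_pair:
  assumes k: "\<And>s. cmod (k s) \<le> C"
  shows "bounded_clinear (ell1_pair k)" "cmod (ell1_pair k f) \<le> C * norm f"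
    "ell1_pair k (ell1_delta s) = k s"
proof -
  have Cs: "((\<lambda>s. C * norm (ell1_apply f s)) has_sum C * norm f) UNIV" for f
    by (rule has_sum_cmult_right[OF ell1_has_sum_norm])
  have le: "cmod (k s * ell1_apply f s) \<le> C * norm (ell1_apply f s)" for f s
    using k by (simp add: norm_mult mult_right_mono)
  have abs: "(\<lambda>s. cmod (k s * ell1_apply f s)) summable_on UNIV" for f
    by (rule summable_on_comparison_test[OF has_sum_imp_summable[OF Cs]]) (use le in auto)
  note sm = abs_summable_summable[OF abs]
  show n: "cmod (ell1_pair k f) \<le> C * norm f" for f
    unfolding ell1_pair_def using norm_infsum_bound[OF abs[of f]]
      has_sum_mono[OF has_sum_infsum[OF abs[of f]] Cs[of f] le[of _ f]] by linarith
  show "bounded_clinear (ell1_pair k)"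
    by (rule bounded_clinearI[where K = C])
       (simp_all add: n, simp_all add: ell1_pair_def ring_distribs infsum_add sm scaleC_complex_def
          mult.left_commute infsum_cmult_right')
  have "ell1_pair k (ell1_delta s) = infsum (\<lambda>t. k t) {s}"
    unfolding ell1_pair_def by (rule infsum_cong_neutral) (auto simp: ell1_delta.rep_eq)
  then show "ell1_pair k (ell1_delta s) = k s" by simp
qed

definition ell1_functional :: "('s \<Rightarrow> complex) \<Rightarrow> 's ell1 cdual" where
  "ell1_functional k = Abs_cdual (ell1_pair k)"

lemma ell1_functional:
  assumes "\<And>s. cmod (k s) \<le> C"
  shows "dual_apply (ell1_functional k) (ell1_delta s) = k s" "norm (ell1_functional k) \<le> C"
proof -
  have C: "C \<ge> 0" using assms norm_ge_zero order_trans by blast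
  show "dual_apply (ell1_functional k) (ell1_delta s) = k s"
    by (simp add: ell1_functional_def dual_apply_Abs_cdual[OF ell1_pair(1)[OF assms]] ell1_pair(3)[OF assms])
  show "norm (ell1_functional k) \<le> C"
    by (rule norm_cdual_le[OF C])
       (simp add: ell1_functional_def dual_apply_Abs_cdual[OF ell1_pair(1)[OF assms]] ell1_pair(2)[OF assms])
qed

lemma ell1_cdual_eqI:
  assumes "\<And>s. dual_apply f (ell1_delta s) = dual_apply g (ell1_delta s)"
  shows "f = g"
  by (rule cdual_eqI, rule ell1_bounded_clinear_eqI) (use assms bounded_clinear_dual_apply in auto)

text \<open>The uniqueness half of the universal property, read for functionals.\<close>

lemma ptensor_cdual_eqI:
  fixes F G :: "('a::complex_normed_vector, 'b::complex_normed_vector) ptensor cdual"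
  assumes "\<And>x y. dual_apply F (tensor x y) = dual_apply G (tensor x y)"
  shows "F = G"
proof -
  have "bounded_cbilinear (\<lambda>x y. dual_apply G (tensor x y))"
    by (rule bounded_cbilinear_compose[OF bounded_clinear_dual_apply bounded_cbilinear_tensor])
  from ptensor_universal(1)[OF this] have "dual_apply F = dual_apply G"
    using assms bounded_clinear_dual_apply by blast
  then show ?thesis by (simp add: dual_apply_inject)
qed

lemma bounded_cbilinearD:
  assumes "bounded_cbilinear \<phi>"
  shows "bounded_clinear (\<lambda>x. \<phi> x y)" "bounded_clinear (\<phi> x)"
  using assms unfolding bounded_cbilinear_def bounded_clinear_def
  by (auto intro: bounded_bilinear.bounded_linear_left bounded_bilinear.bounded_linear_right)

lemma ell1_ptensor_cdual_eqI:
  fixes F G :: "('s ell1, 't ell1) ptensor cdual"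
  assumes "\<And>s t. dual_apply F (tensor (ell1_delta s) (ell1_delta t)) = dual_apply G (tensor (ell1_delta s) (ell1_delta t))"
  shows "F = G"
proof (rule ptensor_cdual_eqI)
  note b = bounded_cbilinearD[OF bounded_cbilinear_compose[OF bounded_clinear_dual_apply bounded_cbilinear_tensor]]
  fix x :: "'s ell1" and y :: "'t ell1"
  show "dual_apply F (tensor x y) = dual_apply G (tensor x y)"
    by (rule ell1_bounded_clinear_eqI[OF b(1) b(1)], rule ell1_bounded_clinear_eqI[OF b(2) b(2)], rule assms)
qed

text \<open>A bounded kernel is a bounded function on the product set; this is the map from
  l-infinity of the product set into the dual of the projective tensor product.\<close>

definition ell1_tensor_functional :: "('s \<Rightarrow> 't \<Rightarrow> complex) \<Rightarrow> ('s ell1, 't ell1) ptensor cdual" where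
  "ell1_tensor_functional K = Abs_cdual (ptensor_lift (\<lambda>a b. ell1_pair (\<lambda>s. ell1_pair (K s) b) a))"

lemma ell1_tensor_functional:
  fixes K :: "'s \<Rightarrow> 't \<Rightarrow> complex"
  assumes K: "\<And>s t. cmod (K s t) \<le> C"
  shows "dual_apply (ell1_tensor_functional K) (tensor (ell1_delta s) (ell1_delta t)) = K s t"
    "norm (ell1_tensor_functional K) \<le> C"
proof -
  have C: "C \<ge> 0" using K norm_ge_zero order_trans by blast
  let ?\<phi> = "\<lambda>a b. ell1_pair (\<lambda>s. ell1_pair (K s) b) a"
  note K1 = ell1_pair[of "K s" C for s, OF K]
  note K2 = ell1_pair[of "\<lambda>s. ell1_pair (K s) b" "C * norm b" for b, OF K1(2)]
  have bnd: "cmod (?\<phi> a b) \<le> C * (norm a * norm b)" for a b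
    by (rule order_trans[OF K2(2)]) (simp add: ac_simps)
  have lin: "?\<phi> a (b + b') = ?\<phi> a b + ?\<phi> a b'" "?\<phi> a (c *\<^sub>C b) = c * ?\<phi> a b" for a b b' c
  proof -
    have sm: "(\<lambda>s. ell1_pair (K s) b * ell1_apply a s) summable_on UNIV" for b
    proof (rule abs_summable_summable, rule summable_on_comparison_test)
      show "(\<lambda>s. (C * norm b) * norm (ell1_apply a s)) summable_on UNIV"
        by (intro summable_on_cmult_right has_sum_imp_summable[OF ell1_has_sum_norm])
      show "norm (ell1_pair (K s) b * ell1_apply a s) \<le> (C * norm b) * norm (ell1_apply a s)" for s
        using K1(2) by (simp add: norm_mult mult_right_mono)
    qed simp
    show "?\<phi> a (b + b') = ?\<phi> a b + ?\<phi> a b'"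
      unfolding ell1_pair_def[of "\<lambda>s. ell1_pair (K s) _"]
      by (simp add: bounded_clinearD[OF K1(1)] ring_distribs infsum_add[OF sm sm])
    show "?\<phi> a (c *\<^sub>C b) = c * ?\<phi> a b"
      unfolding ell1_pair_def[of "\<lambda>s. ell1_pair (K s) _"]
      by (simp add: bounded_clinearD[OF K1(1)] scaleC_complex_def mult.assoc infsum_cmult_right')
  qed
  have bil: "bounded_cbilinear ?\<phi>"
    unfolding bounded_cbilinear_def
  proof (intro conjI allI)
    show "bounded_bilinear ?\<phi>"
    proof
      show "?\<phi> (r *\<^sub>R a) b = r *\<^sub>R ?\<phi> a b" for r a b
        by (simp add: linear_simps(5)[OF bounded_clinearD(6)[OF K2(1)]])
      show "?\<phi> a (r *\<^sub>R b) = r *\<^sub>R ?\<phi> a b" for r a b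
        using lin(2)[where a = a and b = b and c = "complex_of_real r"] by (simp add: scaleC_of_real scaleR_conv_of_real)
      show "\<exists>D. \<forall>a b. norm (?\<phi> a b) \<le> norm a * norm b * D"
        using bnd by (auto simp: mult.commute)
    qed (simp_all add: lin bounded_clinearD[OF K2(1)])
  qed (simp_all add: lin bounded_clinearD[OF K2(1)] scaleC_complex_def)
  note L = ptensor_lift[OF bil]
  show "dual_apply (ell1_tensor_functional K) (tensor (ell1_delta s) (ell1_delta t)) = K s t"
    by (simp add: ell1_tensor_functional_def dual_apply_Abs_cdual[OF L(1)] L(2) K2(3) ell1_pair(3)[of "\<lambda>s. K s t" C, OF K] K1(3))
  show "norm (ell1_tensor_functional K) \<le> C"
    by (rule norm_cdual_le[OF C])
       (simp add: ell1_tensor_functional_def dual_apply_Abs_cdual[OF L(1)]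
         ptensor_universal(2)[OF bil L bnd C])
qed

section \<open>Module actions on biduals\<close>

text \<open>The action on the bidual is the second adjoint of the action on the module: each
  dualisation swaps the sides, so left becomes left again.\<close>

lemma bidual_lact_apply:
  assumes "bounded_clinear (lact a)"
  shows "dual_apply (bidual_lact lact a m) f = dual_apply m (adjoint (lact a) f)"
  using bounded_clinear_adjoint[OF assms] by (simp add: bidual_lact_def dual_lact_def dual_ract_def)

lemma bidual_ract_apply:
  assumes "bounded_clinear (\<lambda>x. ract x a)"
  shows "dual_apply (bidual_ract ract m a) f = dual_apply m (adjoint (\<lambda>x. ract x a) f)"
  using bounded_clinear_adjoint[OF assms] by (simp add: bidual_ract_def dual_lact_def dual_ract_def)

lemma bounded_clinear_mult:
  fixes a :: "'a::complex_banach_algebra"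
  shows "bounded_clinear ((*) a)" "bounded_clinear (\<lambda>x. x * a)"
  using bounded_cbilinearD[OF bounded_cbilinear_times] by auto

lemma norm_ptensor_act_le:
  fixes a :: "'a::complex_banach_algebra"
  shows "norm (ptensor_lact a u) \<le> norm a * norm u" "norm (ptensor_ract u a) \<le> norm a * norm u"
proof -
  have t: "bounded_bilinear (tensor :: 'a \<Rightarrow> 'a \<Rightarrow> _)" "tensor (z *\<^sub>C x) y = z *\<^sub>C tensor x y"
    "tensor x (z *\<^sub>C y) = z *\<^sub>C tensor x y" for z and x y :: 'a
    using bounded_cbilinear_tensor unfolding bounded_cbilinear_def by blast+
  have "bounded_cbilinear (\<lambda>b c::'a. tensor (a * b) c)"
    unfolding bounded_cbilinear_def
    using bounded_bilinear.comp[OF t(1) bounded_linear_mult_right[of a] bounded_linear_ident]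
    by (auto simp: t scaleC_mult_right)
  moreover have "norm (tensor (a * b) c) \<le> norm a * (norm b * norm c)" for b c
    by (rule order_trans[OF norm_tensor_le]) (simp add: norm_mult_ineq mult_right_mono flip: mult.assoc)
  ultimately show "norm (ptensor_lact a u) \<le> norm a * norm u"
    by (intro ptensor_universal(2)[where f = "ptensor_lact a"]) (auto simp: ptensor_lact)
  have "bounded_cbilinear (\<lambda>(b::'a) c. tensor b (c * a))"
    unfolding bounded_cbilinear_def
    using bounded_bilinear.comp[OF t(1) bounded_linear_ident bounded_linear_mult_left[of a]]
    by (auto simp: t scaleC_mult_left)
  moreover have "norm (tensor b (c * a)) \<le> norm a * (norm b * norm c)" for b c
    by (rule order_trans[OF norm_tensor_le])
       (metis norm_mult_ineq mult_left_mono norm_ge_zero mult.commute mult.left_commute)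
  ultimately show "norm (ptensor_ract u a) \<le> norm a * norm u"
    by (intro ptensor_universal(2)[where f = "\<lambda>u. ptensor_ract u a"]) (auto simp: ptensor_ract)
qed

text \<open>Linearity and continuity in \<open>a\<close> for fixed \<open>F\<close>; with this,
  commutation of \<open>m\<close> with the whole algebra has to be checked on basis elements
  only.\<close>

lemma bounded_clinear_bidual_ptensor_act:
  fixes m :: "('a::complex_banach_algebra, 'a) ptensor cdual cdual"
  shows "bounded_clinear (\<lambda>a. dual_apply (bidual_lact ptensor_lact a m) F)"
    "bounded_clinear (\<lambda>a. dual_apply (bidual_ract ptensor_ract m a) F)"
proof -
  note t = bounded_clinearD[OF bounded_cbilinearD(1)[OF bounded_cbilinear_tensor]]
    bounded_clinearD[OF bounded_cbilinearD(2)[OF bounded_cbilinear_tensor]]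
  have n: "norm (dual_apply F x) \<le> norm F * norm a * norm u" if "norm x \<le> norm a * norm u"
    for x u :: "('a, 'a) ptensor" and a :: 'a
    using order_trans[OF norm_dual_apply_le mult_left_mono[OF that norm_ge_zero]] by (simp add: mult.assoc)
  have l: "adjoint (ptensor_lact (a + b)) F = adjoint (ptensor_lact a) F + adjoint (ptensor_lact b) F"
    "adjoint (ptensor_lact (c *\<^sub>C a)) F = c *\<^sub>C adjoint (ptensor_lact a) F"
    "norm (adjoint (ptensor_lact a) F) \<le> norm F * norm a" for a b :: 'a and c
    by (rule ptensor_cdual_eqI norm_cdual_le; simp add: ptensor_lact ring_distribs scaleC_mult_left t
        dual_apply_linear n norm_ptensor_act_le)+
  have "norm (dual_apply m (adjoint (ptensor_lact a) F)) \<le> norm m * norm F * norm a" for a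
    using order_trans[OF norm_dual_apply_le mult_left_mono[OF l(3) norm_ge_zero]] by (simp add: mult.assoc)
  then show "bounded_clinear (\<lambda>a. dual_apply (bidual_lact ptensor_lact a m) F)"
    by (intro bounded_clinearI)
       (auto simp: bidual_lact_apply[OF ptensor_lact(1)] l dual_apply_linear scaleC_complex_def)
  have r: "adjoint (\<lambda>u. ptensor_ract u (a + b)) F = adjoint (\<lambda>u. ptensor_ract u a) F + adjoint (\<lambda>u. ptensor_ract u b) F"
    "adjoint (\<lambda>u. ptensor_ract u (c *\<^sub>C a)) F = c *\<^sub>C adjoint (\<lambda>u. ptensor_ract u a) F"
    "norm (adjoint (\<lambda>u. ptensor_ract u a) F) \<le> norm F * norm a" for a b :: 'a and c
    by (rule ptensor_cdual_eqI norm_cdual_le; simp add: ptensor_ract ring_distribs scaleC_mult_right t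
        dual_apply_linear n norm_ptensor_act_le)+
  have "norm (dual_apply m (adjoint (\<lambda>u. ptensor_ract u a) F)) \<le> norm m * norm F * norm a" for a
    using order_trans[OF norm_dual_apply_le mult_left_mono[OF r(3) norm_ge_zero]] by (simp add: mult.assoc)
  then show "bounded_clinear (\<lambda>a. dual_apply (bidual_ract ptensor_ract m a) F)"
    by (intro bounded_clinearI)
       (auto simp: bidual_ract_apply[OF ptensor_ract(1)] r dual_apply_linear scaleC_complex_def)
qed

lemma bidual_act_embed:
  fixes a b :: "'a::complex_banach_algebra"
  shows "bidual_lact (*) a (bidual_embed b) = bidual_embed (a * b)"
    "bidual_ract (*) (bidual_embed b) a = bidual_embed (b * a)"
  by (rule cdual_eqI; simp add: bidual_lact_apply bidual_ract_apply bounded_clinear_mult)+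

lemma norm_bidual_embed_le: "norm (bidual_embed x) \<le> norm x"
  by (rule norm_cdual_le) (simp_all add: norm_dual_apply_le mult.commute[of "norm x"])

lemma bidual_embed_diff: "bidual_embed (x - y) = bidual_embed x - bidual_embed y"
  by (rule cdual_eqI) (simp add: dual_apply_linear)

section \<open>Invariant means from asymptotically invariant functionals\<close>

text \<open>Tychonoff: the family lives in a product of compact intervals, so it has a cluster
  point, reached along a finer filter.\<close>

lemma subnet_of_bounded_family:
  fixes q :: "'i \<Rightarrow> 'x \<Rightarrow> real"
  assumes F: "F \<noteq> bot" and q: "\<And>i x. \<bar>q i x\<bar> \<le> c x"
  obtains G Q where "G \<le> F" "G \<noteq> bot" "\<And>x. ((\<lambda>i. q i x) \<longlongrightarrow> Q x) G"
proof -
  let ?K = "Pi\<^sub>E UNIV (\<lambda>x. {- c x..c x})"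
  have "compactin (product_topology (\<lambda>_. euclidean) UNIV) ?K"
    unfolding compactin_PiE by simp
  then have "compact ?K" by (simp add: euclidean_product_topology)
  moreover have "filtermap q F \<noteq> bot" using F by (simp add: filtermap_bot_iff)
  moreover have "eventually (\<lambda>y. y \<in> ?K) (filtermap q F)"
    using q by (auto simp: eventually_filtermap abs_le_iff minus_le_iff intro!: always_eventually)
  ultimately obtain Q where Q: "inf (nhds Q) (filtermap q F) \<noteq> bot"
    unfolding compact_filter by blast
  \<comment> \<open>\<open>G\<close> adds to \<open>F\<close> the preimages of the neighbourhoods of
    \<open>Q\<close>; it is proper because \<open>Q\<close> is a cluster point.\<close>
  define G where "G = inf F (filtercomap q (nhds Q))"
  show ?thesis
  proof
    show "G \<le> F" by (simp add: G_def)
    show "G \<noteq> bot"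
    proof
      assume "G = bot"
      then have "eventually (\<lambda>_. False) G" by simp
      then obtain P R where "eventually P F" "eventually R (nhds Q)" "\<And>i. P i \<Longrightarrow> \<not> R (q i)"
        unfolding G_def eventually_inf eventually_filtercomap by blast
      then have "eventually (\<lambda>y. \<not> R y) (filtermap q F)" "eventually R (nhds Q)"
        by (auto simp: eventually_filtermap elim: eventually_mono)
      then have "eventually (\<lambda>_. False) (inf (nhds Q) (filtermap q F))"
        unfolding eventually_inf by blast
      then show False using Q by (simp add: trivial_limit_def)
    qed
    have G: "filterlim q (nhds Q) G"
      unfolding G_def by (rule filterlim_mono[OF filterlim_filtercomap order_refl inf.cobounded2])
    show "((\<lambda>i. q i x) \<longlongrightarrow> Q x) G" for x
    proof -
      have "continuous_on UNIV (\<lambda>y::'x \<Rightarrow> real. y x)" by (rule continuous_on_product_coordinates)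
      from continuous_on_tendsto_compose[OF this G] show ?thesis by simp
    qed
  qed
qed

section \<open>The modulus of a bounded functional\<close>

definition bounded_by :: "'g set \<Rightarrow> ('g \<Rightarrow> real) \<Rightarrow> real \<Rightarrow> bool" where
  "bounded_by X f c \<longleftrightarrow> (\<forall>x\<in>X. \<bar>f x\<bar> \<le> c)"

lemma bounded_by_bounded: "bounded (f ` X) \<longleftrightarrow> (\<exists>c. bounded_by X f c)"
  by (auto simp: bounded_by_def bounded_iff)

text \<open>For a bounded linear functional \<open>n\<close> and a function \<open>f\<close> that is
  bounded and nonnegative on \<open>X\<close>, this is the modulus of \<open>n\<close> evaluated at
  \<open>f\<close>.\<close>

definition total_variation :: "'g set \<Rightarrow> (('g \<Rightarrow> real) \<Rightarrow> real) \<Rightarrow> ('g \<Rightarrow> real) \<Rightarrow> real" where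
  "total_variation X n f = Sup (n ` {u. \<forall>x\<in>X. \<bar>u x\<bar> \<le> f x})"

text \<open>Functions are defined on the whole type, but only their values on \<open>X\<close> count
  (see \<open>eq_on\<close>); the explicit bound \<open>c\<close> stands in for the supremum norm
  over \<open>X\<close>.\<close>

locale bounded_functional =
  fixes X :: "'g set" and n :: "('g \<Rightarrow> real) \<Rightarrow> real"
  assumes bound: "\<exists>B. \<forall>f c. bounded_by X f c \<longrightarrow> \<bar>n f\<bar> \<le> B * c"
    and add: "bounded_by X f c \<Longrightarrow> bounded_by X g d \<Longrightarrow> n (\<lambda>x. f x + g x) = n f + n g"
    and scale: "bounded_by X f c \<Longrightarrow> n (\<lambda>x. r * f x) = r * n f"
begin

abbreviation "P \<equiv> total_variation X n"

text \<open>The difference of \<open>f\<close> and \<open>g\<close> is bounded by \<open>0\<close>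
  on \<open>X\<close>, so \<open>bound\<close> forces \<open>n\<close> to vanish on it.\<close>

lemma eq_on:
  assumes "bounded_by X f c" "\<And>x. x \<in> X \<Longrightarrow> f x = g x"
  shows "n f = n g"
proof -
  obtain B where B: "\<And>f c. bounded_by X f c \<Longrightarrow> \<bar>n f\<bar> \<le> B * c" using bound by blast
  have g: "bounded_by X g c" using assms by (simp add: bounded_by_def)
  have g': "bounded_by X (\<lambda>x. (-1) * g x) c" using g by (simp add: bounded_by_def)
  have "\<bar>n (\<lambda>x. f x + (-1) * g x)\<bar> \<le> B * 0" by (rule B) (use assms in \<open>simp add: bounded_by_def\<close>)
  moreover have "n (\<lambda>x. f x + (-1) * g x) = n f + (-1) * n g"
    by (simp only: add[OF assms(1) g'] scale[OF g])
  ultimately show ?thesis by simp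
qed

lemma variation_upper:
  assumes f: "\<And>x. x \<in> X \<Longrightarrow> f x \<le> c" and u: "\<And>x. x \<in> X \<Longrightarrow> \<bar>u x\<bar> \<le> f x"
  shows "n u \<le> P f"
proof -
  obtain B where B: "\<And>f c. bounded_by X f c \<Longrightarrow> \<bar>n f\<bar> \<le> B * c" using bound by blast
  have "bdd_above (n ` {u. \<forall>x\<in>X. \<bar>u x\<bar> \<le> f x})"
  proof (rule bdd_aboveI2[where M = "B * c"])
    fix u assume "u \<in> {u. \<forall>x\<in>X. \<bar>u x\<bar> \<le> f x}"
    then have "bounded_by X u c" using f unfolding bounded_by_def by force
    then show "n u \<le> B * c" using B by fastforce
  qed
  then show ?thesis unfolding total_variation_def by (intro cSup_upper) (use u in auto)
qed

lemma variation_least: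
  assumes "\<And>x. x \<in> X \<Longrightarrow> 0 \<le> f x" "\<And>u. (\<And>x. x \<in> X \<Longrightarrow> \<bar>u x\<bar> \<le> f x) \<Longrightarrow> n u \<le> y"
  shows "P f \<le> y"
proof -
  have "(\<lambda>_. 0) \<in> {u. \<forall>x\<in>X. \<bar>u x\<bar> \<le> f x}" using assms(1) by simp
  then have "n ` {u. \<forall>x\<in>X. \<bar>u x\<bar> \<le> f x} \<noteq> {}" by (simp only: image_is_empty) (rule notI, simp only: empty_iff)
  moreover have "z \<le> y" if z: "z \<in> n ` {u. \<forall>x\<in>X. \<bar>u x\<bar> \<le> f x}" for z
  proof -
    obtain u where "z = n u" "\<And>x. x \<in> X \<Longrightarrow> \<bar>u x\<bar> \<le> f x" using z by blast
    then show ?thesis using assms(2)[of u] by simp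
  qed
  ultimately show ?thesis unfolding total_variation_def by (rule cSup_least)
qed

lemma variation_nonneg:
  assumes "\<And>x. x \<in> X \<Longrightarrow> 0 \<le> f x" "\<And>x. x \<in> X \<Longrightarrow> f x \<le> c"
  shows "0 \<le> P f"
proof -
  have "n (\<lambda>x. 0 * 0) = 0 * n (\<lambda>_. 0)" by (rule scale[where c = 0]) (simp add: bounded_by_def)
  then show ?thesis using variation_upper[of f c "\<lambda>_. 0"] assms by simp
qed

lemma variation_scale:
  assumes f: "\<And>x. x \<in> X \<Longrightarrow> 0 \<le> f x" "\<And>x. x \<in> X \<Longrightarrow> f x \<le> c" and r: "0 \<le> r"
  shows "P (\<lambda>x. r * f x) = r * P f"
proof (cases "r = 0")
  case True
  have "P (\<lambda>_. 0) \<le> 0"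
  proof (rule variation_least)
    fix u :: "'g \<Rightarrow> real" assume "\<And>x. x \<in> X \<Longrightarrow> \<bar>u x\<bar> \<le> 0"
    then have "n u = n (\<lambda>x. 0 * u x)" by (intro eq_on[where c = 0]) (auto simp: bounded_by_def)
    also have "\<dots> = 0 * n u" using \<open>\<And>x. x \<in> X \<Longrightarrow> \<bar>u x\<bar> \<le> 0\<close>
      by (intro scale[where c = 0]) (auto simp: bounded_by_def)
    finally show "n u \<le> 0" by simp
  qed simp
  then show ?thesis using True variation_nonneg[of "\<lambda>_. 0" 0] by simp
next
  case False
  then have r: "r > 0" using r by simp
  have up: "n u \<le> P g" if "\<And>x. x \<in> X \<Longrightarrow> \<bar>u x\<bar> \<le> g x" "\<And>x. x \<in> X \<Longrightarrow> g x \<le> d" for u g d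
    using variation_upper that by metis
  have sc: "n (\<lambda>x. s * u x) = s * n u" if "\<And>x. x \<in> X \<Longrightarrow> \<bar>u x\<bar> \<le> g x" "\<And>x. x \<in> X \<Longrightarrow> g x \<le> d" for u g d s
    by (rule scale[where c = d]) (use that in \<open>fastforce simp: bounded_by_def\<close>)
  show ?thesis
  proof (rule antisym)
    show "P (\<lambda>x. r * f x) \<le> r * P f"
    proof (rule variation_least)
      fix u assume u: "\<And>x. x \<in> X \<Longrightarrow> \<bar>u x\<bar> \<le> r * f x"
      have "inverse r * n u = n (\<lambda>x. inverse r * u x)"
        using sc[of u "\<lambda>x. r * f x" "r * c" "inverse r"] u f r by simp
      also have "\<dots> \<le> P f" by (rule up[of _ _ c]) (use u f r in \<open>auto simp: abs_mult field_simps\<close>)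
      finally show "n u \<le> r * P f" using r by (simp add: field_simps)
    qed (use f r in simp)
    have "P f \<le> P (\<lambda>x. r * f x) / r"
    proof (rule variation_least)
      fix u assume u: "\<And>x. x \<in> X \<Longrightarrow> \<bar>u x\<bar> \<le> f x"
      have "r * n u = n (\<lambda>x. r * u x)" using sc[of u f c r] u f by simp
      also have "\<dots> \<le> P (\<lambda>x. r * f x)"
        by (rule up[of _ _ "r * c"]) (use u f r in \<open>auto simp: abs_mult\<close>)
      finally show "n u \<le> P (\<lambda>x. r * f x) / r" using r by (simp add: field_simps)
    qed (use f in simp)
    then show "r * P f \<le> P (\<lambda>x. r * f x)" using r by (simp add: field_simps)
  qed
qed

lemma variation_le:
  assumes "\<And>x. x \<in> X \<Longrightarrow> 0 \<le> f x" "\<And>x. x \<in> X \<Longrightarrow> f x \<le> c" "0 \<le> c"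
  shows "P f \<le> c * P (\<lambda>_. 1)"
proof -
  have "P f \<le> P (\<lambda>_. c * 1)"
    by (rule variation_least, rule assms, assumption, rule variation_upper[of _ c])
       (use assms in fastforce)+
  also have "\<dots> = c * P (\<lambda>_. 1)" by (rule variation_scale[of _ 1]) (use assms in auto)
  finally show ?thesis .
qed

text \<open>Additivity is the Riesz decomposition property: truncating \<open>u\<close> at \<open>f\<close> splits \<open>\<bar>u\<bar> \<le> f + g\<close>.\<close>

lemma variation_add:
  assumes f: "\<And>x. x \<in> X \<Longrightarrow> 0 \<le> f x" "\<And>x. x \<in> X \<Longrightarrow> f x \<le> c"
    and g: "\<And>x. x \<in> X \<Longrightarrow> 0 \<le> g x" "\<And>x. x \<in> X \<Longrightarrow> g x \<le> d"
  shows "P (\<lambda>x. f x + g x) = P f + P g"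
proof (rule antisym)
  show "P (\<lambda>x. f x + g x) \<le> P f + P g"
  proof (rule variation_least)
    fix u assume u: "\<And>x. x \<in> X \<Longrightarrow> \<bar>u x\<bar> \<le> f x + g x"
    let ?v = "\<lambda>x. max (- f x) (min (f x) (u x))"
    have v: "\<bar>?v x\<bar> \<le> f x" "\<bar>u x - ?v x\<bar> \<le> g x" if "x \<in> X" for x
      using f(1)[OF that] g(1)[OF that] u[OF that] by (auto simp: max_def min_def abs_if split: if_splits)
    have "bounded_by X ?v c" "bounded_by X (\<lambda>x. u x - ?v x) d"
      unfolding bounded_by_def using v f(2) g(2) order_trans by blast+
    from add[OF this] have "n u = n ?v + n (\<lambda>x. u x - ?v x)" by simp
    also have "\<dots> \<le> P f + P g" by (intro add_mono variation_upper[of _ c] variation_upper[of _ d] f g v)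
    finally show "n u \<le> P f + P g" .
  qed (use f g in \<open>simp add: add_nonneg_nonneg\<close>)
  have fg: "n u + n v \<le> P (\<lambda>x. f x + g x)"
    if u: "\<And>x. x \<in> X \<Longrightarrow> \<bar>u x\<bar> \<le> f x" and v: "\<And>x. x \<in> X \<Longrightarrow> \<bar>v x\<bar> \<le> g x" for u v
  proof -
    have "bounded_by X u c" "bounded_by X v d"
      unfolding bounded_by_def using u v f(2) g(2) order_trans by blast+
    from add[OF this] have "n u + n v = n (\<lambda>x. u x + v x)" by simp
    also have "\<dots> \<le> P (\<lambda>x. f x + g x)"
      by (rule variation_upper[of _ "c + d"]) (use u v f g in \<open>force intro: add_mono order_trans[OF abs_triangle_ineq]\<close>)+
    finally show ?thesis .
  qed
  \<comment> \<open>For the reverse inequality fix \<open>u\<close> and take the supremum over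
    \<open>v\<close>, then the supremum over \<open>u\<close>.\<close>
  have "P g \<le> P (\<lambda>x. f x + g x) - n u" if u: "\<And>x. x \<in> X \<Longrightarrow> \<bar>u x\<bar> \<le> f x" for u
    by (rule variation_least) (use g fg[OF u] in \<open>auto simp: algebra_simps\<close>)
  then have "P f \<le> P (\<lambda>x. f x + g x) - P g"
    by (intro variation_least) (use f in \<open>auto simp: algebra_simps\<close>)
  then show "P f + P g \<le> P (\<lambda>x. f x + g x)" by simp
qed

end

text \<open>The total variations of the functionals \<open>n i\<close>, normalised to be \<open>1\<close> at the constant function \<open>1\<close>,
  are asymptotically invariant; a cluster point of them is an invariant mean.\<close>

lemma invariant_mean_of_asymptotically_invariant:
  fixes G :: "('g, 'b) monoid_scheme" and n :: "'i \<Rightarrow> ('g \<Rightarrow> real) \<Rightarrow> real"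
  assumes G: "group G" and F: "F \<noteq> bot"
    and n: "\<And>i. bounded_functional (carrier G) (n i)"
    and inv: "\<And>h. h \<in> carrier G \<Longrightarrow> \<exists>e. (e \<longlongrightarrow> 0) F \<and>
      (\<forall>i f c. bounded_by (carrier G) f c \<longrightarrow> \<bar>n i (\<lambda>x. f (h \<otimes>\<^bsub>G\<^esub> x)) - n i f\<bar> \<le> e i * c)"
    and one: "((\<lambda>i. n i (\<lambda>_. 1)) \<longlongrightarrow> 1) F"
  shows "\<exists>M. invariant_mean G M"
proof -
  interpret G: group G by (rule G)
  let ?X = "carrier G"
  \<comment> \<open>The bounded nonnegative functions form the cone on which the total variation is
    additive; the mean is constructed there first.\<close>
  define C where "C f c \<longleftrightarrow> (\<forall>x\<in>?X. 0 \<le> f x \<and> f x \<le> c) \<and> 0 \<le> c" for f :: "'g \<Rightarrow> real" and c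
  define P where "P i = total_variation ?X (n i)" for i
  note defs = C_def P_def
  have P1: "0 \<le> P i (\<lambda>_. 1)" "n i (\<lambda>_. 1) \<le> P i (\<lambda>_. 1)" for i
    unfolding P_def using bounded_functional.variation_nonneg[OF n, of "\<lambda>_. 1" 1]
      bounded_functional.variation_upper[OF n, of "\<lambda>_. 1" 1 "\<lambda>_. 1"] by auto
  have P0: "0 \<le> P i f" "P i f \<le> c * P i (\<lambda>_. 1)" if "C f c" for i f c
    using that bounded_functional.variation_nonneg[OF n, of f c] bounded_functional.variation_le[OF n, of f c]
    unfolding defs by auto
  have Padd: "P i (\<lambda>x. f x + g x) = P i f + P i g" if "C f c" "C g d" for i f g c d
    using that bounded_functional.variation_add[OF n, of f c g d] unfolding defs by auto
  have Pscale: "P i (\<lambda>x. r * f x) = r * P i f" if "C f c" "0 \<le> r" for i f c r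
    using that bounded_functional.variation_scale[OF n, of f c r] unfolding defs by auto
  \<comment> \<open>The modulus inherits approximate invariance: the test functions \<open>u\<close>
    are translated by \<open>h\<close> for one inequality and by its inverse for the other.\<close>
  have Pinv: "\<bar>P i (\<lambda>x. f (h \<otimes>\<^bsub>G\<^esub> x)) - P i f\<bar> \<le> e i * c"
    if f: "C f c" and h: "h \<in> ?X"
      and e: "\<And>i f c. bounded_by ?X f c \<Longrightarrow> \<bar>n i (\<lambda>x. f (h \<otimes>\<^bsub>G\<^esub> x)) - n i f\<bar> \<le> e i * c" for i f c h e
  proof -
    interpret n: bounded_functional ?X "n i" by (rule n)
    have bd: "bounded_by ?X u c" if "\<And>x. x \<in> ?X \<Longrightarrow> \<bar>u x\<bar> \<le> f x" for u
      using that f unfolding bounded_by_def C_def by (meson order_trans)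
    have "P i f \<le> P i (\<lambda>x. f (h \<otimes>\<^bsub>G\<^esub> x)) + e i * c"
      unfolding P_def
    proof (rule n.variation_least)
      fix u assume u: "\<And>x. x \<in> ?X \<Longrightarrow> \<bar>u x\<bar> \<le> f x"
      have "n i (\<lambda>x. u (h \<otimes>\<^bsub>G\<^esub> x)) \<le> total_variation ?X (n i) (\<lambda>x. f (h \<otimes>\<^bsub>G\<^esub> x))"
        by (rule n.variation_upper[of _ c]) (use f h u in \<open>auto simp: C_def\<close>)
      then show "n i u \<le> total_variation ?X (n i) (\<lambda>x. f (h \<otimes>\<^bsub>G\<^esub> x)) + e i * c"
        using e[OF bd[OF u], of i] by linarith
    qed (use f in \<open>auto simp: C_def\<close>)
    moreover have "P i (\<lambda>x. f (h \<otimes>\<^bsub>G\<^esub> x)) \<le> P i f + e i * c"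
      unfolding P_def
    proof (rule n.variation_least)
      fix u assume u: "\<And>x. x \<in> ?X \<Longrightarrow> \<bar>u x\<bar> \<le> f (h \<otimes>\<^bsub>G\<^esub> x)"
      let ?v = "\<lambda>x. u (inv\<^bsub>G\<^esub> h \<otimes>\<^bsub>G\<^esub> x)"
      have v: "\<bar>?v x\<bar> \<le> f x" if "x \<in> ?X" for x
        using u[of "inv\<^bsub>G\<^esub> h \<otimes>\<^bsub>G\<^esub> x"] that h by (simp flip: G.m_assoc)
      have "bounded_by ?X u c" using u f h unfolding bounded_by_def C_def by (meson G.m_closed order_trans)
      then have "n i u = n i (\<lambda>x. ?v (h \<otimes>\<^bsub>G\<^esub> x))"
        by (rule n.eq_on) (use h in \<open>simp flip: G.m_assoc\<close>)
      moreover have "n i ?v \<le> total_variation ?X (n i) f"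
        by (rule n.variation_upper[of _ c]) (use f v in \<open>auto simp: C_def\<close>)
      ultimately show "n i u \<le> total_variation ?X (n i) f + e i * c"
        using e[OF bd[OF v], of i] by linarith
    qed (use f h in \<open>auto simp: C_def\<close>)
    ultimately show ?thesis by linarith
  qed
  \<comment> \<open>The chosen bound \<open>c f\<close>, and the value \<open>0\<close> off the
    cone, confine each coordinate \<open>q i f\<close> to a fixed compact interval. Should the
    normaliser be \<open>0\<close>, the quotient is \<open>0\<close> and respects the bounds as
    well.\<close>
  define c where "c f = (SOME c. C f c)" for f
  define q where "q i f = (if \<exists>c. C f c then P i f / P i (\<lambda>_. 1) else 0)" for i f
  have qle: "0 \<le> q i f" "q i f \<le> c" if "C f c" for i f c
  proof -
    have q: "q i f = P i f / P i (\<lambda>_. 1)" using that by (auto simp: q_def)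
    show "0 \<le> q i f" unfolding q using P0[OF that] P1(1) by simp
    show "q i f \<le> c" unfolding q using P0[OF that, of i] P1(1)[of i] that
      by (cases "P i (\<lambda>_. 1) = 0") (auto simp: C_def divide_le_eq)
  qed
  have q_bound: "\<bar>q i f\<bar> \<le> (if \<exists>c. C f c then c f else 0)" for i f
  proof (cases "\<exists>c. C f c")
    case True
    then have "C f (c f)" unfolding c_def by (rule someI_ex)
    then show ?thesis using qle[of f "c f" i] True by simp
  qed (simp add: q_def)
  obtain H Q where H: "H \<le> F" "H \<noteq> bot" "\<And>f. ((\<lambda>i. q i f) \<longlongrightarrow> Q f) H"
    by (rule subnet_of_bounded_family[OF F, where q = q, OF q_bound]) blast
  have Qle: "0 \<le> Q f" "Q f \<le> c" if "C f c" for f c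
    by (rule tendsto_lowerbound[OF H(3) always_eventually H(2)], use qle[OF that] in simp,
        rule tendsto_upperbound[OF H(3) always_eventually H(2)], use qle[OF that] in simp)
  have Q_add: "Q (\<lambda>x. f x + g x) = Q f + Q g" if "C f c" "C g d" for f g c d
  proof -
    have "C (\<lambda>x. f x + g x) (c + d)" using that by (fastforce simp: C_def)
    then have "q i (\<lambda>x. f x + g x) = q i f + q i g" for i
      using that Padd[OF that] by (auto simp: q_def add_divide_distrib)
    then have "((\<lambda>i. q i (\<lambda>x. f x + g x)) \<longlongrightarrow> Q f + Q g) H"
      using tendsto_add[OF H(3)[of f] H(3)[of g]] by simp
    then show ?thesis by (rule tendsto_unique[OF H(2) H(3)])
  qed
  have Q_scale: "Q (\<lambda>x. r * f x) = r * Q f" if "C f c" "0 \<le> r" for f c r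
  proof -
    have "C (\<lambda>x. r * f x) (r * c)" using that by (auto simp: C_def mult_left_mono)
    then have "q i (\<lambda>x. r * f x) = r * q i f" for i
      using that Pscale[OF that] by (auto simp: q_def)
    then have "((\<lambda>i. q i (\<lambda>x. r * f x)) \<longlongrightarrow> r * Q f) H"
      using tendsto_mult_left[OF H(3)[of f]] by simp
    then show ?thesis by (rule tendsto_unique[OF H(2) H(3)])
  qed
  \<comment> \<open>The normalisers dominate \<open>n i\<close> at the constant \<open>1\<close>,
    which tends to \<open>1\<close>. They eventually exceed \<open>1/2\<close>, so dividing by them
    at most doubles the invariance error.\<close>
  have ev: "\<forall>\<^sub>F i in H. 1/2 < P i (\<lambda>_. 1)"
  proof -
    have "\<forall>\<^sub>F i in F. 1/2 < n i (\<lambda>_. 1)" using order_tendstoD(1)[OF one, of "1/2"] by simp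
    then have "\<forall>\<^sub>F i in F. 1/2 < P i (\<lambda>_. 1)" by (rule eventually_mono) (use P1(2) in \<open>meson less_le_trans\<close>)
    then show ?thesis using H(1) by (rule filter_leD[rotated])
  qed
  have Q_one: "Q (\<lambda>_. 1) = 1"
  proof (rule tendsto_unique[OF H(2) H(3)])
    have "C (\<lambda>_. 1) 1" by (simp add: C_def)
    with ev have "\<forall>\<^sub>F i in H. q i (\<lambda>_. 1) = 1" by (auto simp: q_def elim!: eventually_mono)
    then show "((\<lambda>i. q i (\<lambda>_. 1)) \<longlongrightarrow> 1) H" by (rule tendsto_eventually)
  qed
  have Q_inv: "Q (\<lambda>x. f (h \<otimes>\<^bsub>G\<^esub> x)) = Q f" if f: "C f c" and h: "h \<in> ?X" for f c h
  proof -
    obtain e where e: "(e \<longlongrightarrow> 0) F"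
      "\<And>i f c. bounded_by ?X f c \<Longrightarrow> \<bar>n i (\<lambda>x. f (h \<otimes>\<^bsub>G\<^esub> x)) - n i f\<bar> \<le> e i * c"
      using inv[OF h] by blast
    have C': "C (\<lambda>x. f (h \<otimes>\<^bsub>G\<^esub> x)) c" using f h by (auto simp: C_def)
    have e0: "0 \<le> e i" for i
      using order_trans[OF abs_ge_zero e(2)[of "\<lambda>_. 0" 1 i]] by (simp add: bounded_by_def)
    have "\<forall>\<^sub>F i in H. norm (q i (\<lambda>x. f (h \<otimes>\<^bsub>G\<^esub> x)) - q i f) \<le> e i * (2 * c)"
      using ev
    proof eventually_elim
      case (elim i)
      have "norm (q i (\<lambda>x. f (h \<otimes>\<^bsub>G\<^esub> x)) - q i f) = \<bar>P i (\<lambda>x. f (h \<otimes>\<^bsub>G\<^esub> x)) - P i f\<bar> / P i (\<lambda>_. 1)"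
        using f C' elim by (auto simp: q_def abs_divide simp flip: diff_divide_distrib)
      also have "\<dots> \<le> (e i * c) / P i (\<lambda>_. 1)"
        using Pinv[OF f h e(2)] elim by (intro divide_right_mono) auto
      also have "\<dots> \<le> (e i * c) / (1/2)"
        using elim f e0[of i] by (intro divide_left_mono) (auto simp: C_def)
      finally show ?case by simp
    qed
    moreover have "((\<lambda>i. e i * (2 * c)) \<longlongrightarrow> 0) H"
      using tendsto_mult_left_zero[OF tendsto_mono[OF H(1) e(1)]] by blast
    ultimately have "((\<lambda>i. q i (\<lambda>x. f (h \<otimes>\<^bsub>G\<^esub> x)) - q i f) \<longlongrightarrow> 0) H"
      by (rule Lim_null_comparison)
    moreover have "((\<lambda>i. q i (\<lambda>x. f (h \<otimes>\<^bsub>G\<^esub> x)) - q i f) \<longlongrightarrow> Q (\<lambda>x. f (h \<otimes>\<^bsub>G\<^esub> x)) - Q f) H"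
      by (intro tendsto_diff H(3))
    ultimately show ?thesis using tendsto_unique[OF H(2)] by fastforce
  qed
  \<comment> \<open>The mean is extended from the cone by splitting a function into its positive and
    negative parts.\<close>
  define p where "p f x = max 0 (f x)" for f :: "'g \<Rightarrow> real" and x
  define M where "M f = Q (p f) - Q (p (\<lambda>x. - f x))" for f
  have Cp: "\<exists>c. C (p f) c" "\<exists>c. C (p (\<lambda>x. - f x)) c" if "bounded (f ` ?X)" for f
  proof -
    obtain c where "bounded_by ?X f c" using \<open>bounded (f ` ?X)\<close> bounded_by_bounded by blast
    then have "C (p f) \<bar>c\<bar>" "C (p (\<lambda>x. - f x)) \<bar>c\<bar>" by (fastforce simp: C_def bounded_by_def p_def)+
    then show "\<exists>c. C (p f) c" "\<exists>c. C (p (\<lambda>x. - f x)) c" by blast+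
  qed
  have M_diff: "M (\<lambda>x. u x - v x) = Q u - Q v" if u: "C u c" and v: "C v d" for u v c d
  proof -
    let ?f = "\<lambda>x. u x - v x"
    have f: "C (p ?f) (c + d)" "C (p (\<lambda>x. - ?f x)) (c + d)"
      using u v by (fastforce simp: C_def p_def)+
    \<comment> \<open>Both arguments are the pointwise maximum of \<open>u\<close> and
      \<open>v\<close>. Hence the value of \<open>M\<close> is the same for every way of writing a
      function as a difference from the cone, which yields additivity and homogeneity below.\<close>
    have "Q (\<lambda>x. p ?f x + v x) = Q (\<lambda>x. p (\<lambda>x. - ?f x) x + u x)"
      by (rule arg_cong[where f = Q]) (auto simp: p_def max_def)
    then show ?thesis using Q_add[OF f(1) v] Q_add[OF f(2) u] by (simp add: M_def)
  qed
  have M_eq: "f = (\<lambda>x. p f x - p (\<lambda>x. - f x) x)" for f by (auto simp: p_def max_def)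
  show ?thesis
  proof (rule exI[of _ M], unfold invariant_mean_def Let_def mem_Collect_eq, intro conjI allI ballI impI)
    fix f g :: "'g \<Rightarrow> real" assume "f \<in> {f. bounded (f ` ?X)}" "g \<in> {f. bounded (f ` ?X)}"
    then obtain c c' d d' where f: "C (p f) c" "C (p (\<lambda>x. - f x)) c'" and g: "C (p g) d" "C (p (\<lambda>x. - g x)) d'"
      using Cp[of f] Cp[of g] by blast
    have "C (\<lambda>x. p f x + p g x) (c + d)" "C (\<lambda>x. p (\<lambda>x. - f x) x + p (\<lambda>x. - g x) x) (c' + d')"
      using f g by (fastforce simp: C_def)+
    from M_diff[OF this] have "M (\<lambda>x. p f x + p g x - (p (\<lambda>x. - f x) x + p (\<lambda>x. - g x) x)) = M f + M g"
      by (simp add: M_def Q_add[OF f(1) g(1)] Q_add[OF f(2) g(2)])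
    moreover have "(\<lambda>x. f x + g x) = (\<lambda>x. p f x + p g x - (p (\<lambda>x. - f x) x + p (\<lambda>x. - g x) x))"
      by (auto simp: p_def max_def)
    ultimately show "M (\<lambda>x. f x + g x) = M f + M g" by simp
  next
    fix f :: "'g \<Rightarrow> real" and r :: real assume "f \<in> {f. bounded (f ` ?X)}"
    then obtain c c' where f: "C (p f) c" "C (p (\<lambda>x. - f x)) c'" using Cp[of f] by blast
    have C': "C (\<lambda>x. \<bar>r\<bar> * p f x) (\<bar>r\<bar> * c)" "C (\<lambda>x. \<bar>r\<bar> * p (\<lambda>x. - f x) x) (\<bar>r\<bar> * c')"
      using f by (auto simp: C_def mult_left_mono)
    note s = Q_scale[OF f(1), of "\<bar>r\<bar>"] Q_scale[OF f(2), of "\<bar>r\<bar>"]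
    show "M (\<lambda>x. r * f x) = r * M f"
    proof (cases "r \<ge> 0")
      case True
      have "(\<lambda>x. r * f x) = (\<lambda>x. \<bar>r\<bar> * p f x - \<bar>r\<bar> * p (\<lambda>x. - f x) x)"
        using True by (auto simp: p_def max_def)
      then show ?thesis using M_diff[OF C'] s True by (simp add: M_def[of f] algebra_simps)
    next
      case False
      have "(\<lambda>x. r * f x) = (\<lambda>x. \<bar>r\<bar> * p (\<lambda>x. - f x) x - \<bar>r\<bar> * p f x)"
        using False by (auto simp: p_def max_def)
      then show ?thesis using M_diff[OF C'(2,1)] s False by (simp add: M_def[of f] algebra_simps)
    qed
  next
    fix f :: "'g \<Rightarrow> real" assume f: "f \<in> {f. bounded (f ` ?X)}" "\<forall>x\<in>?X. 0 \<le> f x"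
    obtain c where "C (p f) c" using Cp[of f] f by blast
    moreover have "C (p (\<lambda>x. - f x)) 0" using f(2) by (auto simp: C_def p_def)
    ultimately show "0 \<le> M f" using Qle[of "p f" c] Qle[of "p (\<lambda>x. - f x)" 0] by (simp add: M_def)
  next
    have "M (\<lambda>x. 1 - 0) = Q (\<lambda>_. 1) - Q (\<lambda>_. 0)" by (rule M_diff[of _ 1 _ 0]) (auto simp: C_def)
    moreover have "Q (\<lambda>_. 0) = 0" using Qle[of "\<lambda>_. 0" 0] by (simp add: C_def)
    ultimately show "M (\<lambda>_. 1) = 1" by (simp add: Q_one)
  next
    fix f :: "'g \<Rightarrow> real" and h assume "f \<in> {f. bounded (f ` ?X)}" and h: "h \<in> ?X"
    then obtain c c' where f: "C (p f) c" "C (p (\<lambda>x. - f x)) c'" using Cp[of f] by blast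
    show "M (\<lambda>x. f (h \<otimes>\<^bsub>G\<^esub> x)) = M f"
      using Q_inv[OF f(1) h] Q_inv[OF f(2) h] unfolding M_def p_def by simp
  qed
qed

section \<open>Necessity of the two conditions\<close>

lemma below_of_sandwich:
  fixes i u :: "'s::inverse_semigroup"
  assumes i: "i \<in> idempotents" and u: "i * u * i = i"
  shows "i \<in> below (u * star u)"
proof -
  \<comment> \<open>\<open>?w\<close> lies below \<open>u * star u\<close>, so it is enough that
    \<open>i = i * ?w\<close>; this comes from multiplying \<open>i * u * i\<close> by its own
    \<open>star\<close>.\<close>
  let ?w = "u * i * star u"
  have w: "?w \<in> idempotents" by (rule idempotents_conj[OF i])
  have "i = (i * u * i) * star (i * u * i)" using i u by (simp add: star_idempotent idempotentsD)
  also have "\<dots> = i * ?w * i" using i by (simp add: star_idempotent mult.assoc idempotentsD idempotent_absorb)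
  also have "\<dots> = i * ?w" using idempotents_commute[OF w i] idempotent_absorb[OF i] by (simp add: mult.assoc)
  finally have "i = i * ?w" .
  moreover have "?w * (u * star u) = ?w" by (simp add: mult.assoc)
  ultimately have "i * (u * star u) = i" by (metis mult.assoc)
  then show ?thesis using idempotents_below_iff[OF idempotents_star(1) i] by blast
qed

text \<open>If \<open>x x\<^sup>* = p\<close> and \<open>x\<^sup>* x = i\<close>, then the functional detecting \<open>i\<close> is the one detecting \<open>p\<close>
  conjugated by \<open>x\<close>, so a central \<open>z\<close> takes the same value on both.\<close>

lemma card_D_class_idempotents_le:
  fixes z :: "'s::inverse_semigroup ell1 cdual cdual" and p :: 's
  assumes fin: "\<And>t::'s. finite (below t)" and N: "\<And>t::'s. card (below t) \<le> N"
    and central: "\<And>a. bidual_lact (*) a z = bidual_ract (*) z a"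
    and near: "norm (bidual_ract (*) z (ell1_delta p) - bidual_embed (ell1_delta p)) \<le> 1/2"
    and p: "p \<in> idempotents"
    and I: "finite I" "I \<subseteq> D_idempotents p"
  shows "real (card I) \<le> 2 * (norm z * real N)"
proof -
  define c :: "'s \<Rightarrow> 's \<Rightarrow> complex" where "c i u = (if i * u * i = i then 1 else 0)" for i u
  define \<phi> where "\<phi> i = ell1_functional (c i)" for i
  have c1: "cmod (c i u) \<le> 1" for i u by (simp add: c_def)
  note \<phi> = ell1_functional[of "c i" 1 for i, OF c1, folded \<phi>_def]
  note act = bidual_lact_apply[OF bounded_clinear_mult(1)] bidual_ract_apply[OF bounded_clinear_mult(2)]
  \<comment> \<open>\<open>\<phi> p\<close> has the value \<open>1\<close> at the point mass of
    \<open>p\<close>, so a distance of at most \<open>1/2\<close> keeps the real part at least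
    \<open>1/2\<close>.\<close>
  have p1: "1/2 \<le> Re (dual_apply z (adjoint ((*) (ell1_delta p)) (\<phi> p)))"
  proof -
    have "norm (dual_apply (bidual_ract (*) z (ell1_delta p) - bidual_embed (ell1_delta p)) (\<phi> p)) \<le> 1/2 * 1"
      by (rule order_trans[OF norm_dual_apply_le], rule mult_mono[OF near \<phi>(2)]) simp_all
    moreover have "dual_apply (\<phi> p) (ell1_delta p) = 1" using p by (simp add: \<phi> c_def idempotentsD)
    ultimately have "norm (dual_apply z (adjoint ((*) (ell1_delta p)) (\<phi> p)) - 1) \<le> 1/2"
      by (simp add: central[symmetric] act)
    then show ?thesis using abs_Re_le_cmod[of "dual_apply z (adjoint ((*) (ell1_delta p)) (\<phi> p)) - 1"] by simp
  qed
  have eq: "dual_apply z (\<phi> i) = dual_apply z (adjoint ((*) (ell1_delta p)) (\<phi> p))" if i: "i \<in> I" for i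
  proof -
    obtain x where x: "x * star x = p" "star x * x = i" using I i by (auto simp: D_idempotents_def)
    have px: "p * x = x" "x * i = x" "star x * p = star x" "i * star x = star x"
      by (simp_all add: mult.assoc flip: x)
    have cc: "c p (x * u * star x) = c i u" for u
    proof -
      have "p * (x * u * star x) * p = p \<longleftrightarrow> i * u * i = i"
      proof
        assume *: "p * (x * u * star x) * p = p"
        have "i * u * i = star x * (p * (x * u * star x) * p) * x"
          using px by (simp add: mult.assoc flip: x)
        also have "\<dots> = i" using px x unfolding * by (simp add: mult.assoc)
        finally show "i * u * i = i" .
      next
        assume *: "i * u * i = i"
        have "p * (x * u * star x) * p = (p * x) * u * (star x * p)" by (simp only: mult.assoc)
        also have "\<dots> = (x * i) * u * (i * star x)" by (simp only: px)
        also have "\<dots> = x * (i * u * i) * star x" by (simp only: mult.assoc)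
        also have "\<dots> = p" using px x unfolding * by (simp add: mult.assoc)
        finally show "p * (x * u * star x) * p = p" .
      qed
      then show ?thesis by (simp add: c_def)
    qed
    let ?\<psi> = "adjoint ((*) (ell1_delta x)) (\<phi> p)"
    \<comment> \<open>\<open>\<phi> i\<close> evaluates \<open>\<phi> p\<close> after multiplying by
      the point masses at \<open>x\<close> on the left and \<open>star x\<close> on the right.
      Centrality of \<open>z\<close> lets the factor at \<open>star x\<close> act from the left
      instead, where \<open>x * star x = p\<close> merges the two.\<close>
    have "\<phi> i = adjoint (\<lambda>y. y * ell1_delta (star x)) ?\<psi>"
      by (rule ell1_cdual_eqI) (simp add: bounded_clinear_mult ell1_delta_mult \<phi> mult.assoc flip: cc)
    then have "dual_apply z (\<phi> i) = dual_apply (bidual_lact (*) (ell1_delta (star x)) z) ?\<psi>"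
      by (simp add: central act)
    also have "\<dots> = dual_apply z (adjoint ((*) (ell1_delta (star x))) ?\<psi>)" by (simp add: act)
    also have "adjoint ((*) (ell1_delta (star x))) ?\<psi> = adjoint ((*) (ell1_delta p)) (\<phi> p)"
      by (rule ell1_cdual_eqI) (simp add: bounded_clinear_mult ell1_delta_mult \<phi> mult.assoc flip: x)
    finally show ?thesis .
  qed
  have "real (card I) * (1/2) \<le> (\<Sum>i\<in>I. Re (dual_apply z (\<phi> i)))"
    using sum_bounded_below[of I "1/2" "\<lambda>i. Re (dual_apply z (\<phi> i))"] p1 eq by simp
  also have "\<dots> = Re (dual_apply z (sum \<phi> I))" by (simp add: dual_apply_linear)
  also have "\<dots> \<le> norm z * norm (sum \<phi> I)"
    by (rule order_trans[OF complex_Re_le_cmod norm_dual_apply_le])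
  \<comment> \<open>At the point mass of \<open>u\<close> the sum counts the \<open>i\<close> in
    \<open>I\<close> with \<open>i * u * i = i\<close>. All of these lie below
    \<open>u * star u\<close>, so there are at most \<open>N\<close>, however large \<open>I\<close>
    is.\<close>
  also have "norm (sum \<phi> I) \<le> real N"
  proof (rule norm_cdual_le, simp, rule ell1_bounded_clinear_norm_le[OF bounded_clinear_dual_apply])
    fix u
    have i: "i \<in> idempotents" if "i \<in> I" for i using I that D_idempotents_subset by blast
    have "{i \<in> I. i * u * i = i} \<subseteq> below (u * star u)" using below_of_sandwich i by blast
    then have le: "card {i \<in> I. i * u * i = i} \<le> N" using card_mono[OF fin] N order_trans by blast
    have "dual_apply (sum \<phi> I) (ell1_delta u) = (\<Sum>i\<in>I. c i u)" by (simp add: \<phi>)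
    also have "\<dots> = of_nat (card {i \<in> I. i * u * i = i})"
      using I(1) by (simp add: c_def sum.If_cases Int_def)
    finally show "norm (dual_apply (sum \<phi> I) (ell1_delta u)) \<le> real N" using le by simp
  qed
  finally show ?thesis by (simp add: mult_left_mono)
qed

lemma finite_D_class_idempotents:
  fixes p :: "'s::inverse_semigroup"
  assumes ulf: "uniformly_locally_finite (idempotents :: 's set) natural_le"
    and spa: "strong_pseudo_amenable TYPE('s ell1)"
    and p: "p \<in> idempotents"
  shows "finite (D_idempotents p)"
proof -
  obtain N where N: "\<forall>x\<in>(idempotents::'s set). finite {y \<in> idempotents. natural_le y x} \<and>
    card {y \<in> idempotents. natural_le y x} \<le> N" using ulf unfolding uniformly_locally_finite_def by blast
  obtain m :: "('s ell1, 's ell1) ptensor cdual cdual \<Rightarrow> ('s ell1, 's ell1) ptensor cdual cdual" and F where m: "strong_pseudo_net m F"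
    using spa unfolding strong_pseudo_amenable_def by blast
  let ?z = "\<lambda>i. adjoint (adjoint ptensor_prod) (m i)"
  have "((\<lambda>i. bidual_ract (*) (?z i) (ell1_delta p)) \<longlongrightarrow> bidual_embed (ell1_delta p)) F" and F: "F \<noteq> bot"
    using m unfolding strong_pseudo_net_def by auto
  then have "\<forall>\<^sub>F i in F. dist (bidual_ract (*) (?z i) (ell1_delta p)) (bidual_embed (ell1_delta p)) < 1/2"
    by (intro tendstoD) auto
  \<comment> \<open>One member of the net suffices: its norm bounds the cardinality of all finite
    subsets of the class at once.\<close>
  from eventually_happens'[OF F this]
  obtain i where i: "norm (bidual_ract (*) (?z i) (ell1_delta p) - bidual_embed (ell1_delta p)) \<le> 1/2"
    unfolding dist_norm using less_imp_le by blast
  have central: "bidual_lact (*) a (?z i) = bidual_ract (*) (?z i) a" for a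
    using m unfolding strong_pseudo_net_def by blast
  obtain b :: nat where b: "2 * (norm (?z i) * real N) < real b" using reals_Archimedean2 by blast
  show ?thesis
  proof (rule ccontr)
    assume "infinite (D_idempotents p)"
    from infinite_arbitrarily_large[OF this, of b]
    obtain I where I: "I \<subseteq> D_idempotents p" "finite I" "card I = b" by blast
    have "real (card I) \<le> 2 * (norm (?z i) * real N)"
      by (rule card_D_class_idempotents_le[OF below_finite_card[OF N] central i p I(2,1)])
    then show False using b I(3) by simp
  qed
qed

section \<open>Amenability of the maximal subgroups\<close>

text \<open>The set of pairs \<open>(s, t)\<close> dominating some \<open>(s', t')\<close> with \<open>s' t'\<close> in the maximal subgroup at \<open>p\<close>
  and \<open>s'\<^sup>* s' = t' t'\<^sup>*\<close>; necessarily \<open>s' = p s\<close> and \<open>t' = t p\<close>.\<close>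

definition composable_at :: "'s::inverse_semigroup \<Rightarrow> 's \<Rightarrow> 's \<Rightarrow> bool" where
  "composable_at p s t \<longleftrightarrow> p * (s * star s) = p \<and> star t * t * p = p \<and> star s * p * s = t * p * star t"

text \<open>The right-hand side says that \<open>p * (s * t)\<close> lies in the maximal subgroup at
  \<open>p\<close>. So composability depends on the product alone, which makes the form attached to
  the constant function \<open>1\<close> a pullback along the product map.\<close>

lemma composable_at_iff:
  fixes p s t :: "'s::inverse_semigroup"
  assumes p: "p \<in> idempotents"
  shows "composable_at p s t \<longleftrightarrow> p * (s * t) * star (s * t) = p \<and> star (s * t) * p * (s * t) = p"
proof
  assume "composable_at p s t"
  then have a: "p * (s * star s) = p" and b: "star t * t * p = p" and c: "star s * p * s = t * p * star t"
    by (auto simp: composable_at_def)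
  have "p * s = s * star s * p * s"
    using idempotents_commute[OF p idempotents_star(1)[of s]] by (metis a star_inverse(1) mult.assoc)
  then have ps: "p * s = s * (star s * p * s)" by (simp add: mult.assoc)
  have "p * s * (t * star t) = s * (t * p * star t * (t * star t))" by (metis ps c mult.assoc)
  also have "\<dots> = s * (t * p * star t)" by (simp add: mult.assoc)
  also have "\<dots> = p * s" using ps c by simp
  finally have "p * s * (t * star t) * star s = p" using a by (simp add: mult.assoc)
  then have 1: "p * (s * t) * star (s * t) = p" by (simp add: mult.assoc)
  have "star (s * t) * p * (s * t) = star t * (star s * p * s) * t" by (simp add: mult.assoc)
  also have "\<dots> = star t * (t * p * star t) * t" by (simp only: c)
  also have "\<dots> = star t * t * p * (star t * t)" by (simp add: mult.assoc)
  also have "\<dots> = p" using b idempotents_commute[OF p idempotents_star(2)[of t]] by simp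
  finally show "p * (s * t) * star (s * t) = p \<and> star (s * t) * p * (s * t) = p" using 1 by blast
next
  assume *: "p * (s * t) * star (s * t) = p \<and> star (s * t) * p * (s * t) = p"
  then have d: "p * s * (t * star t) * star s = p" and e: "star t * (star s * p * s) * t = p"
    by (simp_all add: mult.assoc)
  have "p * (s * star s) = p * s * (t * star t) * star s * (s * star s)" by (simp only: d)
  also have "\<dots> = p * s * (t * star t) * star s" by (simp add: mult.assoc)
  finally have a: "p * (s * star s) = p" by (simp only: d)
  have "star t * t * p = star t * t * (star t * (star s * p * s) * t)" by (simp only: e)
  also have "\<dots> = star t * (star s * p * s) * t" by (simp add: mult.assoc)
  finally have b: "star t * t * p = p" by (simp only: e)
  \<comment> \<open>Conjugating \<open>d\<close> by \<open>s\<close> shows that \<open>?w\<close>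
    lies below \<open>t * star t\<close>; inserting \<open>e\<close> for \<open>p\<close> then turns
    \<open>t * p * star t\<close> into \<open>?w\<close>.\<close>
  let ?w = "star s * p * s"
  have w: "?w \<in> idempotents" by (rule idempotents_conj[OF p])
  have tt: "t * star t * ?w = ?w * (t * star t)" by (rule idempotents_commute[OF idempotents_star(1) w])
  have "?w * (t * star t) = ?w * ?w * (t * star t)" using idempotentsD[OF w] by simp
  also have "\<dots> = ?w * (t * star t) * ?w" using tt by (simp only: mult.assoc)
  also have "\<dots> = star s * (p * s * (t * star t) * star s) * p * s" by (simp add: mult.assoc)
  also have "\<dots> = ?w" using p by (simp only: d) (simp add: mult.assoc idempotent_absorb)
  finally have wt: "?w * (t * star t) = ?w" .
  have "t * p * star t = t * (star t * ?w * t) * star t" by (simp only: e)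
  also have "\<dots> = t * star t * ?w * (t * star t)" by (simp only: mult.assoc)
  also have "\<dots> = ?w" using wt tt by simp
  finally show "composable_at p s t" using a b by (simp add: composable_at_def)
qed

lemma maximal_subgroup_carrierD:
  fixes h :: "'s::inverse_semigroup"
  assumes "h \<in> carrier (maximal_subgroup p)"
  shows "h * star h = p" "star h * h = p" "p * h = h" "h * p = h" "star h * p = star h" "p * star h = star h"
proof -
  show h: "h * star h = p" "star h * h = p" using assms by (auto simp: maximal_subgroup_def)
  show "p * h = h" "p * star h = star h" by (simp_all add: mult.assoc flip: h(1))
     (metis h star_simps(2) mult.assoc)
  show "h * p = h" "star h * p = star h" by (simp_all add: mult.assoc flip: h(2))
     (metis h star_simps(2))
qed

text \<open>These rules turn the left action of \<open>h\<close> on the tensor square into left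
  translation of the group coordinate, and make the right action trivial on the forms used
  below.\<close>

lemma composable_at_act:
  fixes p h s t :: "'s::inverse_semigroup"
  assumes p: "p \<in> idempotents" and h: "h \<in> carrier (maximal_subgroup p)"
  shows "composable_at p (h * s) t = composable_at p s t"
    "composable_at p s (t * h) = composable_at p s t"
    "star (h * s) * p * (h * s) = star s * p * s" "p * (h * s) = h * (p * s)"
proof -
  note H = maximal_subgroup_carrierD[OF h]
  have H': "star h * (h * x) = p * x" "h * (star h * x) = p * x" "p * (h * x) = h * x" "h * (p * x) = h * x"
    "star h * (p * x) = star h * x" "p * (star h * x) = star h * x" "p * (p * x) = p * x" for x
    using H idempotent_absorb[OF p] by (metis mult.assoc)+
  have pss: "p * (s * (star s * p)) = p * (s * star s)"
    using idempotents_commute[OF p idempotents_star(1)[of s]] idempotent_absorb[OF p] by (metis mult.assoc)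
  have ptt: "p * (star t * (t * p)) = star t * (t * p)"
    using idempotents_commute[OF p idempotents_star(2)[of t]] idempotentsD[OF p] by (metis mult.assoc)
  have 1: "h * (s * (star s * star h)) = p \<longleftrightarrow> p * (s * star s) = p"
  proof
    assume *: "h * (s * (star s * star h)) = p"
    have "p * (s * star s) = star h * (h * (s * (star s * star h))) * h" using pss by (simp add: mult.assoc H H')
    also have "\<dots> = p" by (simp only: *) (simp add: H)
    finally show "p * (s * star s) = p" .
  next
    assume *: "p * (s * star s) = p"
    have "h * (s * (star s * star h)) = h * (p * (s * star s)) * star h" by (simp add: mult.assoc H H')
    also have "\<dots> = p" by (simp only: *) (simp add: H)
    finally show "h * (s * (star s * star h)) = p" .
  qed
  have 2: "star h * (star t * (t * h)) = p \<longleftrightarrow> star t * (t * p) = p"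
  proof
    assume *: "star h * (star t * (t * h)) = p"
    have "star t * (t * p) = h * (star h * (star t * (t * h))) * star h" using ptt by (simp add: mult.assoc H H')
    also have "\<dots> = p" by (simp only: *) (simp add: H)
    finally show "star t * (t * p) = p" .
  next
    assume *: "star t * (t * p) = p"
    have "star h * (star t * (t * h)) = star h * (star t * (t * p)) * h" by (simp add: mult.assoc H H')
    also have "\<dots> = p" by (simp only: *) (simp add: H)
    finally show "star h * (star t * (t * h)) = p" .
  qed
  show "composable_at p (h * s) t = composable_at p s t"
    using 1 by (simp add: composable_at_def mult.assoc H H')
  show "composable_at p s (t * h) = composable_at p s t"
    using 2 by (simp add: composable_at_def mult.assoc H H')
  show "star (h * s) * p * (h * s) = star s * p * s" "p * (h * s) = h * (p * s)"
    by (simp_all add: mult.assoc H')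
qed


lemma amenable_maximal_subgroup:
  fixes p :: "'s::inverse_semigroup"
  assumes spa: "strong_pseudo_amenable TYPE('s ell1)" and p: "p \<in> idempotents"
  shows "amenable_group (maximal_subgroup p)"
proof -
  let ?G = "carrier (maximal_subgroup p)"
  obtain m :: "('s ell1, 's ell1) ptensor cdual cdual \<Rightarrow> ('s ell1, 's ell1) ptensor cdual cdual" and F
    where m: "strong_pseudo_net m F"
    using spa unfolding strong_pseudo_amenable_def by blast
  let ?z = "\<lambda>i. adjoint (adjoint ptensor_prod) (m i)"
  have F: "F \<noteq> bot"
    and comm: "((\<lambda>i. bidual_lact ptensor_lact a (m i) - bidual_ract ptensor_ract (m i) a) \<longlongrightarrow> 0) F"
    and central: "bidual_lact (*) a (?z i) = bidual_ract (*) (?z i) a"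
    and unit: "((\<lambda>i. bidual_ract (*) (?z i) a) \<longlongrightarrow> bidual_embed a) F" for a i
    using m unfolding strong_pseudo_net_def by blast+
  \<comment> \<open>Read \<open>x * star x\<close> as the range of an arrow \<open>x\<close> and
    \<open>star x * x\<close> as its source. \<open>x j\<close> runs from \<open>p\<close> to
    \<open>j\<close>; it closes \<open>p * s\<close>, whose source is \<open>star s * p * s\<close>,
    to a group element that does not involve \<open>t\<close>.\<close>
  define x where "x j = (SOME x::'s. x * star x = j \<and> star x * x = p)" for j
  define k :: "('s \<Rightarrow> real) \<Rightarrow> 's \<Rightarrow> 's \<Rightarrow> complex"
    where "k f s t = (if composable_at p s t then of_real (f (p * s * x (star s * p * s))) else 0)" for f s t
  have xG: "p * s * x (star s * p * s) \<in> ?G" if "composable_at p s t" for s t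
  proof -
    let ?j = "star s * p * s"
    have a: "p * (s * star s) = p" using that by (simp add: composable_at_def)
    have pss: "p * (s * (star s * p)) = p" by (metis a idempotentsD[OF p] mult.assoc)
    \<comment> \<open>The arrow \<open>star s * p\<close> has the required range and source, so the
      choice in \<open>x\<close> succeeds.\<close>
    have "star s * p * star (star s * p) = ?j" "star (star s * p) * (star s * p) = p"
      using p pss by (simp_all add: star_idempotent mult.assoc idempotent_absorb)
    then have "x ?j * star (x ?j) = ?j \<and> star (x ?j) * x ?j = p"
      unfolding x_def by (intro someI[of "\<lambda>x. x * star x = ?j \<and> star x * x = p" "star s * p"]) simp
    then have x: "x ?j * star (x ?j) = ?j" "star (x ?j) * x ?j = p" by blast+
    let ?g = "p * s * x ?j"
    have "?g * star ?g = p * s * (x ?j * star (x ?j)) * star s * p"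
      using p by (simp add: star_idempotent mult.assoc)
    also have "\<dots> = p * s * ?j * star s * p" by (simp only: x(1))
    also have "\<dots> = p * (s * star s) * (p * (s * star s)) * p" by (simp only: mult.assoc)
    also have "\<dots> = p" using p by (simp only: a idempotentsD)
    finally have 1: "?g * star ?g = p" .
    have "star ?g * ?g = star (x ?j) * (star s * p * s) * x ?j"
      using p by (simp add: star_idempotent mult.assoc idempotent_absorb)
    also have "\<dots> = star (x ?j) * (x ?j * star (x ?j)) * x ?j" by (simp only: x(1))
    also have "\<dots> = p" using x(2) by (simp add: mult.assoc)
    finally show ?thesis using 1 by (simp add: maximal_subgroup_def)
  qed
  have pG: "p \<in> ?G" using p by (simp add: maximal_subgroup_def star_idempotent idempotentsD)
  have kb: "cmod (k f s t) \<le> c" if "bounded_by ?G f c" for f c s t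
    using that xG[of s t] pG by (fastforce simp: k_def bounded_by_def)
  define \<Phi> where "\<Phi> f = ell1_tensor_functional (k f)" for f
  note \<Phi> = ell1_tensor_functional[of "k f" c for f c, OF kb, folded \<Phi>_def]
  define n where "n i f = Re (dual_apply (m i) (\<Phi> f))" for i f
  have functional: "bounded_functional ?G (n i)" for i
  proof
    show "\<exists>B. \<forall>f c. bounded_by ?G f c \<longrightarrow> \<bar>n i f\<bar> \<le> B * c"
    proof (intro exI[of _ "norm (m i)"] allI impI)
      fix f c assume f: "bounded_by ?G f c"
      have "\<bar>n i f\<bar> \<le> norm (m i) * norm (\<Phi> f)"
        unfolding n_def by (rule order_trans[OF abs_Re_le_cmod norm_dual_apply_le])
      then show "\<bar>n i f\<bar> \<le> norm (m i) * c"
        using mult_left_mono[OF \<Phi>(2)[OF f] norm_ge_zero[of "m i"]] by linarith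
    qed
    fix f c assume f: "bounded_by ?G f c"
    have rf: "bounded_by ?G (\<lambda>x. r * f x) (\<bar>r\<bar> * c)" for r
      using f by (auto simp: bounded_by_def abs_mult mult_left_mono)
    have "\<Phi> (\<lambda>x. r * f x) = of_real r *\<^sub>C \<Phi> f" for r
      by (rule ell1_ptensor_cdual_eqI) (simp add: \<Phi>(1)[OF rf] \<Phi>(1)[OF f], simp add: k_def)
    then show "n i (\<lambda>x. r * f x) = r * n i f" for r by (simp add: n_def dual_apply_linear)
    fix g d assume g: "bounded_by ?G g d"
    have fg: "bounded_by ?G (\<lambda>x. f x + g x) (c + d)"
      using f g by (fastforce simp: bounded_by_def)
    have "\<Phi> (\<lambda>x. f x + g x) = \<Phi> f + \<Phi> g"
      by (rule ell1_ptensor_cdual_eqI) (simp add: \<Phi>(1)[OF fg] \<Phi>(1)[OF f] \<Phi>(1)[OF g], simp add: k_def)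
    then show "n i (\<lambda>x. f x + g x) = n i f + n i g" by (simp add: n_def dual_apply_linear)
  qed
  have G: "group (maximal_subgroup p)" by (rule group_maximal_subgroup[OF p])
  have mult: "g \<otimes>\<^bsub>maximal_subgroup p\<^esub> h = g * h" for g h by (simp add: maximal_subgroup_def)
  have inv: "\<bar>n i (\<lambda>x. f (h * x)) - n i f\<bar> \<le>
      norm (bidual_lact ptensor_lact (ell1_delta h) (m i) - bidual_ract ptensor_ract (m i) (ell1_delta h)) * c"
    if h: "h \<in> ?G" and f: "bounded_by ?G f c" for h f c i
  proof -
    have hf: "bounded_by ?G (\<lambda>x. f (h * x)) c"
      using f h group.is_monoid[OF G, THEN monoid.m_closed, of h] by (simp add: bounded_by_def mult)
    have "k f (h * s) t = k (\<lambda>x. f (h * x)) s t" "k f s (t * h) = k f s t" for s t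
      using composable_at_act[OF p h] by (simp_all add: k_def mult.assoc)
    then have "adjoint (ptensor_lact (ell1_delta h)) (\<Phi> f) = \<Phi> (\<lambda>x. f (h * x))"
      "adjoint (\<lambda>u. ptensor_ract u (ell1_delta h)) (\<Phi> f) = \<Phi> f"
      by (intro ell1_ptensor_cdual_eqI;
          simp add: ptensor_lact ptensor_ract ell1_delta_mult \<Phi>(1)[OF f] \<Phi>(1)[OF hf])+
    then have "n i (\<lambda>x. f (h * x)) - n i f = Re (dual_apply
        (bidual_lact ptensor_lact (ell1_delta h) (m i) - bidual_ract ptensor_ract (m i) (ell1_delta h)) (\<Phi> f))"
      by (simp add: n_def bidual_lact_apply[OF ptensor_lact(1)] bidual_ract_apply[OF ptensor_ract(1)])
    also have "\<bar>\<dots>\<bar> \<le> norm (bidual_lact ptensor_lact (ell1_delta h) (m i) - bidual_ract ptensor_ract (m i) (ell1_delta h)) * norm (\<Phi> f)"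
      by (rule order_trans[OF abs_Re_le_cmod norm_dual_apply_le])
    finally show ?thesis using mult_left_mono[OF \<Phi>(2)[OF f] norm_ge_zero] order_trans by blast
  qed
  have "\<exists>M. invariant_mean (maximal_subgroup p) M"
  proof (rule invariant_mean_of_asymptotically_invariant[OF G F functional])
    fix h assume h: "h \<in> ?G"
    show "\<exists>e. (e \<longlongrightarrow> 0) F \<and> (\<forall>i f c. bounded_by ?G f c \<longrightarrow>
        \<bar>n i (\<lambda>x. f (h \<otimes>\<^bsub>maximal_subgroup p\<^esub> x)) - n i f\<bar> \<le> e i * c)"
      unfolding mult
      by (intro exI conjI allI impI, rule tendsto_norm_zero[OF comm[of "ell1_delta h"]], rule inv[OF h])
  next
    \<comment> \<open>\<open>c\<close> detects the \<open>u\<close> with \<open>p * u\<close> in the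
      subgroup. By \<open>composable_at_iff\<close> its pullback along the product map is the form
      of the constant function \<open>1\<close>.\<close>
    define c :: "'s \<Rightarrow> complex" where "c u = (if p * u * star u = p \<and> star u * p * u = p then 1 else 0)" for u
    define \<psi> where "\<psi> = ell1_functional c"
    have \<psi>: "dual_apply \<psi> (ell1_delta u) = c u" for u
      unfolding \<psi>_def by (rule ell1_functional[where C = 1]) (simp add: c_def)
    have one: "bounded_by ?G (\<lambda>_. 1) 1" by (simp add: bounded_by_def)
    have "\<Phi> (\<lambda>_. 1) = adjoint ptensor_prod \<psi>"
      by (rule ell1_ptensor_cdual_eqI)
         (simp add: \<Phi>(1)[OF one] ptensor_prod ell1_delta_mult \<psi>, simp only: k_def c_def composable_at_iff[OF p] of_real_1)
    \<comment> \<open>The condition \<open>unit\<close> controls only products with algebra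
      elements; that \<open>\<psi>\<close> absorbs the point mass at \<open>p\<close> supplies such
      a product.\<close>
    moreover have "adjoint ((*) (ell1_delta p)) \<psi> = \<psi>"
    proof (rule ell1_cdual_eqI)
      fix u
      have "p * (u * (star u * p)) = p * (u * star u)"
        using idempotents_commute[OF p idempotents_star(1)[of u]] idempotent_absorb[OF p] by (metis mult.assoc)
      then have "c (p * u) = c u"
        using p by (simp add: c_def mult.assoc star_idempotent idempotent_absorb)
      then show "dual_apply (adjoint ((*) (ell1_delta p)) \<psi>) (ell1_delta u) = dual_apply \<psi> (ell1_delta u)"
        by (simp add: bounded_clinear_mult ell1_delta_mult \<psi>)
    qed
    ultimately have "n i (\<lambda>_. 1) = Re (dual_apply (bidual_ract (*) (?z i) (ell1_delta p)) \<psi>)" for i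
      by (simp add: n_def bidual_lact_apply[OF bounded_clinear_mult(1)] bounded_clinear_adjoint ptensor_prod
          flip: central)
    moreover have "((\<lambda>i. Re (dual_apply (bidual_ract (*) (?z i) (ell1_delta p)) \<psi>)) \<longlongrightarrow>
        Re (dual_apply (bidual_embed (ell1_delta p)) \<psi>)) F"
      using bounded_linear.tendsto[OF bounded_clinearD(6)[OF bounded_clinear_dual_apply[of "bidual_embed \<psi>"]] unit[of "ell1_delta p"]]
      by (intro tendsto_Re) simp
    moreover have "c p = 1" using p by (simp add: c_def star_idempotent idempotentsD)
    ultimately show "((\<lambda>i. n i (\<lambda>_. 1)) \<longlongrightarrow> 1) F" by (simp add: \<psi>)
  qed
  then show ?thesis using G by (simp add: amenable_group_def)
qed

section \<open>The groupoid basis of \<open>\<ell>\<^sup>1(S)\<close>\<close>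

text \<open>Moebius inversion of \<open>\<delta>\<^sub>t = \<Sum>\<^bsub>u \<le> t\<^esub> \<epsilon>\<^sub>u\<close>; the recursion is well-founded only if all
  \<^term>\<open>below t\<close> are finite.\<close>

definition groupoid_basis :: "'s::inverse_semigroup \<Rightarrow> 's ell1" where
  "groupoid_basis = wfrec {(u, t). u \<in> below t - {t}} (\<lambda>e t. ell1_delta t - (\<Sum>u\<in>below t - {t}. e u))"

text \<open>For \<open>delta_mult_groupoid_basis\<close>: these \<open>u\<close> index the terms in
  the expansion of the point mass at \<open>t\<close> that survive multiplication by
  \<open>s\<close>, and the bijection makes the results add up to the point mass at
  \<open>s * t\<close>.\<close>

lemma bij_betw_below_mult_left:
  fixes s t :: "'s::inverse_semigroup"
  shows "bij_betw ((*) s) {u \<in> below t. star s * s * u = u} (below (s * t))"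
proof (rule bij_betwI[where g = "(*) (star s)"])
  show "(*) s \<in> {u \<in> below t. star s * s * u = u} \<rightarrow> below (s * t)"
    by (auto simp: below_def mult.assoc)
  show "(*) (star s) \<in> below (s * t) \<rightarrow> {u \<in> below t. star s * s * u = u}"
  proof
    fix v assume "v \<in> below (s * t)"
    then obtain e where e: "e \<in> idempotents" "v = s * t * e" by (auto simp: below_def)
    have "(star s * s) * (t * e) \<in> below (t * e)"
      using below_iff_left idempotents_star(2) by blast
    then have "star s * v \<in> below t"
      using below_trans[OF _ below_idempotents_le[OF e(1)]] e(2) by (simp add: mult.assoc)
    then show "star s * v \<in> {u \<in> below t. star s * s * u = u}" by (simp add: mult.assoc)
  qed
qed (auto simp: below_def mult.assoc)

lemma bij_betw_below_mult_right:
  fixes s t :: "'s::inverse_semigroup"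
  shows "bij_betw (\<lambda>u. u * s) {u \<in> below t. u * (s * star s) = u} (below (t * s))"
proof (rule bij_betwI[where g = "\<lambda>v. v * star s"])
  show "(\<lambda>u. u * s) \<in> {u \<in> below t. u * (s * star s) = u} \<rightarrow> below (t * s)"
    by (force simp: below_iff_left mult.assoc)
  show "(\<lambda>v. v * star s) \<in> below (t * s) \<rightarrow> {u \<in> below t. u * (s * star s) = u}"
  proof
    fix v assume "v \<in> below (t * s)"
    then obtain e where e: "e \<in> idempotents" "v = e * (t * s)" by (auto simp: below_iff_left)
    have "(e * t) * (s * star s) \<in> below (e * t)"
      by (rule below_idempotents_le[OF idempotents_star(1)])
    moreover have "e * t \<in> below t" using e(1) below_iff_left by blast
    ultimately have "v * star s \<in> below t"
      using below_trans e(2) by (metis mult.assoc)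
    then show "v * star s \<in> {u \<in> below t. u * (s * star s) = u}" by (simp add: mult.assoc)
  qed
qed (auto simp: below_iff_left mult.assoc)

context
  fixes N :: nat
  assumes fin: "\<And>t :: 's::inverse_semigroup. finite (below t)"
    and card: "\<And>t :: 's. card (below t) \<le> N"
begin

lemma card_below_less:
  fixes t u :: 's
  assumes "u \<in> below t - {t}"
  shows "card (below u) < card (below t)"
  using assms below_trans below_antisym below_refl
  by (intro psubset_card_mono[OF fin]) blast

lemma groupoid_basis_rec:
  fixes t :: 's
  shows "groupoid_basis t = ell1_delta t - (\<Sum>u\<in>below t - {t}. groupoid_basis u)"
proof -
  have "wf {(u, t :: 's). u \<in> below t - {t}}"
    by (rule wf_subset[OF wf_measure[of "\<lambda>t. card (below t)"]]) (use card_below_less in auto)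
  note rec = def_wfrec[OF groupoid_basis_def[THEN eq_reflection] this, of t]
  show ?thesis
    by (subst rec, rule arg_cong[where f = "(-) _"], rule sum.cong) (simp_all add: cut_apply)
qed

lemma delta_eq_sum_groupoid_basis:
  fixes t :: 's
  shows "ell1_delta t = (\<Sum>u\<in>below t. groupoid_basis u)"
  using sum.remove[OF fin below_refl, of groupoid_basis t] groupoid_basis_rec[of t] by simp

text \<open>Induction along the natural order: expand the product of the two point masses on both
  sides. The terms strictly below \<open>t\<close> cancel by induction, and the term of
  \<open>t\<close> remains.\<close>

lemma delta_mult_groupoid_basis:
  fixes s t :: 's
  shows "ell1_delta s * groupoid_basis t = (if star s * s * t = t then groupoid_basis (s * t) else 0)"
proof (induction "card (below t)" arbitrary: t rule: less_induct)
  case less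
  let ?B = "{u \<in> below t. star s * s * u = u}"
  have IH: "ell1_delta s * groupoid_basis u = (if star s * s * u = u then groupoid_basis (s * u) else 0)"
    if "u \<in> below t - {t}" for u using less[OF card_below_less[OF that]] .
  have "(\<Sum>u\<in>?B. groupoid_basis (s * u)) = ell1_delta s * ell1_delta t"
    by (simp only: sum.reindex_bij_betw[OF bij_betw_below_mult_left] ell1_delta_mult)
       (simp only: delta_eq_sum_groupoid_basis)
  also have "\<dots> = ell1_delta s * groupoid_basis t + (\<Sum>u\<in>below t - {t}. ell1_delta s * groupoid_basis u)"
    by (subst groupoid_basis_rec[of t]) (simp add: algebra_simps sum_distrib_left)
  also have "(\<Sum>u\<in>below t - {t}. ell1_delta s * groupoid_basis u) = (\<Sum>u\<in>?B - {t}. groupoid_basis (s * u))"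
    using IH fin by (intro sum.mono_neutral_cong_right) auto
  finally have "ell1_delta s * groupoid_basis t = (\<Sum>u\<in>?B. groupoid_basis (s * u)) - (\<Sum>u\<in>?B - {t}. groupoid_basis (s * u))"
    by simp
  also have "\<dots> = (if t \<in> ?B then groupoid_basis (s * t) else 0)"
    using fin by (simp add: sum_diff1)
  finally show ?case by (simp add: below_refl)
qed

lemma groupoid_basis_mult_delta:
  fixes s t :: 's
  shows "groupoid_basis t * ell1_delta s = (if t * (s * star s) = t then groupoid_basis (t * s) else 0)"
proof (induction "card (below t)" arbitrary: t rule: less_induct)
  case less
  let ?B = "{u \<in> below t. u * (s * star s) = u}"
  have IH: "groupoid_basis u * ell1_delta s = (if u * (s * star s) = u then groupoid_basis (u * s) else 0)"
    if "u \<in> below t - {t}" for u using less[OF card_below_less[OF that]] .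
  have "(\<Sum>u\<in>?B. groupoid_basis (u * s)) = ell1_delta t * ell1_delta s"
    by (simp only: sum.reindex_bij_betw[OF bij_betw_below_mult_right] ell1_delta_mult)
       (simp only: delta_eq_sum_groupoid_basis)
  also have "\<dots> = groupoid_basis t * ell1_delta s + (\<Sum>u\<in>below t - {t}. groupoid_basis u * ell1_delta s)"
    by (subst groupoid_basis_rec[of t]) (simp add: algebra_simps sum_distrib_right)
  also have "(\<Sum>u\<in>below t - {t}. groupoid_basis u * ell1_delta s) = (\<Sum>u\<in>?B - {t}. groupoid_basis (u * s))"
    using IH fin by (intro sum.mono_neutral_cong_right) auto
  finally have "groupoid_basis t * ell1_delta s = (\<Sum>u\<in>?B. groupoid_basis (u * s)) - (\<Sum>u\<in>?B - {t}. groupoid_basis (u * s))"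
    by simp
  also have "\<dots> = (if t \<in> ?B then groupoid_basis (t * s) else 0)"
    using fin by (simp add: sum_diff1)
  finally show ?case by (simp add: below_refl)
qed

text \<open>A basis element absorbs the point masses of its own range and source. A nonzero product
  therefore forces the source of the left factor and the range of the right one to lie below each
  other. If they are equal, expand the point mass at \<open>s\<close>: elements strictly below
  \<open>s\<close> have another source, so only the term of \<open>s\<close> survives.\<close>

lemma groupoid_basis_mult:
  fixes s t :: 's
  shows "groupoid_basis s * groupoid_basis t =
    (if star s * s = t * star t then groupoid_basis (s * t) else 0)"
proof -
  have zero: "groupoid_basis u * groupoid_basis t = 0" if ne: "star u * u \<noteq> t * star t" for u
  proof (rule ccontr)
    assume *: "groupoid_basis u * groupoid_basis t \<noteq> 0"
    have "groupoid_basis t = ell1_delta (t * star t) * groupoid_basis t"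
      by (simp add: delta_mult_groupoid_basis mult.assoc)
    then have "groupoid_basis u * groupoid_basis t = (groupoid_basis u * ell1_delta (t * star t)) * groupoid_basis t"
      by (simp add: mult.assoc)
    with * have 1: "u * (t * star t) = u"
      by (auto simp: groupoid_basis_mult_delta mult.assoc split: if_splits)
    have "groupoid_basis u = groupoid_basis u * ell1_delta (star u * u)"
      by (simp add: groupoid_basis_mult_delta mult.assoc)
    then have "groupoid_basis u * groupoid_basis t = groupoid_basis u * (ell1_delta (star u * u) * groupoid_basis t)"
      by (simp flip: mult.assoc)
    with * have 2: "star u * u * t = t"
      by (auto simp: delta_mult_groupoid_basis mult.assoc split: if_splits)
    show False using 1 2 ne by (metis mult.assoc)
  qed
  show ?thesis
  proof (cases "star s * s = t * star t")
    case True
    have "star s * s * t = t" by (simp add: True mult.assoc)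
    then have "groupoid_basis (s * t) = ell1_delta s * groupoid_basis t" by (simp add: delta_mult_groupoid_basis)
    also have "\<dots> = (\<Sum>u\<in>below s. groupoid_basis u * groupoid_basis t)"
      by (simp add: delta_eq_sum_groupoid_basis sum_distrib_right)
    also have "\<dots> = (\<Sum>u\<in>{s}. groupoid_basis u * groupoid_basis t)"
    proof (rule sum.mono_neutral_right[OF fin])
      show "\<forall>u\<in>below s - {s}. groupoid_basis u * groupoid_basis t = 0"
        using zero below_eqI True by (metis DiffE singletonI)
    qed (simp add: below_refl)
    finally show ?thesis using True by simp
  qed (simp add: zero)
qed

text \<open>The recursion descends through smaller and smaller order ideals, so it has depth at most
  \<open>N\<close>; each level subtracts at most \<open>N\<close> terms and costs a factor of at
  most \<open>N + 1\<close>.\<close>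

lemma norm_groupoid_basis_le:
  fixes t :: 's
  shows "norm (groupoid_basis t) \<le> (real N + 1) ^ N"
proof -
  have "norm (groupoid_basis t) \<le> (real N + 1) ^ card (below t)"
  proof (induction "card (below t)" arbitrary: t rule: less_induct)
    case less
    have pos: "card (below t) > 0" using fin below_refl card_gt_0_iff by blast
    have "norm (groupoid_basis t) \<le> 1 + norm (\<Sum>u\<in>below t - {t}. groupoid_basis u)"
      by (subst groupoid_basis_rec) (rule order_trans[OF norm_triangle_ineq4], simp)
    also have "norm (\<Sum>u\<in>below t - {t}. groupoid_basis u) \<le> (\<Sum>u\<in>below t - {t}. (real N + 1) ^ (card (below t) - 1))"
    proof (rule sum_norm_le)
      fix u assume u: "u \<in> below t - {t}"
      have "norm (groupoid_basis u) \<le> (real N + 1) ^ card (below u)" by (rule less[OF card_below_less[OF u]])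
      also have "\<dots> \<le> (real N + 1) ^ (card (below t) - 1)"
        using card_below_less[OF u] by (intro power_increasing) auto
      finally show "norm (groupoid_basis u) \<le> (real N + 1) ^ (card (below t) - 1)" .
    qed
    also have "\<dots> \<le> real N * (real N + 1) ^ (card (below t) - 1)"
    proof -
      have "card (below t - {t}) \<le> N" using card[of t] by (simp add: card_Diff_subset_Int)
      then show ?thesis by (simp add: mult_right_mono)
    qed
    also have "1 + real N * (real N + 1) ^ (card (below t) - 1) \<le> (real N + 1) * (real N + 1) ^ (card (below t) - 1)"
      by (simp add: algebra_simps)
    also have "\<dots> = (real N + 1) ^ card (below t)" using pos by (simp flip: power_Suc)
    finally show ?case by simp
  qed
  also have "\<dots> \<le> (real N + 1) ^ N" using card by (intro power_increasing) auto
  finally show ?thesis .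
qed

lemma groupoid_basis_eqI:
  fixes T U :: "'s ell1 \<Rightarrow> 'b::complex_normed_vector"
  assumes T: "bounded_clinear T" and U: "bounded_clinear U"
    and eq: "\<And>s. T (groupoid_basis s) = U (groupoid_basis s)"
  shows "T a = U a"
  by (rule ell1_bounded_clinear_eqI[OF T U])
     (simp add: delta_eq_sum_groupoid_basis bounded_clinearD(5)[OF T] bounded_clinearD(5)[OF U] eq)

end

text \<open>Finite combinations of point masses are dense and are eventually fixed; the uniform
  bound \<open>K\<close> controls what is left over.\<close>

lemma ell1_bounded_net_tendsto:
  fixes T :: "'i \<Rightarrow> 's ell1 \<Rightarrow> 's ell1"
  assumes T: "\<And>i. bounded_clinear (T i)" and K: "\<And>i s. norm (T i (ell1_delta s)) \<le> K"
    and ev: "\<And>s. \<forall>\<^sub>F i in F. T i (ell1_delta s) = ell1_delta s"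
  shows "((\<lambda>i. T i a) \<longlongrightarrow> a) F"
proof (cases "F = bot")
  case False
  then obtain i :: 'i where True by simp
  have K0: "K \<ge> 0" using K[of i undefined] norm_ge_zero order_trans by blast
  show ?thesis
  proof (rule tendstoI)
    fix e :: real assume e: "e > 0"
    have "((\<lambda>F. \<Sum>s\<in>F. ell1_apply a s *\<^sub>C ell1_delta s) \<longlongrightarrow> a) (finite_subsets_at_top UNIV)"
      using ell1_has_sum_delta[of a] by (simp add: has_sum_def)
    \<comment> \<open>The tolerance is divided by \<open>K + 1\<close> because the remainder enters
      once through \<open>T i\<close> and once directly.\<close>
    then have "\<forall>\<^sub>F X in finite_subsets_at_top UNIV. dist (\<Sum>s\<in>X. ell1_apply a s *\<^sub>C ell1_delta s) a < e / (K + 1)"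
      using e K0 by (intro tendstoD) auto
    then obtain X where X: "finite X" "dist (\<Sum>s\<in>X. ell1_apply a s *\<^sub>C ell1_delta s) a < e / (K + 1)"
      unfolding eventually_finite_subsets_at_top by blast
    let ?a = "\<Sum>s\<in>X. ell1_apply a s *\<^sub>C ell1_delta s"
    have d: "norm (a - ?a) < e / (K + 1)" using X(2) by (simp add: dist_norm norm_minus_commute)
    have "\<forall>\<^sub>F i in F. \<forall>s\<in>X. T i (ell1_delta s) = ell1_delta s"
      using X(1) ev by (simp add: eventually_ball_finite)
    then show "\<forall>\<^sub>F i in F. dist (T i a) a < e"
    proof (rule eventually_mono)
      fix i assume "\<forall>s\<in>X. T i (ell1_delta s) = ell1_delta s"
      then have Ta: "T i ?a = ?a" by (simp add: bounded_clinearD[OF T])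
      have "T i a - a = T i (a - ?a) - (a - ?a)" by (simp add: bounded_clinearD(4)[OF T] Ta)
      then have "norm (T i a - a) \<le> norm (T i (a - ?a)) + norm (a - ?a)" by (metis norm_triangle_ineq4)
      also have "\<dots> \<le> K * norm (a - ?a) + norm (a - ?a)"
        using ell1_bounded_clinear_norm_le[OF T K] by simp
      also have "\<dots> = (K + 1) * norm (a - ?a)" by (simp add: algebra_simps)
      also have "\<dots> < e" using d K0 by (simp add: field_simps)
      finally show "dist (T i a) a < e" by (simp add: dist_norm)
    qed
  qed
qed simp

section \<open>Complex-valued means\<close>

definition complex_mean :: "(('g \<Rightarrow> real) \<Rightarrow> real) \<Rightarrow> ('g \<Rightarrow> complex) \<Rightarrow> complex" where
  "complex_mean M f = Complex (M (\<lambda>x. Re (f x))) (M (\<lambda>x. Im (f x)))"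

context
  fixes G :: "('g, 'b) monoid_scheme" and M
  assumes M: "invariant_mean G M"
begin

lemma mean_props:
  assumes "bounded_by (carrier G) f c"
  shows "bounded_by (carrier G) g d \<Longrightarrow> M (\<lambda>x. f x + g x) = M f + M g"
    "M (\<lambda>x. r * f x) = r * M f"
    "(\<And>x. x \<in> carrier G \<Longrightarrow> 0 \<le> f x) \<Longrightarrow> 0 \<le> M f"
    "h \<in> carrier G \<Longrightarrow> M (\<lambda>x. f (h \<otimes>\<^bsub>G\<^esub> x)) = M f"
  using M assms bounded_by_bounded[of f "carrier G"] bounded_by_bounded[of g "carrier G"]
  unfolding invariant_mean_def Let_def by blast+

lemma mean_one: "M (\<lambda>_. 1) = 1"
  using M by (simp add: invariant_mean_def Let_def)

lemma mean_const: "M (\<lambda>_. r) = r"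
  using mean_props(2)[of "\<lambda>_. 1" 1 r] mean_one by (simp add: bounded_by_def)

text \<open>Positivity applied to \<open>c + f\<close> and \<open>c - f\<close>.\<close>

lemma mean_bound:
  assumes f: "bounded_by (carrier G) f c"
  shows "\<bar>M f\<bar> \<le> c"
proof -
  have b: "bounded_by (carrier G) (\<lambda>x. (- 1) * f x) c" "bounded_by (carrier G) (\<lambda>_. c) \<bar>c\<bar>"
    "bounded_by (carrier G) (\<lambda>x. c + f x) (\<bar>c\<bar> + c)" "bounded_by (carrier G) (\<lambda>x. c + (- 1) * f x) (\<bar>c\<bar> + c)"
    using f by (fastforce simp: bounded_by_def)+
  have "0 \<le> M (\<lambda>x. c + f x)" "0 \<le> M (\<lambda>x. c + (- 1) * f x)"
    by (rule mean_props(3)[OF b(3)] mean_props(3)[OF b(4)]; use f in \<open>force simp: bounded_by_def\<close>)+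
  then have "0 \<le> c + M f" "0 \<le> c + (- 1) * M f"
    by (simp_all only: mean_props(1)[OF b(2) f] mean_props(1)[OF b(2) b(1)] mean_props(2)[OF f] mean_const)
  then show ?thesis by linarith
qed

lemma mean_cong:
  assumes f: "bounded_by (carrier G) f c" and eq: "\<And>x. x \<in> carrier G \<Longrightarrow> f x = g x"
  shows "M f = M g"
proof -
  have g: "bounded_by (carrier G) g c" "bounded_by (carrier G) (\<lambda>x. (- 1) * g x) c"
    "bounded_by (carrier G) (\<lambda>x. f x + (- 1) * g x) 0"
    using f eq by (auto simp: bounded_by_def)
  have "M (\<lambda>x. f x + (- 1) * g x) = M f + (- 1) * M g"
    by (simp only: mean_props(1)[OF f g(2)] mean_props(2)[OF g(1)])
  then show ?thesis using mean_bound[OF g(3)] by simp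
qed

lemma complex_mean:
  assumes f: "\<And>x. x \<in> carrier G \<Longrightarrow> cmod (f x) \<le> c"
  shows "(\<And>x. x \<in> carrier G \<Longrightarrow> cmod (g x) \<le> d) \<Longrightarrow> complex_mean M (\<lambda>x. f x + g x) = complex_mean M f + complex_mean M g"
    and "complex_mean M (\<lambda>x. z * f x) = z * complex_mean M f"
    and "cmod (complex_mean M f) \<le> 2 * c"
    and "h \<in> carrier G \<Longrightarrow> complex_mean M (\<lambda>x. f (h \<otimes>\<^bsub>G\<^esub> x)) = complex_mean M f"
    and "(\<And>x. x \<in> carrier G \<Longrightarrow> f x = f' x) \<Longrightarrow> complex_mean M f = complex_mean M f'"
proof -
  have R: "bounded_by (carrier G) (\<lambda>x. Re (f x)) c" "bounded_by (carrier G) (\<lambda>x. Im (f x)) c"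
    if "\<And>x. x \<in> carrier G \<Longrightarrow> cmod (f x) \<le> c" for f c
    using that abs_Re_le_cmod abs_Im_le_cmod order_trans unfolding bounded_by_def by blast+
  note Rf = R[of f c, OF f]
  show "complex_mean M (\<lambda>x. f x + g x) = complex_mean M f + complex_mean M g"
    if "\<And>x. x \<in> carrier G \<Longrightarrow> cmod (g x) \<le> d"
    using mean_props(1)[OF Rf(1) R(1)[of g d, OF that]] mean_props(1)[OF Rf(2) R(2)[of g d, OF that]]
    by (simp add: complex_mean_def complex_eq_iff)
  show "complex_mean M (\<lambda>x. z * f x) = z * complex_mean M f"
  proof -
    have s: "bounded_by (carrier G) (\<lambda>x. r * u x) (\<bar>r\<bar> * c)" if "bounded_by (carrier G) u c" for r u
      using that by (auto simp: bounded_by_def abs_mult mult_left_mono)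
    have "M (\<lambda>x. Re z * Re (f x) + (- Im z) * Im (f x)) = Re z * M (\<lambda>x. Re (f x)) + (- Im z) * M (\<lambda>x. Im (f x))"
      by (simp only: mean_props(1)[OF s[OF Rf(1)] s[OF Rf(2)]] mean_props(2)[OF Rf(1)] mean_props(2)[OF Rf(2)])
    moreover have "M (\<lambda>x. Re z * Im (f x) + Im z * Re (f x)) = Re z * M (\<lambda>x. Im (f x)) + Im z * M (\<lambda>x. Re (f x))"
      by (simp only: mean_props(1)[OF s[OF Rf(2)] s[OF Rf(1)]] mean_props(2)[OF Rf(1)] mean_props(2)[OF Rf(2)])
    ultimately show ?thesis by (simp add: complex_mean_def complex_eq_iff)
  qed
  \<comment> \<open>Real and imaginary parts are estimated separately, whence the factor
    \<open>2\<close>.\<close>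
  show "cmod (complex_mean M f) \<le> 2 * c"
    using cmod_le[of "complex_mean M f"] mean_bound[OF Rf(1)] mean_bound[OF Rf(2)]
    by (simp add: complex_mean_def)
  show "complex_mean M (\<lambda>x. f (h \<otimes>\<^bsub>G\<^esub> x)) = complex_mean M f" if "h \<in> carrier G"
    using mean_props(4)[OF Rf(1) that] mean_props(4)[OF Rf(2) that] by (simp add: complex_mean_def)
  show "complex_mean M f = complex_mean M f'" if "\<And>x. x \<in> carrier G \<Longrightarrow> f x = f' x"
    using mean_cong[OF Rf(1), of "\<lambda>x. Re (f' x)"] mean_cong[OF Rf(2), of "\<lambda>x. Im (f' x)"] that
    by (simp add: complex_mean_def)
qed

lemma complex_mean_const: "complex_mean M (\<lambda>_. z) = z"
  by (simp add: complex_mean_def mean_const)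

end

section \<open>Sufficiency of the two conditions\<close>

text \<open>In the matrix picture of a \<open>\<D>\<close>-class, the virtual diagonal is the mean over \<open>g\<close> of
  \<open>\<Sum>\<^sub>i E\<^bsub>ip\<^esub> g \<otimes> g\<^sup>-\<^sup>1 E\<^bsub>pi\<^esub>\<close>, for one fixed idempotent \<open>p\<close> of the class; \<open>diagonal i\<close> is its \<open>i\<close>-th summand.\<close>

locale amenable_ulf =
  fixes N :: nat and M :: "'s::inverse_semigroup \<Rightarrow> ('s \<Rightarrow> real) \<Rightarrow> real"
  assumes fin: "\<And>t :: 's. finite (below t)"
    and card: "\<And>t :: 's. card (below t) \<le> N"
    and M: "\<And>p :: 's. p \<in> idempotents \<Longrightarrow> invariant_mean (maximal_subgroup p) (M p)"
begin

section \<open>The virtual diagonal of one D-class\<close>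

abbreviation "\<epsilon> \<equiv> groupoid_basis :: 's \<Rightarrow> 's ell1"
abbreviation "C \<equiv> (real N + 1) ^ N"

text \<open>The choice is made from the set \<open>D_idempotents i\<close>, which is the same for
  all idempotents of a D-class; so they all receive the same representative.\<close>

definition rep :: "'s \<Rightarrow> 's" where
  "rep i = (SOME j. j \<in> D_idempotents i)"

text \<open>An arrow from \<open>rep i\<close> to \<open>i\<close>; its basis element plays the part
  of the matrix unit \<open>E_ip\<close>.\<close>

definition conn :: "'s \<Rightarrow> 's" where
  "conn i = (SOME x. x * star x = i \<and> star x * x = rep i)"

lemma rep_eq: "j \<in> D_idempotents i \<Longrightarrow> rep j = rep i"
  by (simp add: rep_def D_idempotents_eq)

lemma conn:
  assumes "i \<in> idempotents"
  shows "conn i * star (conn i) = i" "star (conn i) * conn i = rep i"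
proof -
  have "rep i \<in> D_idempotents i"
    unfolding rep_def using D_idempotents_refl[OF assms] by (rule someI)
  then have "\<exists>x. x * star x = i \<and> star x * x = rep i" by (simp add: D_idempotents_def)
  then have "conn i * star (conn i) = i \<and> star (conn i) * conn i = rep i"
    unfolding conn_def by (rule someI_ex)
  then show "conn i * star (conn i) = i" "star (conn i) * conn i = rep i" by blast+
qed

lemma rep_idempotent: "i \<in> idempotents \<Longrightarrow> rep i \<in> idempotents"
  using conn(2) idempotents_star(2) by metis

lemma conn_mult_star:
  assumes i: "i \<in> idempotents" and g: "g \<in> carrier (maximal_subgroup (rep i))"
  shows "(conn i * g) * star (conn i * g) = i"
proof -
  have "(conn i * g) * star (conn i * g) = conn i * (g * star g) * star (conn i)" by (simp add: mult.assoc)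
  also have "\<dots> = conn i * (star (conn i) * conn i) * star (conn i)"
    by (simp only: maximal_subgroup_carrierD(1)[OF g] conn(2)[OF i])
  also have "\<dots> = i" using conn(1)[OF i] by (simp add: mult.assoc)
  finally show ?thesis .
qed

definition diagonal :: "'s \<Rightarrow> ('s ell1, 's ell1) ptensor cdual cdual" where
  "diagonal i = Abs_cdual (\<lambda>F. complex_mean (M (rep i))
     (\<lambda>g. dual_apply F (tensor (\<epsilon> (conn i * g)) (\<epsilon> (star (conn i * g))))))"

lemma norm_tensor_basis:
  fixes F :: "('s ell1, 's ell1) ptensor cdual"
  shows "cmod (dual_apply F (tensor (\<epsilon> s) (\<epsilon> t))) \<le> C * C * norm F"
proof -
  have n: "norm (tensor (\<epsilon> s) (\<epsilon> t)) \<le> C * C"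
    by (rule order_trans[OF norm_tensor_le]) (intro mult_mono norm_groupoid_basis_le fin card; simp)
  show ?thesis
    using order_trans[OF norm_dual_apply_le mult_left_mono[OF n norm_ge_zero[of F]]] by (simp add: mult.commute)
qed

lemma diagonal_apply:
  assumes i: "i \<in> idempotents"
  shows "dual_apply (diagonal i) F = complex_mean (M (rep i))
     (\<lambda>g. dual_apply F (tensor (\<epsilon> (conn i * g)) (\<epsilon> (star (conn i * g)))))"
  unfolding diagonal_def
proof (rule dual_apply_Abs_cdual, rule bounded_clinearI[where K = "2 * (C * C)"])
  note cm = complex_mean[OF M[OF rep_idempotent[OF i]] norm_tensor_basis]
  fix F F' :: "('s ell1, 's ell1) ptensor cdual" and c
  show "complex_mean (M (rep i)) (\<lambda>g. dual_apply (F + F') (tensor (\<epsilon> (conn i * g)) (\<epsilon> (star (conn i * g))))) =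
    complex_mean (M (rep i)) (\<lambda>g. dual_apply F (tensor (\<epsilon> (conn i * g)) (\<epsilon> (star (conn i * g))))) +
    complex_mean (M (rep i)) (\<lambda>g. dual_apply F' (tensor (\<epsilon> (conn i * g)) (\<epsilon> (star (conn i * g)))))"
    unfolding dual_apply_simps by (rule cm(1)) (rule norm_tensor_basis)
  show "complex_mean (M (rep i)) (\<lambda>g. dual_apply (c *\<^sub>C F) (tensor (\<epsilon> (conn i * g)) (\<epsilon> (star (conn i * g))))) =
    c *\<^sub>C complex_mean (M (rep i)) (\<lambda>g. dual_apply F (tensor (\<epsilon> (conn i * g)) (\<epsilon> (star (conn i * g)))))"
    unfolding dual_apply_simps scaleC_complex_def by (rule cm(2))
  show "norm (complex_mean (M (rep i)) (\<lambda>g. dual_apply F (tensor (\<epsilon> (conn i * g)) (\<epsilon> (star (conn i * g))))))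
    \<le> 2 * (C * C) * norm F"
    using cm(3)[of F] by (simp add: mult.assoc)
qed

text \<open>All first tensor factors have range \<open>i\<close>, so by
  \<open>groupoid_basis_mult\<close> the integrand vanishes unless \<open>s\<close> has source
  \<open>i\<close>.\<close>

lemma diagonal_lact:
  assumes i: "i \<in> idempotents"
  shows "dual_apply (bidual_lact ptensor_lact (\<epsilon> s) (diagonal i)) F = (if star s * s = i
    then complex_mean (M (rep i)) (\<lambda>g. dual_apply F (tensor (\<epsilon> (s * (conn i * g))) (\<epsilon> (star (conn i * g))))) else 0)"
proof -
  note Mi = M[OF rep_idempotent[OF i]]
  have "dual_apply (bidual_lact ptensor_lact (\<epsilon> s) (diagonal i)) F =
    complex_mean (M (rep i)) (\<lambda>g. dual_apply (adjoint (ptensor_lact (\<epsilon> s)) F) (tensor (\<epsilon> (conn i * g)) (\<epsilon> (star (conn i * g)))))"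
    by (simp only: bidual_lact_apply[OF ptensor_lact(1)] diagonal_apply[OF i])
  also have "\<dots> = complex_mean (M (rep i)) (\<lambda>g. if star s * s = i
      then dual_apply F (tensor (\<epsilon> (s * (conn i * g))) (\<epsilon> (star (conn i * g)))) else 0)"
  proof (rule complex_mean(5)[OF Mi norm_tensor_basis])
    fix g assume g: "g \<in> carrier (maximal_subgroup (rep i))"
    have "tensor (0 :: 's ell1) (y :: 's ell1) = 0" for y
      by (rule bounded_clinearD(3)[OF bounded_cbilinearD(1)[OF bounded_cbilinear_tensor]])
    then show "dual_apply (adjoint (ptensor_lact (\<epsilon> s)) F) (tensor (\<epsilon> (conn i * g)) (\<epsilon> (star (conn i * g)))) =
      (if star s * s = i then dual_apply F (tensor (\<epsilon> (s * (conn i * g))) (\<epsilon> (star (conn i * g)))) else 0)"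
      by (simp add: ptensor_lact groupoid_basis_mult[OF fin card] conn_mult_star[OF i g] dual_apply_linear
          del: star_mult)
  qed
  finally show ?thesis by (simp add: complex_mean_const[OF Mi])
qed

lemma diagonal_ract:
  assumes i: "i \<in> idempotents"
  shows "dual_apply (bidual_ract ptensor_ract (diagonal i) (\<epsilon> s)) F = (if s * star s = i
    then complex_mean (M (rep i)) (\<lambda>g. dual_apply F (tensor (\<epsilon> (conn i * g)) (\<epsilon> (star (conn i * g) * s)))) else 0)"
proof -
  note Mi = M[OF rep_idempotent[OF i]]
  have "dual_apply (bidual_ract ptensor_ract (diagonal i) (\<epsilon> s)) F =
    complex_mean (M (rep i)) (\<lambda>g. dual_apply (adjoint (\<lambda>u. ptensor_ract u (\<epsilon> s)) F) (tensor (\<epsilon> (conn i * g)) (\<epsilon> (star (conn i * g)))))"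
    by (simp only: bidual_ract_apply[OF ptensor_ract(1)] diagonal_apply[OF i])
  also have "\<dots> = complex_mean (M (rep i)) (\<lambda>g. if s * star s = i
      then dual_apply F (tensor (\<epsilon> (conn i * g)) (\<epsilon> (star (conn i * g) * s))) else 0)"
  proof (rule complex_mean(5)[OF Mi norm_tensor_basis])
    fix g assume g: "g \<in> carrier (maximal_subgroup (rep i))"
    have "tensor (y :: 's ell1) (0 :: 's ell1) = 0" for y
      by (rule bounded_clinearD(3)[OF bounded_cbilinearD(2)[OF bounded_cbilinear_tensor]])
    moreover have "i = s * star s \<longleftrightarrow> s * star s = i" by auto
    ultimately show "dual_apply (adjoint (\<lambda>u. ptensor_ract u (\<epsilon> s)) F) (tensor (\<epsilon> (conn i * g)) (\<epsilon> (star (conn i * g)))) =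
      (if s * star s = i then dual_apply F (tensor (\<epsilon> (conn i * g)) (\<epsilon> (star (conn i * g) * s))) else 0)"
      by (simp add: ptensor_ract groupoid_basis_mult[OF fin card] conn_mult_star[OF i g] dual_apply_linear
          del: star_mult)
  qed
  finally show ?thesis by (simp add: complex_mean_const[OF Mi])
qed

text \<open>With \<open>h = x\<^sup>*\<^sub>l s x\<^sub>k\<close> in the maximal subgroup, where \<open>k = s\<^sup>* s\<close> and \<open>l = s s\<^sup>*\<close>, the two sides differ by
  the substitution of \<open>h g\<close> for \<open>g\<close>.\<close>

lemma diagonal_commute:
  "dual_apply (bidual_lact ptensor_lact (\<epsilon> s) (diagonal (star s * s))) F =
    dual_apply (bidual_ract ptensor_ract (diagonal (s * star s)) (\<epsilon> s)) F"
proof -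
  let ?k = "star s * s" and ?l = "s * star s"
  have kl: "?k \<in> idempotents" "?l \<in> idempotents" by (rule idempotents_star)+
  have "?k \<in> D_idempotents ?l" by (auto simp: D_idempotents_def)
  then have rep: "rep ?k = rep ?l" by (rule rep_eq)
  let ?q = "rep ?l" and ?h = "star (conn ?l) * s * conn ?k"
  note k = conn[OF kl(1), unfolded rep] and l = conn[OF kl(2)]
  have h: "?h \<in> carrier (maximal_subgroup ?q)"
  proof -
    have "?h * star ?h = star (conn ?l) * s * (conn ?k * star (conn ?k)) * star s * conn ?l" by (simp add: mult.assoc)
    also have "\<dots> = star (conn ?l) * ?l * conn ?l" by (simp only: k) (simp add: mult.assoc)
    also have "\<dots> = star (conn ?l) * (conn ?l * star (conn ?l)) * conn ?l" by (simp only: l)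
    also have "\<dots> = star (conn ?l) * conn ?l" by (simp add: mult.assoc)
    also have "\<dots> = ?q" by (rule l)
    finally have 1: "?h * star ?h = ?q" .
    have "star ?h * ?h = star (conn ?k) * star s * (conn ?l * star (conn ?l)) * s * conn ?k" by (simp add: mult.assoc)
    also have "\<dots> = star (conn ?k) * ?k * conn ?k" by (simp only: l) (simp add: mult.assoc)
    also have "\<dots> = star (conn ?k) * (conn ?k * star (conn ?k)) * conn ?k" by (simp only: k)
    also have "\<dots> = star (conn ?k) * conn ?k" by (simp add: mult.assoc)
    also have "\<dots> = ?q" by (rule k)
    finally show ?thesis using 1 by (simp add: maximal_subgroup_def)
  qed
  \<comment> \<open>After the substitution the first tensor factor carries \<open>s\<close> on its
    left, while in the second \<open>s\<close> cancels on the right: this is the integrand of the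
    left action.\<close>
  have sub: "conn ?l * (?h * g) = s * (conn ?k * g)" "star (s * (conn ?k * g)) * s = star (conn ?k * g)" for g
  proof -
    have "conn ?l * (?h * g) = (conn ?l * star (conn ?l)) * s * (conn ?k * g)" by (simp only: mult.assoc)
    also have "\<dots> = s * (conn ?k * g)" by (simp only: l) (simp add: mult.assoc)
    finally show "conn ?l * (?h * g) = s * (conn ?k * g)" .
    have "star (s * (conn ?k * g)) * s = star g * (star (conn ?k) * ?k)" by (simp add: mult.assoc)
    also have "\<dots> = star g * (star (conn ?k) * (conn ?k * star (conn ?k)))" by (simp only: k)
    finally show "star (s * (conn ?k * g)) * s = star (conn ?k * g)" by simp
  qed
  let ?\<phi> = "\<lambda>g. dual_apply F (tensor (\<epsilon> (conn ?l * g)) (\<epsilon> (star (conn ?l * g) * s)))"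
  have "complex_mean (M ?q) ?\<phi> = complex_mean (M ?q) (\<lambda>g. ?\<phi> (?h \<otimes>\<^bsub>maximal_subgroup ?q\<^esub> g))"
    by (rule complex_mean(4)[OF M[OF rep_idempotent[OF kl(2)]] norm_tensor_basis h, symmetric])
  also have "\<dots> = complex_mean (M ?q) (\<lambda>g. ?\<phi> (?h * g))" by (simp add: maximal_subgroup_def)
  finally show ?thesis
    by (simp only: diagonal_lact[OF kl(1)] diagonal_ract[OF kl(2)] sub rep simp_thms if_True)
qed

text \<open>The two tensor factors multiply to \<open>\<epsilon> i\<close> for every
  \<open>g\<close>, and a mean returns constants.\<close>

lemma diagonal_prod:
  assumes i: "i \<in> idempotents"
  shows "adjoint (adjoint ptensor_prod) (diagonal i) = bidual_embed (\<epsilon> i)"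
proof (rule cdual_eqI)
  fix f :: "'s ell1 cdual"
  note Mi = M[OF rep_idempotent[OF i]]
  have "dual_apply (adjoint (adjoint ptensor_prod) (diagonal i)) f = complex_mean (M (rep i))
    (\<lambda>g. dual_apply (adjoint ptensor_prod f) (tensor (\<epsilon> (conn i * g)) (\<epsilon> (star (conn i * g)))))"
    by (simp only: adjoint_apply[OF bounded_clinear_adjoint[OF ptensor_prod(1)]] diagonal_apply[OF i])
  also have "\<dots> = complex_mean (M (rep i)) (\<lambda>_. dual_apply f (\<epsilon> i))"
    by (rule complex_mean(5)[OF Mi norm_tensor_basis])
       (simp add: ptensor_prod groupoid_basis_mult[OF fin card] conn_mult_star[OF i] del: star_mult)
  finally show "dual_apply (adjoint (adjoint ptensor_prod) (diagonal i)) f = dual_apply (bidual_embed (\<epsilon> i)) f"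
    by (simp add: complex_mean_const[OF Mi])
qed

section \<open>Sums over finitely many full D-classes\<close>

context
  fixes \<Lambda> :: "'s set"
  assumes \<Lambda>: "finite \<Lambda>" "\<Lambda> \<subseteq> idempotents" "\<And>i j. i \<in> \<Lambda> \<Longrightarrow> j \<in> D_idempotents i \<Longrightarrow> j \<in> \<Lambda>"
begin

text \<open>It is enough to take \<open>a = \<epsilon> s\<close>. Only the summand at
  \<open>star s * s\<close> sees the left action and only the one at \<open>s * star s\<close> the
  right action. These idempotents are related, so \<open>\<Lambda>\<close> contains both or neither,
  and \<open>diagonal_commute\<close> identifies the contributions.\<close>

lemma sum_diagonal_commute:
  "bidual_lact ptensor_lact a (sum diagonal \<Lambda>) = bidual_ract ptensor_ract (sum diagonal \<Lambda>) a"
proof (rule cdual_eqI, rule groupoid_basis_eqI[OF fin card bounded_clinear_bidual_ptensor_act])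
  fix F :: "('s ell1, 's ell1) ptensor cdual" and s :: 's
  have "star s * s \<in> D_idempotents (s * star s)" by (auto simp: D_idempotents_def)
  then have iff: "star s * s \<in> \<Lambda> \<longleftrightarrow> s * star s \<in> \<Lambda>" using \<Lambda>(3) D_idempotents_sym by blast
  have "dual_apply (bidual_lact ptensor_lact (\<epsilon> s) (sum diagonal \<Lambda>)) F =
      (\<Sum>i\<in>\<Lambda>. dual_apply (bidual_lact ptensor_lact (\<epsilon> s) (diagonal i)) F)"
    by (simp add: bidual_lact_apply[OF ptensor_lact(1)])
  also have "\<dots> = (\<Sum>i\<in>\<Lambda>. if star s * s = i then dual_apply (bidual_lact ptensor_lact (\<epsilon> s) (diagonal i)) F else 0)"
    using \<Lambda>(2) by (intro sum.cong) (auto simp: diagonal_lact)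
  also have "\<dots> = (if star s * s \<in> \<Lambda> then dual_apply (bidual_lact ptensor_lact (\<epsilon> s) (diagonal (star s * s))) F else 0)"
    using \<Lambda>(1) by (simp only: sum.delta')
  also have "\<dots> = (if s * star s \<in> \<Lambda> then dual_apply (bidual_ract ptensor_ract (diagonal (s * star s)) (\<epsilon> s)) F else 0)"
    by (simp only: iff diagonal_commute)
  also have "\<dots> = (\<Sum>i\<in>\<Lambda>. if s * star s = i then dual_apply (bidual_ract ptensor_ract (diagonal i) (\<epsilon> s)) F else 0)"
    using \<Lambda>(1) by (simp only: sum.delta')
  also have "\<dots> = (\<Sum>i\<in>\<Lambda>. dual_apply (bidual_ract ptensor_ract (diagonal i) (\<epsilon> s)) F)"
    using \<Lambda>(2) by (intro sum.cong) (auto simp: diagonal_ract)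
  also have "\<dots> = dual_apply (bidual_ract ptensor_ract (sum diagonal \<Lambda>) (\<epsilon> s)) F"
    by (simp add: bidual_ract_apply[OF ptensor_ract(1)])
  finally show "dual_apply (bidual_lact ptensor_lact (\<epsilon> s) (sum diagonal \<Lambda>)) F =
    dual_apply (bidual_ract ptensor_ract (sum diagonal \<Lambda>) (\<epsilon> s)) F" .
qed

lemma sum_diagonal_prod:
  "adjoint (adjoint ptensor_prod) (sum diagonal \<Lambda>) = bidual_embed (sum \<epsilon> \<Lambda>)"
proof (rule cdual_eqI)
  fix f :: "'s ell1 cdual"
  have "adjoint (adjoint ptensor_prod) (sum diagonal \<Lambda>) = (\<Sum>i\<in>\<Lambda>. bidual_embed (\<epsilon> i))"
    unfolding bounded_clinearD(5)[OF bounded_clinear_adjoint[OF bounded_clinear_adjoint[OF ptensor_prod(1)]]]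
    using \<Lambda>(2) by (intro sum.cong refl diagonal_prod) blast
  then show "dual_apply (adjoint (adjoint ptensor_prod) (sum diagonal \<Lambda>)) f = dual_apply (bidual_embed (sum \<epsilon> \<Lambda>)) f"
    by (simp add: dual_apply_linear)
qed

text \<open>Each \<open>\<epsilon> i\<close> is a local unit at \<open>i\<close>, so the sum is a
  unit on the span of the chosen classes and annihilates the others.\<close>

lemma sum_basis_mult:
  "sum \<epsilon> \<Lambda> * \<epsilon> s = (if s * star s \<in> \<Lambda> then \<epsilon> s else 0)"
  "\<epsilon> s * sum \<epsilon> \<Lambda> = (if star s * s \<in> \<Lambda> then \<epsilon> s else 0)"
proof -
  have ii: "star i * i = i" "i * star i = i" if "i \<in> \<Lambda>" for i
    using that \<Lambda>(2) by (auto simp: star_idempotent idempotentsD)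
  have "sum \<epsilon> \<Lambda> * \<epsilon> s = (\<Sum>i\<in>\<Lambda>. if s * star s = i then \<epsilon> s else 0)"
    unfolding sum_distrib_right groupoid_basis_mult[OF fin card]
    by (intro sum.cong) (auto simp: ii mult.assoc)
  then show "sum \<epsilon> \<Lambda> * \<epsilon> s = (if s * star s \<in> \<Lambda> then \<epsilon> s else 0)" using \<Lambda>(1) by (simp add: sum.delta')
  have "\<epsilon> s * sum \<epsilon> \<Lambda> = (\<Sum>i\<in>\<Lambda>. if star s * s = i then \<epsilon> s else 0)"
    unfolding sum_distrib_left groupoid_basis_mult[OF fin card]
    by (intro sum.cong) (auto simp: ii)
  then show "\<epsilon> s * sum \<epsilon> \<Lambda> = (if star s * s \<in> \<Lambda> then \<epsilon> s else 0)" using \<Lambda>(1) by (simp add: sum.delta')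
qed

lemma sum_basis_central: "sum \<epsilon> \<Lambda> * a = a * sum \<epsilon> \<Lambda>"
proof (rule groupoid_basis_eqI[OF fin card bounded_clinear_mult])
  fix s :: 's
  have "star s * s \<in> D_idempotents (s * star s)" by (auto simp: D_idempotents_def)
  then have "star s * s \<in> \<Lambda> \<longleftrightarrow> s * star s \<in> \<Lambda>" using \<Lambda>(3) D_idempotents_sym by blast
  then show "sum \<epsilon> \<Lambda> * \<epsilon> s = \<epsilon> s * sum \<epsilon> \<Lambda>" by (simp add: sum_basis_mult)
qed

text \<open>The point mass at \<open>s\<close> is a sum of at most \<open>N\<close> basis elements,
  each of which is kept or deleted. The bound is the same for all \<open>\<Lambda>\<close>, as
  \<open>ell1_bounded_net_tendsto\<close> requires.\<close>

lemma sum_basis_mult_delta: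
  "norm (sum \<epsilon> \<Lambda> * ell1_delta s) \<le> real N * C"
  "(\<And>u. u \<in> below s \<Longrightarrow> u * star u \<in> \<Lambda>) \<Longrightarrow> sum \<epsilon> \<Lambda> * ell1_delta s = ell1_delta s"
proof -
  have eq: "sum \<epsilon> \<Lambda> * ell1_delta s = (\<Sum>u\<in>below s. if u * star u \<in> \<Lambda> then \<epsilon> u else 0)"
    by (simp only: delta_eq_sum_groupoid_basis[OF fin card, of s] sum_distrib_left sum_basis_mult)
  have "norm (sum \<epsilon> \<Lambda> * ell1_delta s) \<le> (\<Sum>u\<in>below s. C)"
    unfolding eq by (rule sum_norm_le) (simp add: norm_groupoid_basis_le[OF fin card])
  also have "\<dots> \<le> real N * C" using card[of s] by (simp add: mult_right_mono)
  finally show "norm (sum \<epsilon> \<Lambda> * ell1_delta s) \<le> real N * C" .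
  show "sum \<epsilon> \<Lambda> * ell1_delta s = ell1_delta s" if "\<And>u. u \<in> below s \<Longrightarrow> u * star u \<in> \<Lambda>"
    unfolding eq using that by (simp add: delta_eq_sum_groupoid_basis[OF fin card, of s])
qed

end

section \<open>The net of diagonals\<close>

lemma strong_pseudo_amenable_of_finite_D:
  assumes finD: "\<And>i :: 's. i \<in> idempotents \<Longrightarrow> finite (D_idempotents i)"
  shows "strong_pseudo_amenable TYPE('s ell1)"
proof -
  \<comment> \<open>Finite sets of idempotents are saturated to full D-classes, which stay finite by
    \<open>finD\<close>. The default \<open>{}\<close> covers all other indices, since
    \<open>strong_pseudo_net\<close> demands centrality at every index.\<close>
  define \<Lambda> :: "'s set \<Rightarrow> 's set"
    where "\<Lambda> Y = (if finite Y \<and> Y \<subseteq> idempotents then \<Union> (D_idempotents ` Y) else {})" for Y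
  have \<Lambda>: "finite (\<Lambda> Y)" "\<Lambda> Y \<subseteq> idempotents" "\<And>i j. i \<in> \<Lambda> Y \<Longrightarrow> j \<in> D_idempotents i \<Longrightarrow> j \<in> \<Lambda> Y" for Y
    using finD D_idempotents_subset D_idempotents_trans by (auto simp: \<Lambda>_def split: if_splits) blast+
  note props = sum_diagonal_commute[OF \<Lambda>] sum_diagonal_prod[OF \<Lambda>] sum_basis_central[OF \<Lambda>]
  have unit: "((\<lambda>Y. sum \<epsilon> (\<Lambda> Y) * a) \<longlongrightarrow> a) (finite_subsets_at_top idempotents)" for a
  proof (rule ell1_bounded_net_tendsto[OF bounded_clinear_mult(1) sum_basis_mult_delta(1)[OF \<Lambda>]])
    fix s :: 's
    \<comment> \<open>Once \<open>Y\<close> contains the ranges of all elements below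
      \<open>s\<close>, no term in the expansion of the point mass at \<open>s\<close> is
      deleted.\<close>
    let ?X = "(\<lambda>u. u * star u) ` below s"
    show "\<forall>\<^sub>F Y in finite_subsets_at_top idempotents. sum \<epsilon> (\<Lambda> Y) * ell1_delta s = ell1_delta s"
      unfolding eventually_finite_subsets_at_top
    proof (intro exI[of _ ?X] conjI allI impI)
      show "finite ?X" using fin by simp
      show "?X \<subseteq> idempotents" using idempotents_star by blast
      fix Y assume Y: "finite Y \<and> ?X \<subseteq> Y \<and> Y \<subseteq> idempotents"
      then have YL: "Y \<subseteq> \<Lambda> Y" by (simp add: \<Lambda>_def) (blast intro: D_idempotents_refl)
      then show "sum \<epsilon> (\<Lambda> Y) * ell1_delta s = ell1_delta s"
        by (intro sum_basis_mult_delta(2)[OF \<Lambda>]) (use Y YL in auto)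
    qed
  qed
  have "strong_pseudo_net (\<lambda>Y. sum diagonal (\<Lambda> Y)) (finite_subsets_at_top idempotents)"
    unfolding strong_pseudo_net_def
  proof (intro conjI allI)
    show "finite_subsets_at_top idempotents \<noteq> bot" by simp
    fix a :: "'s ell1"
    show "((\<lambda>Y. bidual_lact ptensor_lact a (sum diagonal (\<Lambda> Y)) - bidual_ract ptensor_ract (sum diagonal (\<Lambda> Y)) a) \<longlongrightarrow> 0)
      (finite_subsets_at_top idempotents)"
      by (simp add: props)
    show "bidual_lact (*) a (adjoint (adjoint ptensor_prod) (sum diagonal (\<Lambda> Y))) =
      bidual_ract (*) (adjoint (adjoint ptensor_prod) (sum diagonal (\<Lambda> Y))) a" for Y
      by (simp add: props bidual_act_embed)
    have "((\<lambda>Y. bidual_embed (sum \<epsilon> (\<Lambda> Y) * a) - bidual_embed a) \<longlongrightarrow> 0) (finite_subsets_at_top idempotents)"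
    proof (rule Lim_null_comparison)
      show "((\<lambda>Y. norm (sum \<epsilon> (\<Lambda> Y) * a - a)) \<longlongrightarrow> 0) (finite_subsets_at_top idempotents)"
        using unit[of a] by (intro tendsto_norm_zero) (simp add: LIM_zero_iff)
      show "\<forall>\<^sub>F Y in finite_subsets_at_top idempotents.
        norm (bidual_embed (sum \<epsilon> (\<Lambda> Y) * a) - bidual_embed a) \<le> norm (sum \<epsilon> (\<Lambda> Y) * a - a)"
        by (intro always_eventually allI) (simp add: norm_bidual_embed_le flip: bidual_embed_diff)
    qed
    then show "((\<lambda>Y. bidual_ract (*) (adjoint (adjoint ptensor_prod) (sum diagonal (\<Lambda> Y))) a) \<longlongrightarrow> bidual_embed a)
      (finite_subsets_at_top idempotents)"
      by (simp add: props(2) bidual_act_embed LIM_zero_iff)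
  qed
  then show ?thesis by (rule strong_pseudo_amenableI)
qed

end

section \<open>The equivalence, from its two directions\<close>

theorem theorem4p5:
  assumes "uniformly_locally_finite (idempotents :: 's::inverse_semigroup set) natural_le"
  shows "strong_pseudo_amenable TYPE('s ell1) \<longleftrightarrow>
    (\<forall>p \<in> (idempotents :: 's set). amenable_group (maximal_subgroup p)) \<and>
    (\<forall>D \<in> (UNIV :: 's set) // D_relation. finite (D \<inter> idempotents))"
proof
  assume spa: "strong_pseudo_amenable TYPE('s ell1)"
  have "finite (D \<inter> idempotents)" if "D \<in> (UNIV :: 's set) // D_relation" for D
    using that by (rule quotientE) (simp add: D_relation_idempotents finite_D_class_idempotents[OF assms spa] idempotents_star)
  then show "(\<forall>p \<in> (idempotents :: 's set). amenable_group (maximal_subgroup p)) \<and>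
      (\<forall>D \<in> (UNIV :: 's set) // D_relation. finite (D \<inter> idempotents))"
    using amenable_maximal_subgroup[OF spa] by blast
next
  assume *: "(\<forall>p \<in> (idempotents :: 's set). amenable_group (maximal_subgroup p)) \<and>
    (\<forall>D \<in> (UNIV :: 's set) // D_relation. finite (D \<inter> idempotents))"
  obtain N where N: "\<forall>x\<in>(idempotents::'s set). finite {y \<in> idempotents. natural_le y x} \<and>
    card {y \<in> idempotents. natural_le y x} \<le> N" using assms unfolding uniformly_locally_finite_def by blast
  define M where "M p = (SOME M. invariant_mean (maximal_subgroup (p :: 's)) M)" for p
  have "invariant_mean (maximal_subgroup p) (M p)" if "p \<in> idempotents" for p
  proof -
    have "\<exists>M. invariant_mean (maximal_subgroup p) M" using * that by (simp add: amenable_group_def)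
    then show ?thesis unfolding M_def by (rule someI_ex)
  qed
  then interpret amenable_ulf N M using below_finite_card[OF N] by unfold_locales
  have "finite (D_idempotents i)" if "i \<in> idempotents" for i :: 's
  proof -
    have "D_relation `` {i} \<in> (UNIV :: 's set) // D_relation" by (rule quotientI) simp
    then have "finite (D_relation `` {i} \<inter> idempotents)" using * by blast
    then show ?thesis using that by (simp add: D_relation_idempotents star_idempotent idempotentsD)
  qed
  then show "strong_pseudo_amenable TYPE('s ell1)" by (rule strong_pseudo_amenable_of_finite_D)
qed

end
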